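(* Let $k$ be a countable algebraically closed field. Then there exists a finitely generated (affine) $k$-algebra $A$ which is right Goldie, not simple, and just infinite over $k$, but which is not stably just infinite.
   Context: All rings are associative unital algebras over a field. A $k$-algebra $A$ is called just infinite (dimensional) if $\dim_k(A)=\infty$ and every nonzero two-sided ideal of $A$ has finite codimension in $A$. A just infinite $k$-algebra $A$ is called stably just infinite if $A\otimes_k K$ is just infinite over $K$ for every field extension $K/k$. *)

theory Defs
  imports "HOL-Algebra.Algebraic_Closure" "HOL-Algebra.Module" "HOL-Algebra.QuotRing"
    "HOL-Library.Countable_Set"
begin

definition kalgebra :: "('k, 'c) ring_scheme \<Rightarrow> ('k, 'a) module \<Rightarrow> bool" where
  "kalgebra k A \<longleftrightarrow> field k \<and> ring A \<and> module k A \<and>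
     (\<forall>c\<in>carrier k. \<forall>x\<in>carrier A. \<forall>y\<in>carrier A.
        (c \<odot>\<^bsub>A\<^esub> x) \<otimes>\<^bsub>A\<^esub> y = c \<odot>\<^bsub>A\<^esub> (x \<otimes>\<^bsub>A\<^esub> y) \<and>
        x \<otimes>\<^bsub>A\<^esub> (c \<odot>\<^bsub>A\<^esub> y) = c \<odot>\<^bsub>A\<^esub> (x \<otimes>\<^bsub>A\<^esub> y))"

definition lspan :: "('k, 'c) ring_scheme \<Rightarrow> ('k, 'a) module \<Rightarrow> 'a set \<Rightarrow> 'a set" where
  "lspan k A S = {finsum A (\<lambda>s. c s \<odot>\<^bsub>A\<^esub> s) T | T c. finite T \<and> T \<subseteq> S \<and> c \<in> T \<rightarrow> carrier k}"

definition fin_codim :: "('k, 'c) ring_scheme \<Rightarrow> ('k, 'a) module \<Rightarrow> 'a set \<Rightarrow> bool" where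
  "fin_codim k A I \<longleftrightarrow> (\<exists>S. finite S \<and> S \<subseteq> carrier A \<and>
     (\<forall>a\<in>carrier A. \<exists>s\<in>lspan k A S. \<exists>i\<in>I. a = s \<oplus>\<^bsub>A\<^esub> i))"

definition infinite_dim :: "('k, 'c) ring_scheme \<Rightarrow> ('k, 'a) module \<Rightarrow> bool" where
  "infinite_dim k A \<longleftrightarrow> \<not> fin_codim k A {\<zero>\<^bsub>A\<^esub>}"

definition just_infinite :: "('k, 'c) ring_scheme \<Rightarrow> ('k, 'a) module \<Rightarrow> bool" where
  "just_infinite k A \<longleftrightarrow> kalgebra k A \<and> infinite_dim k A \<and>
     (\<forall>I. ideal I A \<and> I \<noteq> {\<zero>\<^bsub>A\<^esub>} \<longrightarrow> fin_codim k A I)"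

inductive_set gen_subalg :: "('k, 'c) ring_scheme \<Rightarrow> ('k, 'a) module \<Rightarrow> 'a set \<Rightarrow> 'a set"
  for k A G where
    gen: "g \<in> G \<Longrightarrow> g \<in> gen_subalg k A G"
  | one: "\<one>\<^bsub>A\<^esub> \<in> gen_subalg k A G"
  | add: "x \<in> gen_subalg k A G \<Longrightarrow> y \<in> gen_subalg k A G \<Longrightarrow> x \<oplus>\<^bsub>A\<^esub> y \<in> gen_subalg k A G"
  | mult: "x \<in> gen_subalg k A G \<Longrightarrow> y \<in> gen_subalg k A G \<Longrightarrow> x \<otimes>\<^bsub>A\<^esub> y \<in> gen_subalg k A G"
  | smult: "c \<in> carrier k \<Longrightarrow> x \<in> gen_subalg k A G \<Longrightarrow> c \<odot>\<^bsub>A\<^esub> x \<in> gen_subalg k A G"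

definition finitely_generated :: "('k, 'c) ring_scheme \<Rightarrow> ('k, 'a) module \<Rightarrow> bool" where
  "finitely_generated k A \<longleftrightarrow> (\<exists>G. finite G \<and> G \<subseteq> carrier A \<and> carrier A = gen_subalg k A G)"

definition simple_ring :: "('a, 'b) ring_scheme \<Rightarrow> bool" where
  "simple_ring A \<longleftrightarrow> carrier A \<noteq> {\<zero>\<^bsub>A\<^esub>} \<and> (\<forall>I. ideal I A \<longrightarrow> I = {\<zero>\<^bsub>A\<^esub>} \<or> I = carrier A)"

definition right_ideal :: "'a set \<Rightarrow> ('a, 'b) ring_scheme \<Rightarrow> bool" where
  "right_ideal I A \<longleftrightarrow> additive_subgroup I A \<and> (\<forall>x\<in>I. \<forall>a\<in>carrier A. x \<otimes>\<^bsub>A\<^esub> a \<in> I)"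

definition ideal_sum :: "('a, 'b) ring_scheme \<Rightarrow> (nat \<Rightarrow> 'a set) \<Rightarrow> nat \<Rightarrow> 'a set" where
  "ideal_sum A J n = {finsum A x {..<n} | x. \<forall>m<n. x m \<in> J m}"

definition finite_right_udim :: "('a, 'b) ring_scheme \<Rightarrow> bool" where
  "finite_right_udim A \<longleftrightarrow> \<not> (\<exists>J :: nat \<Rightarrow> 'a set.
      (\<forall>n. right_ideal (J n) A \<and> J n \<noteq> {\<zero>\<^bsub>A\<^esub>}) \<and>
      (\<forall>n. J n \<inter> ideal_sum A J n = {\<zero>\<^bsub>A\<^esub>}))"

definition right_ann :: "('a, 'b) ring_scheme \<Rightarrow> 'a set \<Rightarrow> 'a set" where
  "right_ann A Y = {a \<in> carrier A. \<forall>x\<in>Y. x \<otimes>\<^bsub>A\<^esub> a = \<zero>\<^bsub>A\<^esub>}"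

definition acc_right_ann :: "('a, 'b) ring_scheme \<Rightarrow> bool" where
  "acc_right_ann A \<longleftrightarrow> \<not> (\<exists>Y :: nat \<Rightarrow> 'a set. (\<forall>n. Y n \<subseteq> carrier A) \<and>
      (\<forall>n. right_ann A (Y n) \<subset> right_ann A (Y (Suc n))))"

definition right_goldie :: "('a, 'b) ring_scheme \<Rightarrow> bool" where
  "right_goldie A \<longleftrightarrow> ring A \<and> finite_right_udim A \<and> acc_right_ann A"

(* Tensor product A \<otimes>_k K (for a field extension phi : k \<rightarrow> K), built as the
   K-algebra K[(A,\<cdot>)] of finitely supported functions carrier A \<rightarrow> K
   (convolution along the multiplication of A) modulo the K-span N of the
   k-linearity relations  [x+y]-[x]-[y]  and  [a x]-phi(a)[x]. *)
definition delta :: "('k, 'a) module \<Rightarrow> ('b, 'd) ring_scheme \<Rightarrow> 'a \<Rightarrow> 'a \<Rightarrow> 'b" where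
  "delta A K x = (\<lambda>y. if y = x then \<one>\<^bsub>K\<^esub> else \<zero>\<^bsub>K\<^esub>)"

definition tensor_free :: "('k, 'a) module \<Rightarrow> ('b, 'd) ring_scheme \<Rightarrow> ('b, 'a \<Rightarrow> 'b) module" where
  "tensor_free A K =
    \<lparr>carrier = {f. (\<forall>x. f x \<in> carrier K) \<and> (\<forall>x. x \<notin> carrier A \<longrightarrow> f x = \<zero>\<^bsub>K\<^esub>)
                  \<and> finite {x. f x \<noteq> \<zero>\<^bsub>K\<^esub>}},
     monoid.mult = (\<lambda>f g z. finsum K (\<lambda>p. f (fst p) \<otimes>\<^bsub>K\<^esub> g (snd p))
                      {p. f (fst p) \<noteq> \<zero>\<^bsub>K\<^esub> \<and> g (snd p) \<noteq> \<zero>\<^bsub>K\<^esub> \<and> fst p \<otimes>\<^bsub>A\<^esub> snd p = z}),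
     one = delta A K \<one>\<^bsub>A\<^esub>,
     zero = (\<lambda>x. \<zero>\<^bsub>K\<^esub>),
     add = (\<lambda>f g x. f x \<oplus>\<^bsub>K\<^esub> g x),
     smult = (\<lambda>c f x. c \<otimes>\<^bsub>K\<^esub> f x)\<rparr>"

definition tensor_rel :: "('k, 'c) ring_scheme \<Rightarrow> ('k, 'a) module \<Rightarrow> ('b, 'd) ring_scheme
                           \<Rightarrow> ('k \<Rightarrow> 'b) \<Rightarrow> ('a \<Rightarrow> 'b) set" where
  "tensor_rel k A K phi = lspan K (tensor_free A K)
     ({(delta A K (x \<oplus>\<^bsub>A\<^esub> y) \<ominus>\<^bsub>tensor_free A K\<^esub> delta A K x) \<ominus>\<^bsub>tensor_free A K\<^esub> delta A K y
        | x y. x \<in> carrier A \<and> y \<in> carrier A} \<union>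
      {delta A K (a \<odot>\<^bsub>A\<^esub> x) \<ominus>\<^bsub>tensor_free A K\<^esub> (phi a \<odot>\<^bsub>tensor_free A K\<^esub> delta A K x)
        | a x. a \<in> carrier k \<and> x \<in> carrier A})"

definition tensor :: "('k, 'c) ring_scheme \<Rightarrow> ('k, 'a) module \<Rightarrow> ('b, 'd) ring_scheme
                       \<Rightarrow> ('k \<Rightarrow> 'b) \<Rightarrow> ('b, ('a \<Rightarrow> 'b) set) module" where
  "tensor k A K phi =
    (let F = tensor_free A K; N = tensor_rel k A K phi; Q = F Quot N in
    \<lparr>carrier = carrier Q, monoid.mult = monoid.mult Q, one = one Q, zero = zero Q, add = add Q,
     smult = (\<lambda>c Y. N +>\<^bsub>F\<^esub> (c \<odot>\<^bsub>F\<^esub> (SOME f. f \<in> Y)))\<rparr>)"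

definition stably_just_infinite_in :: "'b itself \<Rightarrow> ('k, 'c) ring_scheme \<Rightarrow> ('k, 'a) module \<Rightarrow> bool" where
  "stably_just_infinite_in (ty :: 'b itself) k A \<longleftrightarrow> just_infinite k A \<and>
     (\<forall>(K :: 'b ring) phi. field K \<and> phi \<in> ring_hom k K \<longrightarrow> just_infinite K (tensor k A K phi))"

end

theory Submission
  imports Defs "HOL-Library.Poly_Mapping"
begin

text \<open>
  Let \<open>K = k(t)\<close> and let \<open>R\<close> be the twisted group algebra over \<open>K\<close> of the lamplighter group
  \<open>\<int> wr \<int>\<close>, generated by a shift \<open>\<sigma>\<close> and by lamps \<open>u\<^sub>i = \<sigma>\<^sup>i u \<sigma>\<^sup>-\<^sup>i\<close> with
  \<open>u\<^sub>i u\<^sub>j = c\<^sub>i\<^sub>-\<^sub>j u\<^sub>j u\<^sub>i\<close> for \<open>i > j\<close>, where the \<open>c\<^sub>n\<close> run through the countable set of units of \<open>K\<close>. Then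
  \<open>R\<close> is a right Ore domain (the group is ordered and built up by extensions with \<open>\<int>\<close>), it is simple, and
  it is generated over \<open>k\<close> by \<open>u\<close>, \<open>\<sigma>\<close> and their inverses, since commutators of lamps yield all of \<open>K\<close>. Put
  \<open>y = 1 + \<sigma>\<close>, which is not a unit, and \<open>A = k + ky + kty + y\<^sup>2R\<close>. By simplicity of \<open>R\<close>, every nonzero ideal
  of \<open>A\<close> contains \<open>y\<^sup>2R\<close>, which has codimension three, and \<open>A\<close> is again affine and right Ore. After extension of
  scalars to \<open>K\<close>, the kernel of the multiplication map \<open>A \<otimes> K \<rightarrow> R\<close> contains \<open>ty \<otimes> 1 - y \<otimes> t\<close>
  and has infinite codimension.
\<close>

section \<open>Fields of fractions\<close>

text \<open>What destroys stability is the centre of R. All of K is central in R, but A meets K y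
  only in the k-plane spanned by y and ty, so the relation t * y = ty, true in R, is lost in A
  \<otimes> K. The obstacle is affineness: K is not finitely generated as a k-algebra, yet R must be
  generated by finitely many elements. In the lamplighter group two generators produce infinitely
  many lamps, and a shift-invariant twist may prescribe one commutator for each distance between
  lamps. Countability of k makes K countable, so a single sequence of commutators can exhaust the
  units of K. The same sequence has to serve simplicity, which needs that no nontrivial
  configuration of lamps commutes with all lamps; this is where t must not be a root of unity. R
  itself is simple and hence not the example: the factor y^2 creates a proper ideal, while A stays
  close enough to R to inherit the Ore condition, finite generation and the control over
  ideals.\<close>

locale fraction_field = domain D for D :: "'d ring" (structure) +
  fixes enc :: "'d \<times> 'd \<Rightarrow> nat"
  assumes enc_inj: "inj_on enc (carrier D \<times> carrier D)"
begin

definition nz :: "'d set"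
  where "nz = carrier D - {\<zero>}"

text \<open>
  The class of \<open>a/b\<close> is coded by a set of natural numbers, because the final field has to
  live on the type \<^typ>\<open>nat set\<close>.
\<close>

definition frac :: "'d \<Rightarrow> 'd \<Rightarrow> nat set"
  where "frac a b = enc ` {(c, d). c \<in> carrier D \<and> d \<in> nz \<and> a \<otimes> d = c \<otimes> b}"

text \<open>\<open>fracs\<close> computes with this arbitrary representative;
  \<open>mult_fracs\<close> and \<open>add_fracs\<close> show that every other one gives the same
  class.\<close>

definition rep :: "nat set \<Rightarrow> 'd \<times> 'd"
  where "rep x = (SOME p. fst p \<in> carrier D \<and> snd p \<in> nz \<and> x = frac (fst p) (snd p))"

definition fracs :: "nat set ring"
  where "fracs = \<lparr>carrier = {frac a b |a b. a \<in> carrier D \<and> b \<in> nz},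
     monoid.mult = (\<lambda>x y. frac (fst (rep x) \<otimes> fst (rep y)) (snd (rep x) \<otimes> snd (rep y))),
     one = frac \<one> \<one>, zero = frac \<zero> \<one>,
     add = (\<lambda>x y. frac (fst (rep x) \<otimes> snd (rep y) \<oplus> fst (rep y) \<otimes> snd (rep x))
                       (snd (rep x) \<otimes> snd (rep y)))\<rparr>"

lemma nz_carrier [simp]: "a \<in> nz \<Longrightarrow> a \<in> carrier D"
  and nz_one [simp]: "\<one> \<in> nz"
  and nz_mult [simp]: "a \<in> nz \<Longrightarrow> b \<in> nz \<Longrightarrow> a \<otimes> b \<in> nz"
  by (auto simp: nz_def integral_iff)

lemma cancel:
  assumes "a \<in> carrier D" "b \<in> carrier D" "c \<in> nz" "a \<otimes> c = b \<otimes> c"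
  shows "a = b"
  using assms m_rcancel[of c a b] by (auto simp: nz_def)

text \<open>Since \<open>enc\<close> is injective, the code of (c, d) lies in the set
  \<open>frac a b\<close> only if (c, d) is itself equivalent to (a, b). The converse is
  transitivity of cross-multiplication, by cancelling a nonzero denominator.\<close>

lemma frac_eq_iff:
  assumes "a \<in> carrier D" "b \<in> nz" "c \<in> carrier D" "d \<in> nz"
  shows "frac a b = frac c d \<longleftrightarrow> a \<otimes> d = c \<otimes> b"
proof
  assume eq: "frac a b = frac c d"
  have "enc (c, d) \<in> frac a b"
    unfolding eq using assms by (auto simp: frac_def)
  then obtain p q where pq: "enc (c, d) = enc (p, q)" "p \<in> carrier D" "q \<in> nz" "a \<otimes> q = p \<otimes> b"
    by (auto simp: frac_def)
  then have "(c, d) = (p, q)"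
    using assms by (intro inj_onD[OF enc_inj]) auto
  with pq show "a \<otimes> d = c \<otimes> b"
    by simp
next
  assume eq: "a \<otimes> d = c \<otimes> b"
  have "a \<otimes> q = p \<otimes> b \<longleftrightarrow> c \<otimes> q = p \<otimes> d" if pq: "p \<in> carrier D" "q \<in> nz" for p q
  proof
    assume "a \<otimes> q = p \<otimes> b"
    then have "(a \<otimes> d) \<otimes> q = (p \<otimes> d) \<otimes> b"
      using assms pq by (metis m_assoc m_comm nz_carrier m_closed)
    then have "(c \<otimes> q) \<otimes> b = (p \<otimes> d) \<otimes> b"
      using assms pq unfolding eq by (simp add: m_ac)
    then show "c \<otimes> q = p \<otimes> d"
      using assms pq by (intro cancel[of "c \<otimes> q" "p \<otimes> d" b]) auto
  next
    assume "c \<otimes> q = p \<otimes> d"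
    then have "(c \<otimes> b) \<otimes> q = (p \<otimes> b) \<otimes> d"
      using assms pq by (metis m_assoc m_comm nz_carrier m_closed)
    then have "(a \<otimes> q) \<otimes> d = (p \<otimes> b) \<otimes> d"
      using assms pq unfolding eq[symmetric] by (simp add: m_ac)
    then show "a \<otimes> q = p \<otimes> b"
      using assms pq by (intro cancel[of "a \<otimes> q" "p \<otimes> b" d]) auto
  qed
  then show "frac a b = frac c d"
    unfolding frac_def by (intro arg_cong[where f="image enc"]) auto
qed

lemma rep_frac:
  assumes "a \<in> carrier D" "b \<in> nz"
  obtains a' b' where "rep (frac a b) = (a', b')" "a' \<in> carrier D" "b' \<in> nz" "a' \<otimes> b = a \<otimes> b'"
proof -
  have "fst (rep (frac a b)) \<in> carrier D \<and> snd (rep (frac a b)) \<in> nz \<and>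
        frac a b = frac (fst (rep (frac a b))) (snd (rep (frac a b)))"
    unfolding rep_def by (rule someI[of _ "(a, b)"]) (use assms in simp)
  then show thesis
    using assms frac_eq_iff that[of "fst (rep (frac a b))" "snd (rep (frac a b))"] by auto
qed

lemma carrier_fracs: "carrier fracs = {frac a b |a b. a \<in> carrier D \<and> b \<in> nz}"
  and one_fracs: "\<one>\<^bsub>fracs\<^esub> = frac \<one> \<one>"
  and zero_fracs: "\<zero>\<^bsub>fracs\<^esub> = frac \<zero> \<one>"
  by (simp_all add: fracs_def)

lemma mult_fracs:
  assumes "a \<in> carrier D" "b \<in> nz" "c \<in> carrier D" "d \<in> nz"
  shows "frac a b \<otimes>\<^bsub>fracs\<^esub> frac c d = frac (a \<otimes> c) (b \<otimes> d)"
proof -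
  obtain a' b' where a: "rep (frac a b) = (a', b')" "a' \<in> carrier D" "b' \<in> nz" "a' \<otimes> b = a \<otimes> b'"
    using rep_frac assms by metis
  obtain c' d' where c: "rep (frac c d) = (c', d')" "c' \<in> carrier D" "d' \<in> nz" "c' \<otimes> d = c \<otimes> d'"
    using rep_frac assms by metis
  have "(a' \<otimes> c') \<otimes> (b \<otimes> d) = (a' \<otimes> b) \<otimes> (c' \<otimes> d)"
    using assms a(2,3) c(2,3) by (simp add: m_ac)
  also have "\<dots> = (a \<otimes> c) \<otimes> (b' \<otimes> d')"
    unfolding a(4) c(4) using assms a(2,3) c(2,3) by (simp add: m_ac)
  finally show ?thesis
    using assms a(1-3) c(1-3) by (simp add: fracs_def frac_eq_iff)
qed

lemma add_fracs:
  assumes "a \<in> carrier D" "b \<in> nz" "c \<in> carrier D" "d \<in> nz"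
  shows "frac a b \<oplus>\<^bsub>fracs\<^esub> frac c d = frac (a \<otimes> d \<oplus> c \<otimes> b) (b \<otimes> d)"
proof -
  obtain a' b' where a: "rep (frac a b) = (a', b')" "a' \<in> carrier D" "b' \<in> nz" "a' \<otimes> b = a \<otimes> b'"
    using rep_frac assms by metis
  obtain c' d' where c: "rep (frac c d) = (c', d')" "c' \<in> carrier D" "d' \<in> nz" "c' \<otimes> d = c \<otimes> d'"
    using rep_frac assms by metis
  have "(a' \<otimes> d' \<oplus> c' \<otimes> b') \<otimes> (b \<otimes> d) = (a' \<otimes> b) \<otimes> (d' \<otimes> d) \<oplus> (c' \<otimes> d) \<otimes> (b' \<otimes> b)"
    using assms a(2,3) c(2,3) by (simp add: l_distr r_distr m_ac)
  also have "\<dots> = (a \<otimes> d \<oplus> c \<otimes> b) \<otimes> (b' \<otimes> d')"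
    unfolding a(4) c(4) using assms a(2,3) c(2,3) by (simp add: l_distr r_distr m_ac)
  finally show ?thesis
    using assms a(1-3) c(1-3) by (simp add: fracs_def frac_eq_iff)
qed

lemma fracE:
  assumes "x \<in> carrier fracs"
  obtains a b where "x = frac a b" "a \<in> carrier D" "b \<in> nz"
  using assms by (auto simp: carrier_fracs)

lemma frac_closed [simp]: "a \<in> carrier D \<Longrightarrow> b \<in> nz \<Longrightarrow> frac a b \<in> carrier fracs"
  by (auto simp: carrier_fracs)

lemma fracs_cring: "cring fracs"
proof (rule cringI)
  show "abelian_group fracs"
  proof (rule abelian_groupI)
    fix x y assume xy: "x \<in> carrier fracs" "y \<in> carrier fracs"
    obtain a b where x: "x = frac a b" "a \<in> carrier D" "b \<in> nz" using xy(1) by (rule fracE)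
    obtain c d where y: "y = frac c d" "c \<in> carrier D" "d \<in> nz" using xy(2) by (rule fracE)
    show "x \<oplus>\<^bsub>fracs\<^esub> y \<in> carrier fracs"
      using x y by (simp add: add_fracs)
    show "x \<oplus>\<^bsub>fracs\<^esub> y = y \<oplus>\<^bsub>fracs\<^esub> x"
      using x y by (simp add: add_fracs a_comm m_comm)
    fix z assume "z \<in> carrier fracs"
    then obtain e f where z: "z = frac e f" "e \<in> carrier D" "f \<in> nz" by (rule fracE)
    show "x \<oplus>\<^bsub>fracs\<^esub> y \<oplus>\<^bsub>fracs\<^esub> z = x \<oplus>\<^bsub>fracs\<^esub> (y \<oplus>\<^bsub>fracs\<^esub> z)"
      using x y z by (simp add: add_fracs l_distr r_distr m_ac a_ac)
  next
    fix x assume "x \<in> carrier fracs"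
    then obtain a b where x: "x = frac a b" "a \<in> carrier D" "b \<in> nz" by (rule fracE)
    show "\<zero>\<^bsub>fracs\<^esub> \<oplus>\<^bsub>fracs\<^esub> x = x"
      using x by (simp add: zero_fracs add_fracs)
    show "\<exists>y\<in>carrier fracs. y \<oplus>\<^bsub>fracs\<^esub> x = \<zero>\<^bsub>fracs\<^esub>"
      using x by (intro bexI[of _ "frac (\<ominus> a) b"])
        (simp_all add: zero_fracs add_fracs frac_eq_iff l_minus l_neg)
  qed (simp add: zero_fracs)
  show "comm_monoid fracs"
  proof (rule comm_monoidI)
    fix x y assume xy: "x \<in> carrier fracs" "y \<in> carrier fracs"
    obtain a b where x: "x = frac a b" "a \<in> carrier D" "b \<in> nz" using xy(1) by (rule fracE)
    obtain c d where y: "y = frac c d" "c \<in> carrier D" "d \<in> nz" using xy(2) by (rule fracE)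
    show "x \<otimes>\<^bsub>fracs\<^esub> y \<in> carrier fracs"
      using x y by (simp add: mult_fracs)
    show "x \<otimes>\<^bsub>fracs\<^esub> y = y \<otimes>\<^bsub>fracs\<^esub> x"
      using x y by (simp add: mult_fracs m_comm)
    fix z assume "z \<in> carrier fracs"
    then obtain e f where z: "z = frac e f" "e \<in> carrier D" "f \<in> nz" by (rule fracE)
    show "x \<otimes>\<^bsub>fracs\<^esub> y \<otimes>\<^bsub>fracs\<^esub> z = x \<otimes>\<^bsub>fracs\<^esub> (y \<otimes>\<^bsub>fracs\<^esub> z)"
      using x y z by (simp add: mult_fracs m_assoc)
  next
    fix x assume "x \<in> carrier fracs"
    then show "\<one>\<^bsub>fracs\<^esub> \<otimes>\<^bsub>fracs\<^esub> x = x"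
      by (elim fracE) (simp add: one_fracs mult_fracs)
  qed (simp add: one_fracs)
  fix x y z assume xyz: "x \<in> carrier fracs" "y \<in> carrier fracs" "z \<in> carrier fracs"
  obtain a b where x: "x = frac a b" "a \<in> carrier D" "b \<in> nz" using xyz(1) by (rule fracE)
  obtain c d where y: "y = frac c d" "c \<in> carrier D" "d \<in> nz" using xyz(2) by (rule fracE)
  obtain e f where z: "z = frac e f" "e \<in> carrier D" "f \<in> nz" using xyz(3) by (rule fracE)
  \<comment> \<open>The two sides of the distributive law carry the different denominators
    \<open>b \<otimes> d \<otimes> f\<close> and
    \<open>b \<otimes> f \<otimes> (d \<otimes> f)\<close>, so they are compared by
    cross-multiplication.\<close>
  have "(a \<otimes> d \<oplus> c \<otimes> b) \<otimes> e \<otimes> (b \<otimes> f \<otimes> (d \<otimes> f)) =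
      (a \<otimes> e \<otimes> (d \<otimes> f) \<oplus> c \<otimes> e \<otimes> (b \<otimes> f)) \<otimes> (b \<otimes> d \<otimes> f)"
    using x(2,3) y(2,3) z(2,3) by (simp add: l_distr r_distr m_ac)
  then show "(x \<oplus>\<^bsub>fracs\<^esub> y) \<otimes>\<^bsub>fracs\<^esub> z = x \<otimes>\<^bsub>fracs\<^esub> z \<oplus>\<^bsub>fracs\<^esub> y \<otimes>\<^bsub>fracs\<^esub> z"
    using x y z by (simp add: mult_fracs add_fracs frac_eq_iff)
qed

lemma fracs_field: "field fracs"
proof -
  interpret F: cring fracs
    by (rule fracs_cring)
  show ?thesis
  proof (rule F.cring_fieldI, rule equalityI)
    have "\<one> \<noteq> \<zero>"
      by simp
    then have ne: "\<one>\<^bsub>fracs\<^esub> \<noteq> \<zero>\<^bsub>fracs\<^esub>"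
      by (simp add: one_fracs zero_fracs frac_eq_iff)
    then show "Units fracs \<subseteq> carrier fracs - {\<zero>\<^bsub>fracs\<^esub>}"
      by (auto simp: Units_def)
    show "carrier fracs - {\<zero>\<^bsub>fracs\<^esub>} \<subseteq> Units fracs"
    proof
      fix x assume x': "x \<in> carrier fracs - {\<zero>\<^bsub>fracs\<^esub>}"
      then obtain a b where x: "x = frac a b" "a \<in> carrier D" "b \<in> nz"
        by (blast elim: fracE)
      then have "a \<in> nz"
        using x' by (auto simp: nz_def[of] zero_fracs frac_eq_iff)
      then have "x \<otimes>\<^bsub>fracs\<^esub> frac b a = \<one>\<^bsub>fracs\<^esub>" "frac b a \<in> carrier fracs"
        using x by (simp_all add: mult_fracs one_fracs frac_eq_iff m_comm)
      then show "x \<in> Units fracs"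
        using x' F.m_comm unfolding Units_def by (metis (mono_tags, lifting) DiffD1 mem_Collect_eq)
    qed
  qed
qed

lemma frac_hom: "(\<lambda>a. frac a \<one>) \<in> ring_hom D fracs"
  by (rule ring_hom_memI) (simp_all add: mult_fracs add_fracs one_fracs)

lemma frac_one_inj: "a \<in> carrier D \<Longrightarrow> b \<in> carrier D \<Longrightarrow> frac a \<one> = frac b \<one> \<longleftrightarrow> a = b"
  by (simp add: frac_eq_iff)

lemma countable_fracs: "countable (carrier D) \<Longrightarrow> countable (carrier fracs)"
proof -
  assume "countable (carrier D)"
  then have "countable ((\<lambda>(a, b). frac a b) ` (carrier D \<times> carrier D))"
    by blast
  moreover have "carrier fracs \<subseteq> (\<lambda>(a, b). frac a b) ` (carrier D \<times> carrier D)"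
    by (auto simp: carrier_fracs)
  ultimately show ?thesis
    by (rule countable_subset[rotated])
qed

end

text \<open>\<open>K\<close> is the fraction field of k[X] and \<open>t\<close> is X. Polynomials
  are finite lists of coefficients, so countability passes from \<open>k\<close> to
  \<open>K\<close>; X is no constant and X^n is a monomial of degree n, so \<open>t\<close> lies
  outside \<open>k\<close> and is not a root of unity.\<close>

lemma transcendental_extension:
  fixes k :: "'k ring"
  assumes "field k" "countable (carrier k)"
  obtains K :: "nat set ring" and phi t
  where "field K" "countable (carrier K)" "phi \<in> ring_hom k K" "t \<in> carrier K"
    "t \<notin> phi ` carrier k" "\<And>n :: nat. n > 0 \<Longrightarrow> t [^]\<^bsub>K\<^esub> n \<noteq> \<one>\<^bsub>K\<^esub>"
proof -
  interpret k: field k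
    by fact
  define D where "D = (carrier k)[X]\<^bsub>k\<^esub>"
  interpret D: domain D
    unfolding D_def by (rule k.univ_poly_is_domain[OF k.carrier_is_subring])
  have "carrier D \<subseteq> lists (carrier k)"
    unfolding D_def univ_poly_def polynomial_def by auto
  then have cD: "countable (carrier D)"
    using assms(2) by (meson countable_lists countable_subset)
  then have "countable (carrier D \<times> carrier D)"
    by simp
  then obtain enc :: "_ \<Rightarrow> nat" where "inj_on enc (carrier D \<times> carrier D)"
    by (rule countableE)
  then interpret fraction_field D enc
    by unfold_locales
  define phi where "phi c = frac (k.poly_of_const c) \<one>\<^bsub>D\<^esub>" for c
  have pc: "k.poly_of_const \<in> ring_hom k D"
    unfolding D_def by (rule k.canonical_embedding_is_hom[OF k.carrier_is_subring, simplified])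
  have "phi \<in> ring_hom k fracs"
    using ring_hom_trans[OF pc frac_hom] by (simp add: phi_def[abs_def] comp_def)
  have X: "X\<^bsub>k\<^esub> \<in> carrier D"
    unfolding D_def by (rule k.var_closed(1)[OF k.carrier_is_subring])
  have 1: "frac X\<^bsub>k\<^esub> \<one>\<^bsub>D\<^esub> \<notin> phi ` carrier k"
  proof
    assume "frac X\<^bsub>k\<^esub> \<one>\<^bsub>D\<^esub> \<in> phi ` carrier k"
    then obtain c where c: "c \<in> carrier k" "frac X\<^bsub>k\<^esub> \<one>\<^bsub>D\<^esub> = frac (k.poly_of_const c) \<one>\<^bsub>D\<^esub>"
      by (auto simp: phi_def)
    then have "X\<^bsub>k\<^esub> = k.poly_of_const c"
      using X ring_hom_closed[OF pc] frac_one_inj by metis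
    then show False
      by (auto simp: var_def k.poly_of_const_def split: if_splits)
  qed
  have 2: "frac X\<^bsub>k\<^esub> \<one>\<^bsub>D\<^esub> [^]\<^bsub>fracs\<^esub> n \<noteq> \<one>\<^bsub>fracs\<^esub>" if "n > 0" for n :: nat
  proof
    assume eq: "frac X\<^bsub>k\<^esub> \<one>\<^bsub>D\<^esub> [^]\<^bsub>fracs\<^esub> n = \<one>\<^bsub>fracs\<^esub>"
    interpret F: field fracs
      by (rule fracs_field)
    have "frac (X\<^bsub>k\<^esub> [^]\<^bsub>D\<^esub> n) \<one>\<^bsub>D\<^esub> = frac X\<^bsub>k\<^esub> \<one>\<^bsub>D\<^esub> [^]\<^bsub>fracs\<^esub> n"
      using X by (induction n) (simp_all add: one_fracs ring_hom_mult[OF frac_hom])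
    then have "X\<^bsub>k\<^esub> [^]\<^bsub>D\<^esub> n = \<one>\<^bsub>D\<^esub>"
      using eq X frac_one_inj by (simp add: one_fracs)
    moreover have "X\<^bsub>k\<^esub> [^]\<^bsub>D\<^esub> n = k.monom \<one>\<^bsub>k\<^esub> n"
      unfolding D_def by (rule k.unitary_monom_eq_var_pow[OF k.carrier_is_subring, symmetric])
    ultimately show False
      using that by (auto simp: D_def univ_poly_one k.monom_def)
  qed
  show thesis
    by (rule that[of fracs phi "frac X\<^bsub>k\<^esub> \<one>\<^bsub>D\<^esub>"])
      (use fracs_field countable_fracs[OF cD] \<open>phi \<in> ring_hom k fracs\<close> X 1 2 in auto)
qed

section \<open>Twisted group algebras\<close>

text \<open>\<open>tw\<close> is a normalised 2-cocycle with values in the units of \<open>K\<close>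
  and trivial action, as associativity of [a][b] = tw(a, b)[a + b] demands. The group is written
  additively although it need not be commutative.\<close>

locale twisted_group = field K for K :: "'b ring" (structure) +
  fixes tw :: "'g::group_add \<Rightarrow> 'g \<Rightarrow> 'b"
  assumes tw_closed [simp]: "tw a b \<in> carrier K"
    and tw_nonzero: "tw a b \<noteq> \<zero>"
    and tw_cocycle: "tw a b \<otimes> tw (a + b) c = tw b c \<otimes> tw a (b + c)"
    and tw_0_left [simp]: "tw 0 a = \<one>"
    and tw_0_right [simp]: "tw a 0 = \<one>"
begin

definition supp :: "('g \<Rightarrow> 'b) \<Rightarrow> 'g set"
  where "supp f = {a. f a \<noteq> \<zero>}"

definition mon :: "'b \<Rightarrow> 'g \<Rightarrow> 'g \<Rightarrow> 'b"
  where "mon c a = (\<lambda>z. if z = a then c else \<zero>)"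

definition fs :: "('g \<Rightarrow> 'b) set"
  where "fs = {f. (\<forall>a. f a \<in> carrier K) \<and> finite (supp f)}"

text \<open>Summing over the support of the left factor alone keeps the product meaningful for every
  right factor with values in \<open>K\<close>.\<close>

definition conv :: "('g \<Rightarrow> 'b) \<Rightarrow> ('g \<Rightarrow> 'b) \<Rightarrow> 'g \<Rightarrow> 'b"
  where "conv f g = (\<lambda>z. \<Oplus>a\<in>supp f. f a \<otimes> (tw a (- a + z) \<otimes> g (- a + z)))"

definition tga :: "('g \<Rightarrow> 'b) ring"
  where "tga = \<lparr>carrier = fs, monoid.mult = conv, one = mon \<one> 0,
                zero = (\<lambda>_. \<zero>), add = (\<lambda>f g z. f z \<oplus> g z)\<rparr>"

lemma tga_simps [simp]:
  "carrier tga = fs" "f \<otimes>\<^bsub>tga\<^esub> g = conv f g" "\<one>\<^bsub>tga\<^esub> = mon \<one> 0"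
  "\<zero>\<^bsub>tga\<^esub> = (\<lambda>_. \<zero>)" "f \<oplus>\<^bsub>tga\<^esub> g = (\<lambda>z. f z \<oplus> g z)"
  by (simp_all add: tga_def)

lemma fsI: "(\<And>a. f a \<in> carrier K) \<Longrightarrow> finite (supp f) \<Longrightarrow> f \<in> fs"
  and fs_finite [simp]: "f \<in> fs \<Longrightarrow> finite (supp f)"
  and fs_closed [simp]: "f \<in> fs \<Longrightarrow> f a \<in> carrier K"
  by (simp_all add: fs_def)

lemma supp_zero [simp]: "supp (\<lambda>_. \<zero>) = {}"
  by (simp add: supp_def)

lemma zero_fs [simp]: "(\<lambda>_. \<zero>) \<in> fs"
  by (simp add: fsI)

lemma supp_eq_empty_iff: "supp f = {} \<longleftrightarrow> f = (\<lambda>_. \<zero>)"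
  by (auto simp: supp_def)

lemma supp_mon: "supp (mon c a) = (if c = \<zero> then {} else {a})"
  by (auto simp: supp_def mon_def)

lemma mon_fs [simp]: "c \<in> carrier K \<Longrightarrow> mon c a \<in> fs"
  by (rule fsI) (auto simp: supp_mon, auto simp: mon_def)

lemma mon_zero [simp]: "mon \<zero> a = (\<lambda>_. \<zero>)"
  by (auto simp: mon_def)

lemma supp_add: "f \<in> fs \<Longrightarrow> g \<in> fs \<Longrightarrow> supp (\<lambda>z. f z \<oplus> g z) \<subseteq> supp f \<union> supp g"
  by (auto simp: supp_def)

lemma add_fs [simp]: "f \<in> fs \<Longrightarrow> g \<in> fs \<Longrightarrow> (\<lambda>z. f z \<oplus> g z) \<in> fs"
  by (rule fsI) (auto intro: finite_subset[OF supp_add])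

lemma uminus_fs [simp]: "f \<in> fs \<Longrightarrow> (\<lambda>z. \<ominus> f z) \<in> fs"
proof -
  assume f: "f \<in> fs"
  have "supp (\<lambda>z. \<ominus> f z) \<subseteq> supp f"
    using f by (auto simp: supp_def)
  with f show ?thesis
    by (auto intro!: fsI intro: finite_subset)
qed

text \<open>Peeling off one monomial at a time reduces every identity that is additive in an
  argument to the case of monomials.\<close>

lemma fs_induct [consumes 1, case_names zero mon add]:
  assumes f: "f \<in> fs" and z: "P (\<lambda>_. \<zero>)"
    and m: "\<And>c a. c \<in> carrier K \<Longrightarrow> P (mon c a)"
    and p: "\<And>f g. f \<in> fs \<Longrightarrow> g \<in> fs \<Longrightarrow> P f \<Longrightarrow> P g \<Longrightarrow> P (\<lambda>z. f z \<oplus> g z)"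
  shows "P f"
  using f
proof (induction "card (supp f)" arbitrary: f)
  case 0
  then have "supp f = {}"
    by simp
  with z show ?case
    by (simp add: supp_eq_empty_iff)
next
  case (Suc n)
  then obtain a where a: "a \<in> supp f"
    by (metis card.empty ex_in_conv nat.distinct(1))
  define g where "g = f(a := \<zero>)"
  have sg: "supp g = supp f - {a}"
    by (auto simp: supp_def g_def)
  have g: "g \<in> fs"
    using Suc.prems sg by (intro fsI) (auto simp: g_def)
  have "P g"
    using Suc sg a g by (intro Suc.hyps) auto
  moreover have "f = (\<lambda>z. mon (f a) a z \<oplus> g z)"
    using Suc.prems by (auto simp: mon_def g_def fun_eq_iff)
  ultimately show ?case
    using p[of "mon (f a) a" g] m[of "f a" a] g Suc.prems by simp
qed

lemma conv_superset:
  assumes "f \<in> fs" "\<And>z. g z \<in> carrier K" "finite S" "supp f \<subseteq> S"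
  shows "conv f g z = (\<Oplus>a\<in>S. f a \<otimes> (tw a (- a + z) \<otimes> g (- a + z)))"
  unfolding conv_def
  by (rule add.finprod_mono_neutral_cong_left) (use assms in \<open>auto simp: supp_def\<close>)

lemma conv_mon:
  assumes "c \<in> carrier K" "\<And>z. g z \<in> carrier K"
  shows "conv (mon c a) g = (\<lambda>z. c \<otimes> (tw a (- a + z) \<otimes> g (- a + z)))"
  by (rule ext, subst conv_superset[where S="{a}"]) (use assms in \<open>auto simp: supp_mon\<close>, simp add: mon_def)

lemma conv_closed [simp]:
  assumes "f \<in> fs" "\<And>z. g z \<in> carrier K"
  shows "conv f g z \<in> carrier K"
  unfolding conv_def by (rule finsum_closed) (use assms in auto)

lemma conv_add_left:
  assumes "f \<in> fs" "f' \<in> fs" "\<And>z. g z \<in> carrier K"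
  shows "conv (\<lambda>z. f z \<oplus> f' z) g = (\<lambda>z. conv f g z \<oplus> conv f' g z)"
proof
  fix z
  let ?S = "supp f \<union> supp f'"
  let ?t = "\<lambda>f a. f a \<otimes> (tw a (- a + z) \<otimes> g (- a + z))"
  have "conv (\<lambda>z. f z \<oplus> f' z) g z = (\<Oplus>a\<in>?S. ?t (\<lambda>z. f z \<oplus> f' z) a)"
    using assms supp_add[of f f'] by (intro conv_superset) auto
  also have "\<dots> = (\<Oplus>a\<in>?S. ?t f a \<oplus> ?t f' a)"
    using assms by (intro finsum_cong') (auto simp: l_distr)
  also have "\<dots> = (\<Oplus>a\<in>?S. ?t f a) \<oplus> (\<Oplus>a\<in>?S. ?t f' a)"
    using assms by (intro finsum_addf) auto
  also have "\<dots> = conv f g z \<oplus> conv f' g z"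
    using assms by (subst (1 2) conv_superset[where S="?S"]) auto
  finally show "conv (\<lambda>z. f z \<oplus> f' z) g z = conv f g z \<oplus> conv f' g z" .
qed

lemma conv_add_right:
  assumes "f \<in> fs" "g \<in> fs" "g' \<in> fs"
  shows "conv f (\<lambda>z. g z \<oplus> g' z) = (\<lambda>z. conv f g z \<oplus> conv f g' z)"
proof
  fix z
  let ?t = "\<lambda>g a. f a \<otimes> (tw a (- a + z) \<otimes> g (- a + z))"
  have "conv f (\<lambda>z. g z \<oplus> g' z) z = (\<Oplus>a\<in>supp f. ?t g a \<oplus> ?t g' a)"
    unfolding conv_def using assms by (intro finsum_cong') (auto simp: r_distr)
  also have "\<dots> = conv f g z \<oplus> conv f g' z"
    unfolding conv_def using assms by (intro finsum_addf) auto
  finally show "conv f (\<lambda>z. g z \<oplus> g' z) z = conv f g z \<oplus> conv f g' z" .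
qed

lemma conv_zero_left [simp]: "conv (\<lambda>_. \<zero>) g = (\<lambda>_. \<zero>)"
  by (simp add: conv_def fun_eq_iff)

lemma supp_conv:
  assumes "f \<in> fs" "g \<in> fs"
  shows "supp (conv f g) \<subseteq> {a + b |a b. a \<in> supp f \<and> b \<in> supp g}"
proof
  fix z assume z: "z \<in> supp (conv f g)"
  show "z \<in> {a + b |a b. a \<in> supp f \<and> b \<in> supp g}"
  proof (rule ccontr)
    assume n: "z \<notin> {a + b |a b. a \<in> supp f \<and> b \<in> supp g}"
    have "g (- a + z) = \<zero>" if "a \<in> supp f" for a
    proof (rule ccontr)
      assume "g (- a + z) \<noteq> \<zero>"
      then have "- a + z \<in> supp g"
        by (simp add: supp_def)
      moreover have "z = a + (- a + z)"
        by (simp add: add.assoc[symmetric])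
      ultimately show False
        using n that by blast
    qed
    then have "conv f g z = \<zero>"
      unfolding conv_def using assms by (intro add.finprod_one_eqI) auto
    with z show False
      by (simp add: supp_def)
  qed
qed

lemma conv_fs [simp]:
  assumes "f \<in> fs" "g \<in> fs"
  shows "conv f g \<in> fs"
proof -
  have "finite ((\<lambda>(a, b). a + b) ` (supp f \<times> supp g))"
    using assms by simp
  moreover have "supp (conv f g) \<subseteq> (\<lambda>(a, b). a + b) ` (supp f \<times> supp g)"
    using supp_conv[OF assms] by (force simp: image_iff)
  ultimately have "finite (supp (conv f g))"
    using finite_subset by blast
  with assms show ?thesis
    by (intro fsI) auto
qed

lemma conv_mon_mon:
  assumes "c \<in> carrier K" "d \<in> carrier K"
  shows "conv (mon c a) (mon d b) = mon (c \<otimes> d \<otimes> tw a b) (a + b)"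
proof -
  have "- a + z = b \<longleftrightarrow> z = a + b" for z
    by (metis add.assoc add.left_inverse add_0 add_minus_cancel)
  with assms show ?thesis
    by (subst conv_mon) (auto simp: mon_def fun_eq_iff m_ac)
qed

text \<open>Once the two left factors are monomials, both sides are explicit functions of z, and
  they agree by the cocycle identity for \<open>a\<close>, \<open>b\<close> and
  \<open>- b + (- a + z)\<close>, the element that completes \<open>a + b\<close> to z.\<close>

lemma conv_assoc_mon:
  assumes "c \<in> carrier K" "g \<in> fs" "h \<in> fs"
  shows "conv (conv (mon c a) g) h = conv (mon c a) (conv g h)"
  using assms(2)
proof (induction rule: fs_induct)
  case zero
  then show ?case
    using assms by (subst (2) conv_mon) (auto simp: conv_mon)
next
  case (mon d b)
  have eq: "- (a + b) + z = - b + (- a + z)" for z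
    by (simp only: group_add_class.minus_add add.assoc)
  have tw: "tw a b \<otimes> tw (a + b) (- (a + b) + z) = tw b (- b + (- a + z)) \<otimes> tw a (- a + z)" for z
    using tw_cocycle[of a b "- b + (- a + z)"] by (simp add: eq)
  have "conv (conv (mon c a) (mon d b)) h
      = (\<lambda>z. c \<otimes> d \<otimes> tw a b \<otimes> (tw (a + b) (- (a + b) + z) \<otimes> h (- (a + b) + z)))"
    using assms mon by (subst conv_mon_mon) (simp_all add: conv_mon)
  also have "\<dots> = (\<lambda>z. c \<otimes> d \<otimes> (tw a b \<otimes> tw (a + b) (- (a + b) + z)) \<otimes> h (- (a + b) + z))"
    using assms mon by (simp add: m_ac)
  also have "\<dots> = (\<lambda>z. c \<otimes> (tw a (- a + z) \<otimes>
      (d \<otimes> (tw b (- b + (- a + z)) \<otimes> h (- b + (- a + z))))))"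
    unfolding tw using assms mon by (simp add: m_ac eq)
  also have "\<dots> = conv (mon c a) (conv (mon d b) h)"
    using assms mon by (simp add: conv_mon)
  finally show ?case .
next
  case (add f g)
  then show ?case
    using assms by (simp add: conv_add_left conv_add_right)
qed

lemma conv_assoc:
  assumes "f \<in> fs" "g \<in> fs" "h \<in> fs"
  shows "conv (conv f g) h = conv f (conv g h)"
  using assms(1)
  by (induction rule: fs_induct) (use assms in \<open>simp_all add: conv_assoc_mon conv_add_left\<close>)

lemma conv_one_right: "f \<in> fs \<Longrightarrow> conv f (mon \<one> 0) = f"
  by (induction rule: fs_induct) (simp_all add: conv_mon_mon conv_add_left)

lemma conv_one_left: "f \<in> fs \<Longrightarrow> conv (mon \<one> 0) f = f"
  by (simp add: conv_mon)

lemma tga_ring: "ring tga"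
proof (rule ringI)
  show "abelian_group tga"
  proof (rule abelian_groupI)
    fix f assume "f \<in> carrier tga"
    then show "\<exists>g\<in>carrier tga. g \<oplus>\<^bsub>tga\<^esub> f = \<zero>\<^bsub>tga\<^esub>"
      by (intro bexI[of _ "\<lambda>z. \<ominus> f z"]) (auto simp: l_neg)
  qed (auto simp: a_ac)
  show "Group.monoid tga"
    by (rule monoidI) (auto simp: conv_assoc conv_one_left conv_one_right)
qed (auto simp: conv_add_left conv_add_right)

sublocale R: ring tga
  by (rule tga_ring)

lemma a_inv_tga: "f \<in> fs \<Longrightarrow> \<ominus>\<^bsub>tga\<^esub> f = (\<lambda>z. \<ominus> f z)"
  by (rule R.minus_equality) (auto simp: l_neg)

lemma a_minus_tga: "f \<in> fs \<Longrightarrow> g \<in> fs \<Longrightarrow> f \<ominus>\<^bsub>tga\<^esub> g = (\<lambda>z. f z \<ominus> g z)"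
  by (simp add: a_minus_def a_inv_tga)

lemma conv_mon_right:
  assumes "c \<in> carrier K" "f \<in> fs"
  shows "conv f (mon c a) = (\<lambda>z. f (z - a) \<otimes> tw (z - a) a \<otimes> c)"
  using assms(2)
proof (induction rule: fs_induct)
  case (mon d b)
  then have "conv (mon d b) (mon c a) = mon (d \<otimes> tw b a \<otimes> c) (b + a)"
    using assms by (subst conv_mon_mon) (simp_all add: m_ac)
  then show ?case
    using assms by (auto simp: mon_def fun_eq_iff diff_eq_eq)
qed (use assms in \<open>simp_all add: conv_add_left l_distr\<close>)

text \<open>Twists and nonzero scalars are invertible, so nothing cancels and a monomial merely
  translates supports.\<close>

lemma supp_conv_mon:
  assumes "f \<in> fs" "c \<in> carrier K" "c \<noteq> \<zero>"
  shows "supp (conv (mon c a) f) = (\<lambda>b. a + b) ` supp f"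
    and "supp (conv f (mon c a)) = (\<lambda>b. b + a) ` supp f"
proof -
  have "z \<in> supp (conv (mon c a) f) \<longleftrightarrow> - a + z \<in> supp f" for z
    using assms by (simp add: conv_mon supp_def integral_iff tw_nonzero)
  moreover have "- a + z \<in> supp f \<longleftrightarrow> z \<in> (\<lambda>b. a + b) ` supp f" for z
    by (auto simp: image_iff add.assoc[symmetric] intro: bexI[of _ "- a + z"])
  ultimately show "supp (conv (mon c a) f) = (\<lambda>b. a + b) ` supp f"
    by blast
  have "z \<in> supp (conv f (mon c a)) \<longleftrightarrow> z - a \<in> supp f" for z
    using assms by (simp add: conv_mon_right supp_def integral_iff tw_nonzero)
  moreover have "z - a \<in> supp f \<longleftrightarrow> z \<in> (\<lambda>b. b + a) ` supp f" for z
    by (auto simp: image_iff intro: bexI[of _ "z - a"])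
  ultimately show "supp (conv f (mon c a)) = (\<lambda>b. b + a) ` supp f"
    by blast
qed

definition kap :: "'b \<Rightarrow> 'g \<Rightarrow> 'b"
  where "kap c = mon c 0"

lemma conv_kap: "c \<in> carrier K \<Longrightarrow> f \<in> fs \<Longrightarrow> conv (kap c) f = (\<lambda>z. c \<otimes> f z)"
  by (simp add: kap_def conv_mon)

lemma kap_hom: "kap \<in> ring_hom K tga"
  by (rule ring_hom_memI) (auto simp: kap_def conv_mon_mon, auto simp: mon_def)

lemma kap_central: "c \<in> carrier K \<Longrightarrow> f \<in> fs \<Longrightarrow> conv (kap c) f = conv f (kap c)"
  by (simp add: kap_def conv_mon conv_mon_right m_comm)

text \<open>A finitely supported function is determined by its finite graph over the
  support.\<close>

lemma countable_fs:
  assumes "countable (carrier K)" "countable (UNIV :: 'g set)"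
  shows "countable fs"
proof -
  let ?e = "\<lambda>f. (\<lambda>a. (a, f a)) ` supp f"
  have "inj_on ?e fs"
  proof (rule inj_onI, rule ext)
    fix f g a assume "f \<in> fs" "g \<in> fs" "?e f = ?e g"
    moreover have "(a, c) \<in> ?e f \<longleftrightarrow> c = f a \<and> f a \<noteq> \<zero>" for f c
      by (auto simp: supp_def)
    ultimately show "f a = g a"
      by metis
  qed
  moreover have "?e ` fs \<subseteq> {S. finite S \<and> S \<subseteq> UNIV \<times> carrier K}"
    by auto
  moreover have "countable {S. finite S \<and> S \<subseteq> (UNIV :: 'g set) \<times> carrier K}"
    using assms by (intro countable_Collect_finite_subset) auto
  ultimately show ?thesis
    by (meson countable_image_inj_on countable_subset)
qed

end

section \<open>The Ore condition for ordered groups\<close>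

locale ordered_twisted_group = twisted_group K tw
  for K :: "'b ring" (structure) and tw :: "'g::{group_add, linorder} \<Rightarrow> 'g \<Rightarrow> 'b" +
  assumes add_less_left: "b < c \<Longrightarrow> a + b < (a + c :: 'g)"
    and add_less_right: "b < c \<Longrightarrow> b + a < (c + a :: 'g)"
begin

text \<open>Leading terms: with a and b the largest elements of the two supports, invariance of the
  order leaves (a, b) as the only pair that contributes to the coefficient at a + b.\<close>

lemma conv_nonzero:
  assumes f: "f \<in> fs" "f \<noteq> (\<lambda>_. \<zero>)" and g: "g \<in> fs" "g \<noteq> (\<lambda>_. \<zero>)"
  shows "conv f g \<noteq> (\<lambda>_. \<zero>)"
proof -
  define a b where "a = Max (supp f)" and "b = Max (supp g)"
  have a: "a \<in> supp f" "\<And>x. x \<in> supp f \<Longrightarrow> x \<le> a"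
    using f by (auto simp: a_def supp_eq_empty_iff intro: Max_in)
  have b: "b \<in> supp g" "\<And>x. x \<in> supp g \<Longrightarrow> x \<le> b"
    using g by (auto simp: b_def supp_eq_empty_iff intro: Max_in)
  let ?F = "\<lambda>x. f x \<otimes> (tw x (- x + (a + b)) \<otimes> g (- x + (a + b)))"
  have "g (- x + (a + b)) = \<zero>" if x: "x \<in> supp f" "x \<noteq> a" for x
  proof (rule ccontr)
    assume "g (- x + (a + b)) \<noteq> \<zero>"
    then have "- x + (a + b) \<le> b"
      by (intro b) (simp add: supp_def)
    then have "x + (- x + (a + b)) \<le> x + b"
      by (metis add_less_left le_less)
    then have "a + b \<le> x + b"
      by (simp add: add.assoc[symmetric])
    moreover have "x + b < a + b"
      using x a(2)[of x] by (intro add_less_right) auto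
    ultimately show False
      by simp
  qed
  then have "finsum K ?F {a} = finsum K ?F (supp f)"
    by (intro add.finprod_mono_neutral_cong_left) (use f g a in auto)
  then have "conv f g (a + b) = ?F a"
    using f g by (simp add: conv_def)
  also have "\<dots> = f a \<otimes> (tw a b \<otimes> g b)"
    by (simp add: add.assoc[symmetric])
  also have "\<dots> \<noteq> \<zero>"
    using a(1) b(1) f g tw_nonzero by (simp add: supp_def integral_iff)
  finally show ?thesis
    by auto
qed

lemma mon_eq_zero_iff: "mon c a = (\<lambda>_. \<zero>) \<longleftrightarrow> c = \<zero>"
  by (metis supp_eq_empty_iff supp_mon insert_not_empty)

lemma conv_zero_right [simp]: "f \<in> fs \<Longrightarrow> conv f (\<lambda>_. \<zero>) = (\<lambda>_. \<zero>)"
  using R.r_null[of f] by simp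

text \<open>The multipliers are confined to \<open>H\<close> so that the Ore condition can be proved
  for a growing family of subgroups.\<close>

definition ore_pair :: "'g set \<Rightarrow> ('g \<Rightarrow> 'b) \<Rightarrow> ('g \<Rightarrow> 'b) \<Rightarrow> bool"
  where "ore_pair H a b \<longleftrightarrow> (\<exists>r\<in>fs. \<exists>s\<in>fs. supp r \<subseteq> H \<and> supp s \<subseteq> H \<and>
           r \<noteq> (\<lambda>_. \<zero>) \<and> conv a r = conv b s)"

definition ore_on :: "'g set \<Rightarrow> bool"
  where "ore_on H \<longleftrightarrow> (\<forall>a\<in>fs. \<forall>b\<in>fs. supp a \<subseteq> H \<longrightarrow> supp b \<subseteq> H \<longrightarrow>
           a \<noteq> (\<lambda>_. \<zero>) \<longrightarrow> b \<noteq> (\<lambda>_. \<zero>) \<longrightarrow> ore_pair H a b)"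

text \<open>Only \<open>r\<close> is required to be nonzero, but in a domain \<open>conv a r\<close>
  is then nonzero, which forces \<open>s\<close> to be nonzero as well.\<close>

lemma ore_pair_sym:
  assumes "ore_pair H a b" "a \<in> fs" "b \<in> fs" "a \<noteq> (\<lambda>_. \<zero>)"
  shows "ore_pair H b a"
proof -
  obtain r s where rs: "r \<in> fs" "s \<in> fs" "supp r \<subseteq> H" "supp s \<subseteq> H"
    "r \<noteq> (\<lambda>_. \<zero>)" "conv a r = conv b s"
    using assms(1) by (auto simp: ore_pair_def)
  have "s \<noteq> (\<lambda>_. \<zero>)"
    using conv_nonzero[of a r] rs assms by auto
  with rs show ?thesis
    unfolding ore_pair_def by metis
qed

lemma supp_conv_subset:
  assumes "f \<in> fs" "g \<in> fs" "supp f \<subseteq> H" "supp g \<subseteq> H"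
    and "\<And>a b. a \<in> H \<Longrightarrow> b \<in> H \<Longrightarrow> a + b \<in> H"
  shows "supp (conv f g) \<subseteq> H"
  using supp_conv[OF assms(1,2)] assms(3-5) by blast

text \<open>First move of the Euclidean algorithm: a common right multiple of a w and b is one of a
  and b, and the multiplier w r stays nonzero in a domain.\<close>

lemma ore_pair_mult:
  assumes "ore_pair H (conv a w) b" "a \<in> fs" "b \<in> fs" "w \<in> fs" "supp w \<subseteq> H" "w \<noteq> (\<lambda>_. \<zero>)"
    and H: "\<And>a b. a \<in> H \<Longrightarrow> b \<in> H \<Longrightarrow> a + b \<in> H"
  shows "ore_pair H a b"
proof -
  obtain r s where rs: "r \<in> fs" "s \<in> fs" "supp r \<subseteq> H" "supp s \<subseteq> H"
    "r \<noteq> (\<lambda>_. \<zero>)" "conv (conv a w) r = conv b s"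
    using assms(1) by (auto simp: ore_pair_def)
  then have "conv a (conv w r) = conv b s"
    using assms by (simp add: conv_assoc)
  moreover have "conv w r \<noteq> (\<lambda>_. \<zero>)"
    using rs assms by (intro conv_nonzero)
  moreover have "supp (conv w r) \<subseteq> H"
    using rs assms by (intro supp_conv_subset)
  ultimately show ?thesis
    unfolding ore_pair_def using rs assms by (meson conv_fs)
qed

text \<open>Second move: (a + b z) r = b s rearranges to a r = b (s - z r), with the same nonzero
  r.\<close>

lemma ore_pair_add:
  assumes "ore_pair H (\<lambda>x. a x \<oplus> conv b z x) b" "a \<in> fs" "b \<in> fs" "z \<in> fs" "supp z \<subseteq> H"
    and H: "\<And>a b. a \<in> H \<Longrightarrow> b \<in> H \<Longrightarrow> a + b \<in> H"
  shows "ore_pair H a b"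
proof -
  obtain r s where rs: "r \<in> fs" "s \<in> fs" "supp r \<subseteq> H" "supp s \<subseteq> H"
    "r \<noteq> (\<lambda>_. \<zero>)" "conv (\<lambda>x. a x \<oplus> conv b z x) r = conv b s"
    using assms(1) by (auto simp: ore_pair_def)
  let ?m = "\<lambda>x. \<ominus> conv z r x"
  let ?s = "\<lambda>x. s x \<oplus> ?m x"
  have m: "?m \<in> fs" "?s \<in> fs"
    using rs assms by simp_all
  have "(\<lambda>x. conv a r x \<oplus> conv b (conv z r) x) = conv b s"
    using rs assms by (simp add: conv_add_left conv_assoc)
  then have "conv b s x = conv a r x \<oplus> conv b (conv z r) x" for x
    by (metis (no_types))
  then have "conv a r x = conv b s x \<ominus> conv b (conv z r) x" for x
    using rs assms by (simp add: minus_eq a_assoc r_neg)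
  moreover have "conv b ?m = (\<lambda>x. \<ominus> conv b (conv z r) x)"
    using R.r_minus[of b "conv z r"] rs assms by (simp add: a_inv_tga)
  ultimately have "conv a r = conv b ?s"
    using rs assms m conv_add_right[of b s ?m] by (simp add: fun_eq_iff minus_eq)
  moreover have "supp ?s \<subseteq> H"
  proof -
    have "supp (conv z r) \<subseteq> H"
      using rs assms by (intro supp_conv_subset)
    moreover have "supp ?m \<subseteq> supp (conv z r)"
      using rs assms by (auto simp: supp_def)
    ultimately show ?thesis
      using supp_add[of s ?m] rs m by blast
  qed
  ultimately show ?thesis
    unfolding ore_pair_def using rs m by blast
qed

text \<open>
  Think of the algebra supported on \<open>H\<close> as a skew Laurent polynomial ring over its degree-zero part. The
  Ore condition in degree zero lets one cancel the leading terms of \<open>a r\<close> and \<open>b q\<close>, as in the Euclidean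
  algorithm; \<open>n + m\<close> below bounds the sum of the widths of the degree ranges of \<open>a\<close> and \<open>b\<close>.
\<close>

lemma ore_on_extend:
  fixes d :: "'g \<Rightarrow> int"
  assumes H: "\<And>a b. a \<in> H \<Longrightarrow> b \<in> H \<Longrightarrow> a + b \<in> H"
    and d: "\<And>a b. a \<in> H \<Longrightarrow> b \<in> H \<Longrightarrow> d (a + b) = d a + d b"
    and surj: "\<And>n. \<exists>h\<in>H. d h = n"
    and base: "ore_on {h \<in> H. d h = 0}"
  shows "ore_on H"
proof -
  let ?Z = "\<lambda>_ :: 'g. \<zero>"
  \<comment> \<open>Supports are normalised to degrees in the interval from -n to 0, so that degree
    0 is always the top.\<close>
  let ?W = "\<lambda>n. {h \<in> H. - int n \<le> d h \<and> d h \<le> 0}"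
  obtain s where s: "s \<in> H" "d s = 1"
    using surj by blast
  \<comment> \<open>Right multiplication by this monomial raises every degree by one; it
    renormalises an element whose top part has vanished.\<close>
  define sg where "sg = mon \<one> s"
  have sg: "sg \<in> fs" "supp sg \<subseteq> H" "sg \<noteq> ?Z"
    using s by (auto simp: sg_def supp_mon mon_eq_zero_iff)
  \<comment> \<open>For supports in \<open>?W n\<close>, \<open>hi\<close> is the leading
    coefficient, an element of the degree-zero algebra, and \<open>lo\<close> is the rest, of
    strictly negative degree.\<close>
  define lo where "lo f = (\<lambda>x. if d x = 0 then \<zero> else f x)" for f :: "'g \<Rightarrow> 'b"
  define hi where "hi f = (\<lambda>x. if d x = 0 then f x else \<zero>)" for f :: "'g \<Rightarrow> 'b"
  have lohi: "lo f \<in> fs" "hi f \<in> fs" "supp (lo f) = supp f - {x. d x = 0}"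
    "supp (hi f) = supp f \<inter> {x. d x = 0}" "f = (\<lambda>x. hi f x \<oplus> lo f x)" if "f \<in> fs" for f
  proof -
    show l: "supp (lo f) = supp f - {x. d x = 0}" and h: "supp (hi f) = supp f \<inter> {x. d x = 0}"
      by (auto simp: supp_def lo_def hi_def)
    show "lo f \<in> fs"
      by (rule fsI) (use that in \<open>simp add: lo_def\<close>, use that in \<open>simp add: l\<close>)
    show "hi f \<in> fs"
      by (rule fsI) (use that in \<open>simp add: hi_def\<close>, use that in \<open>simp add: h\<close>)
    show "f = (\<lambda>x. hi f x \<oplus> lo f x)"
      using that by (auto simp: lo_def hi_def)
  qed
  \<comment> \<open>An element without degree-zero part fits, after multiplication by
    \<open>sg\<close>, into a strip that is shorter by one; for n = 0 no degree would be left for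
    it.\<close>
  have shrink: "\<exists>n'. n = Suc n' \<and> conv e sg \<noteq> ?Z \<and> supp (conv e sg) \<subseteq> ?W n'"
    if e: "e \<in> fs" "e \<noteq> ?Z" "supp e \<subseteq> {h \<in> H. - int n \<le> d h \<and> d h < 0}" for e n
  proof -
    obtain x where "x \<in> supp e"
      using e supp_eq_empty_iff by blast
    then have "n \<noteq> 0"
      using e by fastforce
    then obtain n' where n': "n = Suc n'"
      using not0_implies_Suc by blast
    have "supp (conv e sg) \<subseteq> ?W n'"
    proof
      fix z assume "z \<in> supp (conv e sg)"
      then obtain x where x: "x \<in> supp e" "z = x + s"
        using supp_conv_mon(2)[of e \<one> s] e by (auto simp: sg_def)
      then have "x \<in> H" "- int n \<le> d x" "d x < 0"
        using e by auto
      then show "z \<in> ?W n'"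
        using x s n' H d by auto
    qed
    then show ?thesis
      using n' conv_nonzero[of e sg] e sg by blast
  qed
  have main: "ore_pair H a b"
    if "a \<in> fs" "b \<in> fs" "a \<noteq> ?Z" "b \<noteq> ?Z" "supp a \<subseteq> ?W n" "supp b \<subseteq> ?W m" for a b n m
    using that
  proof (induction "n + m" arbitrary: n m a b rule: less_induct)
    case less
    \<comment> \<open>The induction hypothesis is made an explicit premise so that the argument for
      m \<le> n can also be run with \<open>a\<close> and \<open>b\<close> exchanged.\<close>
    have key: "ore_pair H a b"
      if le: "m \<le> n" and IH: "\<And>n' m' a b. n' + m' < n + m \<Longrightarrow> a \<in> fs \<Longrightarrow> b \<in> fs \<Longrightarrow> a \<noteq> ?Z \<Longrightarrow> b \<noteq> ?Z
           \<Longrightarrow> supp a \<subseteq> ?W n' \<Longrightarrow> supp b \<subseteq> ?W m' \<Longrightarrow> ore_pair H a b"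
        and ab: "a \<in> fs" "b \<in> fs" "a \<noteq> ?Z" "b \<noteq> ?Z" "supp a \<subseteq> ?W n" "supp b \<subseteq> ?W m" for a b n m
    proof -
      have red: "ore_pair H e b"
        if e: "e \<in> fs" "e \<noteq> ?Z" "supp e \<subseteq> {h \<in> H. - int n \<le> d h \<and> d h < 0}" for e
      proof -
        obtain n' where n': "n = Suc n'" "conv e sg \<noteq> ?Z" "supp (conv e sg) \<subseteq> ?W n'"
          using shrink[OF e] by blast
        have "ore_pair H (conv e sg) b"
          using n' e sg ab by (intro IH[of n' m]) auto
        then show ?thesis
          using e sg ab H by (intro ore_pair_mult[of H e sg b]) auto
      qed
      consider "hi a = ?Z" | "hi b = ?Z" | "hi a \<noteq> ?Z" "hi b \<noteq> ?Z"
        by blast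
      then show ?thesis
      proof cases
        case 1
        then have "supp a \<inter> {x. d x = 0} = {}"
          using lohi(4)[OF ab(1)] by simp
        then have "supp a \<subseteq> {h \<in> H. - int n \<le> d h \<and> d h < 0}"
          using ab(5) by force
        then show ?thesis
          using ab by (intro red)
      next
        case 2
        then have "supp b \<inter> {x. d x = 0} = {}"
          using lohi(4)[OF ab(2)] by simp
        then have "supp b \<subseteq> {h \<in> H. - int m \<le> d h \<and> d h < 0}"
          using ab(6) by force
        then obtain m' where m': "m = Suc m'" "conv b sg \<noteq> ?Z" "supp (conv b sg) \<subseteq> ?W m'"
          using shrink ab by blast
        have "ore_pair H a (conv b sg)"
          using m' sg ab by (intro IH[of n m']) auto
        then have "ore_pair H (conv b sg) a"
          using ab sg by (intro ore_pair_sym[of H a "conv b sg"]) auto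
        then have "ore_pair H b a"
          using ab sg H by (intro ore_pair_mult[of H b sg a]) auto
        then show ?thesis
          using ab by (intro ore_pair_sym[of H b a])
      next
        case 3
        let ?H0 = "{h \<in> H. d h = 0}"
        have "supp (hi a) \<subseteq> ?H0" "supp (hi b) \<subseteq> ?H0"
          using lohi(4)[OF ab(1)] lohi(4)[OF ab(2)] ab(5,6) by auto
        then have "ore_pair ?H0 (hi a) (hi b)"
          using base 3 lohi(2)[OF ab(1)] lohi(2)[OF ab(2)] by (simp add: ore_on_def)
        then obtain r q where rq: "r \<in> fs" "q \<in> fs" "supp r \<subseteq> ?H0" "supp q \<subseteq> ?H0"
          "r \<noteq> ?Z" "conv (hi a) r = conv (hi b) q"
          by (auto simp: ore_pair_def)
        define q' where "q' = (\<lambda>x. \<ominus> q x)"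
        have q': "q' \<in> fs" "supp q' \<subseteq> ?H0"
          using rq by (auto simp: q'_def) (auto simp: supp_def)
        have cq: "conv c q' = (\<lambda>x. \<ominus> conv c q x)" if "c \<in> fs" for c
          using R.r_minus[of c q] rq that by (simp add: a_inv_tga q'_def)
        \<comment> \<open>This is a r - b q. The leading terms cancel by the choice of
          \<open>r\<close> and \<open>q\<close>, and as these have degree zero, the remainder has
          degrees between -n and -1; for the part coming from \<open>b\<close> this uses m \<le>
          n.\<close>
        let ?e = "\<lambda>x. conv a r x \<oplus> conv b q' x"
        have e: "?e \<in> fs"
          using ab rq q' by simp
        have ar: "conv a r x = conv (hi a) r x \<oplus> conv (lo a) r x" for x
          using conv_add_left[of "hi a" "lo a" r] lohi(1,2)[OF ab(1)] lohi(5)[OF ab(1)] rq by (metis fs_closed)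
        have bq: "conv b q' x = \<ominus> conv (hi b) q x \<oplus> conv (lo b) q' x" for x
          using conv_add_left[of "hi b" "lo b" q'] lohi(1,2)[OF ab(2)] lohi(5)[OF ab(2)] q' cq by (metis fs_closed)
        have eq: "?e = (\<lambda>x. conv (lo a) r x \<oplus> conv (lo b) q' x)"
        proof
          fix x
          let ?u = "conv (hi b) q x" and ?v = "conv (lo a) r x" and ?w = "conv (lo b) q' x"
          have cl: "?u \<in> carrier K" "?v \<in> carrier K" "?w \<in> carrier K"
            using lohi(1,2)[OF ab(1)] lohi(1,2)[OF ab(2)] rq q' by simp_all
          have "?e x = (?u \<oplus> ?v) \<oplus> (\<ominus> ?u \<oplus> ?w)"
            using ar bq rq(6) by simp
          also have "\<dots> = (?u \<oplus> \<ominus> ?u) \<oplus> (?v \<oplus> ?w)"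
            using cl by (simp add: a_ac del: r_neg r_neg2)
          also have "\<dots> = ?v \<oplus> ?w"
            using cl by (simp add: r_neg)
          finally show "?e x = ?v \<oplus> ?w" .
        qed
        have "supp ?e \<subseteq> supp (conv (lo a) r) \<union> supp (conv (lo b) q')"
          unfolding eq using lohi(1,2)[OF ab(1)] lohi(1,2)[OF ab(2)] rq q' by (intro supp_add) simp_all
        moreover have "supp (conv (lo a) r) \<subseteq> {h \<in> H. - int n \<le> d h \<and> d h < 0}"
        proof
          fix z assume "z \<in> supp (conv (lo a) r)"
          then obtain x y where "z = x + y" "x \<in> supp (lo a)" "y \<in> supp r"
            using supp_conv[of "lo a" r] lohi(1)[OF ab(1)] rq by blast
          then show "z \<in> {h \<in> H. - int n \<le> d h \<and> d h < 0}"
            using lohi(3)[OF ab(1)] ab(5) rq(3) H d by (force dest!: subsetD)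
        qed
        moreover have "supp (conv (lo b) q') \<subseteq> {h \<in> H. - int n \<le> d h \<and> d h < 0}"
        proof
          fix z assume "z \<in> supp (conv (lo b) q')"
          then obtain x y where "z = x + y" "x \<in> supp (lo b)" "y \<in> supp q'"
            using supp_conv[of "lo b" q'] lohi(1)[OF ab(2)] q' by blast
          then show "z \<in> {h \<in> H. - int n \<le> d h \<and> d h < 0}"
            using lohi(3)[OF ab(2)] ab(6) q'(2) H d le by (force dest!: subsetD)
        qed
        ultimately have se: "supp ?e \<subseteq> {h \<in> H. - int n \<le> d h \<and> d h < 0}"
          by blast
        have rH: "supp r \<subseteq> H" "supp q \<subseteq> H" "supp q' \<subseteq> H"
          using rq q' by auto
        show ?thesis
        proof (cases "?e = ?Z")
          case True
          have "conv a r x = conv b q x" for x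
          proof -
            have "conv a r x \<oplus> \<ominus> conv b q x = \<zero>"
              using True cq[OF ab(2)] by (metis (no_types, lifting))
            then show ?thesis
              using ab rq r_right_minus_eq[of "conv a r x" "conv b q x"] unfolding minus_eq by simp
          qed
          then have "conv a r = conv b q"
            by auto
          then show ?thesis
            unfolding ore_pair_def using rq rH by blast
        next
          case False
          \<comment> \<open>The way back from the remainder to \<open>a\<close>: undo the
            subtraction of b q, then the multiplication by \<open>r\<close>.\<close>
          have "ore_pair H ?e b"
            using e False se by (rule red)
          then have "ore_pair H (conv a r) b"
            using ab rq q' rH H by (intro ore_pair_add[of H "conv a r" b q']) auto
          then show ?thesis
            using ab rq rH H by (intro ore_pair_mult[of H a r b]) auto
        qed
      qed
    qed
    show ?case
    proof (cases "m \<le> n")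
      case True
      show ?thesis
        by (rule key[OF True _ less.prems]) (use less.hyps in blast)
    next
      case False
      then have "ore_pair H b a"
        using less.prems less.hyps by (intro key[of n m b a]) (auto simp: add.commute)
      then show ?thesis
        using less.prems by (intro ore_pair_sym[of H b a])
    qed
  qed
  show ?thesis
    unfolding ore_on_def
  proof (intro ballI impI)
    fix a b assume ab: "a \<in> fs" "b \<in> fs" "supp a \<subseteq> H" "supp b \<subseteq> H" "a \<noteq> ?Z" "b \<noteq> ?Z"
    have "finite ((\<lambda>x. nat \<bar>d x\<bar>) ` (supp a \<union> supp b))"
      using ab by simp
    then obtain N where "\<And>y. y \<in> (\<lambda>x. nat \<bar>d x\<bar>) ` (supp a \<union> supp b) \<Longrightarrow> y \<le> N"
      by (metis Max_ge)
    then have N: "\<bar>d x\<bar> \<le> int N" if "x \<in> supp a \<union> supp b" for x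
      using that by (force simp: image_iff nat_le_iff)
    \<comment> \<open>Right translation by an element of degree -N carries degrees between -N and N
      to degrees between -2N and 0.\<close>
    obtain g where g: "g \<in> H" "d g = - int N"
      using surj by blast
    define mg where "mg = mon \<one> g"
    have mg: "mg \<in> fs" "supp mg \<subseteq> H" "mg \<noteq> ?Z"
      using g by (auto simp: mg_def supp_mon mon_eq_zero_iff)
    have W: "supp (conv c mg) \<subseteq> ?W (2 * N)" if "c = a \<or> c = b" for c
    proof
      fix z assume "z \<in> supp (conv c mg)"
      moreover have "c \<in> fs"
        using that ab by blast
      ultimately obtain x where x: "x \<in> supp c" "z = x + g"
        using supp_conv_mon(2)[of c \<one> g] by (auto simp: mg_def)
      then have "\<bar>d x\<bar> \<le> int N" "x \<in> H"
        using N that ab by auto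
      then show "z \<in> ?W (2 * N)"
        using x g H d by auto
    qed
    have "ore_pair H (conv a mg) (conv b mg)"
      by (rule main[of _ _ "2 * N" "2 * N"]) (use W ab mg conv_nonzero in auto)
    then have "ore_pair H a (conv b mg)"
      using ab mg H by (intro ore_pair_mult[of H a mg]) auto
    then have "ore_pair H (conv b mg) a"
      using ab mg by (intro ore_pair_sym[of H a "conv b mg"]) auto
    then have "ore_pair H b a"
      using ab mg H by (intro ore_pair_mult[of H b mg]) auto
    then show "ore_pair H a b"
      using ab by (intro ore_pair_sym[of H b a])
  qed
qed

end

section \<open>The lamplighter group\<close>

lift_definition sh :: "int \<Rightarrow> (int \<Rightarrow>\<^sub>0 int) \<Rightarrow> (int \<Rightarrow>\<^sub>0 int)"
  is "\<lambda>n v i. v (i - n)"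
proof -
  fix n :: int and v :: "int \<Rightarrow> int"
  assume "finite {i. v i \<noteq> 0}"
  then have "finite ((\<lambda>i. i + n) ` {i. v i \<noteq> 0})"
    by simp
  moreover have "{i. v (i - n) \<noteq> 0} \<subseteq> (\<lambda>i. i + n) ` {i. v i \<noteq> 0}"
    by (force simp: image_iff intro: exI[of _ "_ - n"])
  ultimately show "finite {i. v (i - n) \<noteq> 0}"
    by (rule finite_subset[rotated])
qed

lemma lookup_sh: "Poly_Mapping.lookup (sh n v) i = Poly_Mapping.lookup v (i - n)"
  by (simp add: sh.rep_eq)

lemma sh_add: "sh n (v + w) = sh n v + sh n w"
  and sh_uminus: "sh n (- v) = - sh n v"
  and sh_sh: "sh n (sh m v) = sh (n + m) v"
  and sh_0 [simp]: "sh 0 v = v"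
  and sh_zero [simp]: "sh n 0 = 0"
  and sh_single: "sh n (Poly_Mapping.single i c) = Poly_Mapping.single (i + n) c"
  by (auto intro!: poly_mapping_eqI simp: lookup_sh lookup_add lookup_single algebra_simps when_def)

lemma keys_sh: "Poly_Mapping.keys (sh n v) = (\<lambda>i. i + n) ` Poly_Mapping.keys v"
  by (force simp: in_keys_iff lookup_sh image_iff intro: bexI[of _ "_ - n"])

text \<open>Finitely supported functions are compared at the least index where they differ, and a
  shift moves this index along.\<close>

lemma sh_less: "v < w \<Longrightarrow> sh n v < sh n w"
proof (transfer fixing: n)
  fix v w :: "int \<Rightarrow> int"
  assume "less_fun v w"
  then obtain i where "v i < w i" "\<forall>j<i. v j = w j"
    by (auto simp: less_fun_def)
  then show "less_fun (\<lambda>i. v (i - n)) (\<lambda>i. w (i - n))"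
    by (auto simp: less_fun_def intro!: exI[of _ "i + n"])
qed

text \<open>\<open>Lamp v n\<close> stands for v \<sigma>^n in the wreath product of the integers
  with themselves: v records the exponent of each lamp, and \<sigma>^n moves every lamp n places
  up.\<close>

datatype lamp = Lamp (lv: "int \<Rightarrow>\<^sub>0 int") (ls: int)

instantiation lamp :: "{group_add, linorder}"
begin

definition "0 = Lamp 0 0"
definition "a + b = Lamp (lv a + sh (ls a) (lv b)) (ls a + ls b)"
definition "- a = Lamp (- sh (- ls a) (lv a)) (- ls a)"
definition "a - (b :: lamp) = a + - b"
definition "a < b \<longleftrightarrow> ls a < ls b \<or> (ls a = ls b \<and> lv a < lv b)"
definition "a \<le> b \<longleftrightarrow> a = b \<or> a < (b :: lamp)"

instance
proof
  fix a b c :: lamp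
  show "a + b + c = a + (b + c)"
    by (simp add: plus_lamp_def sh_add sh_sh add.assoc)
  show "0 + a = a" "a + 0 = a"
    by (simp_all add: plus_lamp_def zero_lamp_def)
  show "- a + a = 0"
    by (simp add: plus_lamp_def zero_lamp_def uminus_lamp_def)
  show "a + - b = a - b"
    by (simp add: minus_lamp_def)
  show "a < b \<longleftrightarrow> a \<le> b \<and> \<not> b \<le> a"
    by (auto simp: less_lamp_def less_eq_lamp_def)
  show "a \<le> a" "a \<le> b \<Longrightarrow> b \<le> c \<Longrightarrow> a \<le> c" "a \<le> b \<Longrightarrow> b \<le> a \<Longrightarrow> a = b"
    by (auto simp: less_lamp_def less_eq_lamp_def)
  show "a \<le> b \<or> b \<le> a"
    by (cases a; cases b) (auto simp: less_lamp_def less_eq_lamp_def)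
qed

end

lemma lamp_sel [simp]:
  "lv 0 = 0" "ls 0 = 0" "ls (a + b) = ls a + ls b" "lv (a + b) = lv a + sh (ls a) (lv b)"
  "ls (- a) = - ls a" "lv (- a) = - sh (- ls a) (lv a)"
  by (simp_all add: plus_lamp_def zero_lamp_def uminus_lamp_def)

text \<open>The order compares shift exponents first and configurations second. It is invariant on
  the left because conjugation by a shift preserves the order of configurations.\<close>

lemma lamp_less_left: "b < c \<Longrightarrow> a + b < a + (c :: lamp)"
  by (auto simp: less_lamp_def sh_less)

lemma lamp_less_right: "b < c \<Longrightarrow> b + a < c + (a :: lamp)"
  by (auto simp: less_lamp_def)

lemma countable_lamp: "countable (UNIV :: lamp set)"
proof -
  let ?e = "\<lambda>a. ((\<lambda>i. (i, Poly_Mapping.lookup (lv a) i)) ` Poly_Mapping.keys (lv a), ls a)"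
  have "inj ?e"
  proof (rule injI)
    fix a b assume eq: "?e a = ?e b"
    have "(i, c) \<in> fst (?e a) \<longleftrightarrow> c \<noteq> 0 \<and> Poly_Mapping.lookup (lv a) i = c" for a i c
      by (auto simp: in_keys_iff)
    then have "Poly_Mapping.lookup (lv a) i = Poly_Mapping.lookup (lv b) i" for i
      using eq by metis
    then have "lv a = lv b"
      by (intro poly_mapping_eqI) auto
    with eq show "a = b"
      by (auto intro: lamp.expand)
  qed
  moreover have "countable (range ?e)"
  proof (rule countable_subset)
    show "range ?e \<subseteq> {S. finite S \<and> S \<subseteq> UNIV} \<times> UNIV"
      by auto
    show "countable ({S. finite S \<and> S \<subseteq> (UNIV :: (int \<times> int) set)} \<times> (UNIV :: int set))"
      by (intro countable_SIGMA countable_Collect_finite_subset) auto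
  qed
  ultimately show ?thesis
    using countable_image_inj_on by blast
qed

section \<open>Shift-invariant bimultiplicative forms and their cocycles\<close>

locale shift_form = comm_group G for G :: "'u monoid" (structure) +
  fixes b :: "int \<Rightarrow> 'u"
  assumes b_closed [simp]: "b n \<in> carrier G"
begin

text \<open>A bimultiplicative form with a Toeplitz matrix: the entry for positions i and j depends
  on i - j alone, whence the invariance \<open>bet_sh\<close>.\<close>

definition bet :: "(int \<Rightarrow>\<^sub>0 int) \<Rightarrow> (int \<Rightarrow>\<^sub>0 int) \<Rightarrow> 'u"
  where "bet v w = (\<Otimes>p\<in>Poly_Mapping.keys v \<times> Poly_Mapping.keys w.
     b (fst p - snd p) [^] (Poly_Mapping.lookup v (fst p) * Poly_Mapping.lookup w (snd p)))"

lemma bet_closed [simp]: "bet v w \<in> carrier G"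
  unfolding bet_def by (rule finprod_closed) auto

lemma bet_superset:
  assumes "finite I" "finite J" "Poly_Mapping.keys v \<subseteq> I" "Poly_Mapping.keys w \<subseteq> J"
  shows "bet v w = (\<Otimes>p\<in>I \<times> J.
     b (fst p - snd p) [^] (Poly_Mapping.lookup v (fst p) * Poly_Mapping.lookup w (snd p)))"
  unfolding bet_def
  by (rule finprod_mono_neutral_cong_left) (use assms in \<open>auto simp: in_keys_iff\<close>)

lemma bet_add_left: "bet (v + v') w = bet v w \<otimes> bet v' w"
proof -
  let ?I = "Poly_Mapping.keys v \<union> Poly_Mapping.keys v'" and ?J = "Poly_Mapping.keys w"
  have k: "Poly_Mapping.keys (v + v') \<subseteq> ?I"
    by (rule keys_add)
  show ?thesis
    using k by (simp add: bet_superset[where I="?I" and J="?J"] lookup_add distrib_right int_pow_mult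
        flip: finprod_multf)
qed

lemma bet_add_right: "bet v (w + w') = bet v w \<otimes> bet v w'"
proof -
  let ?I = "Poly_Mapping.keys v" and ?J = "Poly_Mapping.keys w \<union> Poly_Mapping.keys w'"
  have k: "Poly_Mapping.keys (w + w') \<subseteq> ?J"
    by (rule keys_add)
  show ?thesis
    using k by (simp add: bet_superset[where I="?I" and J="?J"] lookup_add distrib_left int_pow_mult
        flip: finprod_multf)
qed

lemma bet_sh: "bet (sh n v) (sh n w) = bet v w"
proof -
  let ?h = "\<lambda>p. (fst p + n, snd p + n)"
  have eq: "Poly_Mapping.keys (sh n v) \<times> Poly_Mapping.keys (sh n w)
      = ?h ` (Poly_Mapping.keys v \<times> Poly_Mapping.keys w)"
    by (force simp: keys_sh image_iff)
  show ?thesis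
    unfolding bet_def eq by (subst finprod_reindex) (auto simp: inj_on_def lookup_sh)
qed

lemma bet_zero [simp]: "bet 0 w = \<one>" "bet v 0 = \<one>"
  by (simp_all add: bet_def)

lemma bet_single_left:
  "bet (Poly_Mapping.single j 1) w
    = (\<Otimes>i\<in>Poly_Mapping.keys w. b (j - i) [^] Poly_Mapping.lookup w i)"
proof -
  have eq: "{j} \<times> Poly_Mapping.keys w = (\<lambda>i. (j, i)) ` Poly_Mapping.keys w"
    by auto
  show ?thesis
    unfolding bet_def by (simp add: eq) (subst finprod_reindex, auto simp: inj_on_def)
qed

lemma bet_single_right:
  "bet w (Poly_Mapping.single j 1)
    = (\<Otimes>i\<in>Poly_Mapping.keys w. b (i - j) [^] Poly_Mapping.lookup w i)"
proof -
  have eq: "Poly_Mapping.keys w \<times> {j} = (\<lambda>i. (i, j)) ` Poly_Mapping.keys w"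
    by auto
  show ?thesis
    unfolding bet_def by (simp add: eq) (subst finprod_reindex, auto simp: inj_on_def)
qed

lemma bet_single: "bet (Poly_Mapping.single i 1) (Poly_Mapping.single j 1) = b (i - j)"
  by (simp add: bet_single_left)

text \<open>In (v \<sigma>^n)(w \<sigma>^m) the factor \<sigma>^n has to pass w, which shifts w by n
  before the two configurations are merged.\<close>

definition ltw :: "lamp \<Rightarrow> lamp \<Rightarrow> 'u"
  where "ltw a c = bet (lv a) (sh (ls a) (lv c))"

text \<open>By bimultiplicativity both sides are products of three values of \<open>bet\<close>. Two
  of them match literally; the third, for \<open>c\<close> and \<open>d\<close>, appears on the left
  shifted by \<open>ls a\<close>.\<close>

lemma ltw_cocycle: "ltw a c \<otimes> ltw (a + c) d = ltw c d \<otimes> ltw a (c + d)"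
  using bet_sh[of "ls a" "lv c" "sh (ls c) (lv d)"]
  by (simp add: ltw_def bet_add_left bet_add_right sh_add sh_sh m_ac)

lemma ltw_zero [simp]: "ltw 0 a = \<one>" "ltw a 0 = \<one>"
  by (simp_all add: ltw_def)

lemma ltw_closed [simp]: "ltw a c \<in> carrier G"
  by (simp add: ltw_def)

end

section \<open>A simple twisted group algebra\<close>

locale lamp_algebra = field K for K :: "'b ring" (structure) +
  fixes t :: 'b
  assumes countable_K: "countable (carrier K)"
    and t_closed [simp]: "t \<in> carrier K"
    and t_pow: "\<And>n :: nat. n > 0 \<Longrightarrow> t [^] n \<noteq> \<one>"
    and t_nonzero: "t \<noteq> \<zero>"
begin

text \<open>Forgetting the second component of the decoded pair makes each unit appear at infinitely
  many indices.\<close>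

definition unit_enum :: "nat \<Rightarrow> 'b"
  where "unit_enum m = from_nat_into (Units K) (fst (prod_decode m))"

text \<open>
  The commutator of the lamps at \<open>i > j\<close> is \<open>twist_seq (i - j)\<close>. Every unit occurs among its values, so
  commutators generate \<open>K\<close>; the values are trivial off the sparse set of powers of two, and
  \<open>t\<close> occurs infinitely often, so a far away lamp can be made to see a single lamp of any given configuration.
\<close>

definition twist_seq :: "int \<Rightarrow> 'b"
  where "twist_seq n = (if n \<in> range (\<lambda>m. 2 ^ m) then unit_enum (inv_into UNIV (\<lambda>m. 2 ^ m) n) else \<one>)"

lemma unit_enum_unit: "unit_enum m \<in> Units K"
  unfolding unit_enum_def by (rule from_nat_into) (use Units_one_closed in blast)

lemma twist_seq_pow: "twist_seq (2 ^ m) = unit_enum m"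
proof -
  have "inj (\<lambda>m. (2 :: int) ^ m)"
    by (simp add: inj_def)
  then show ?thesis
    by (simp add: twist_seq_def inv_f_f[of "\<lambda>m. (2 :: int) ^ m"])
qed

lemma twist_seq_nonpos: "n \<le> 0 \<Longrightarrow> twist_seq n = \<one>"
  by (auto simp: twist_seq_def)

lemma twist_seq_between:
  assumes "2 ^ m < n" "n < 2 ^ Suc m"
  shows "twist_seq n = \<one>"
proof -
  have "n \<noteq> 2 ^ p" for p
  proof
    assume "n = 2 ^ p"
    then have "m < p" "p < Suc m"
      using assms by (simp_all only: power_strict_increasing_iff one_less_numeral_iff semiring_norm)
    then show False
      by simp
  qed
  then show ?thesis
    by (auto simp: twist_seq_def)
qed

lemma unit_enum_infinitely_often:
  assumes "c \<in> Units K"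
  shows "\<exists>m\<ge>l. unit_enum m = c"
proof -
  have "range (from_nat_into (Units K)) = Units K"
    by (rule range_from_nat_into)
      (use assms countable_K in \<open>auto intro: countable_subset[of _ "carrier K"]\<close>)
  then obtain i where "from_nat_into (Units K) i = c"
    using assms by (metis imageE)
  then show ?thesis
    by (intro exI[of _ "prod_encode (i, l)"]) (simp add: unit_enum_def le_prod_encode_2)
qed

lemma t_unit: "t \<in> Units K"
  using t_nonzero by (simp add: field_Units)

sublocale S: shift_form "units_of K" twist_seq
proof -
  interpret U: comm_group "units_of K"
    by (rule units_comm_group)
  show "shift_form (units_of K) twist_seq"
    by unfold_locales (simp add: units_of_carrier twist_seq_def unit_enum_unit)
qed

sublocale ordered_twisted_group K S.ltw
proof
  show "S.ltw a b \<in> carrier K" "S.ltw a b \<noteq> \<zero>" for a b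
    using S.ltw_closed[of a b] by (auto simp: units_of_carrier field_Units simp del: S.ltw_closed)
  show "S.ltw a b \<otimes> S.ltw (a + b) c = S.ltw b c \<otimes> S.ltw a (b + c)" for a b c
    using S.ltw_cocycle[of a b c] by (simp add: units_of_mult)
  show "S.ltw 0 a = \<one>" "S.ltw a 0 = \<one>" for a
    by (simp_all add: units_of_one)
qed (auto intro: lamp_less_left lamp_less_right)

lemma units_pow_t: "z \<noteq> 0 \<Longrightarrow> t [^]\<^bsub>units_of K\<^esub> (z :: int) \<noteq> \<one>"
proof
  assume z: "z \<noteq> 0" and eq: "t [^]\<^bsub>units_of K\<^esub> z = \<one>"
  have p: "t [^]\<^bsub>units_of K\<^esub> n = t [^] n" for n :: nat
    by (induction n) (simp_all add: units_of_one units_of_mult)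
  have tc: "t \<in> carrier (units_of K)"
    by (simp add: units_of_carrier t_unit)
  obtain n where n: "z = int n \<or> z = - int n" "n > 0"
    using z by (metis int_cases3 of_nat_0_less_iff neg_0_less_iff_less)
  have "t [^]\<^bsub>units_of K\<^esub> n = \<one>\<^bsub>units_of K\<^esub>"
    using n(1)
  proof
    assume "z = int n"
    then show ?thesis
      using eq by (simp only: int_pow_int units_of_one)
  next
    assume "z = - int n"
    then have "inv\<^bsub>units_of K\<^esub> (t [^]\<^bsub>units_of K\<^esub> n) = \<one>\<^bsub>units_of K\<^esub>"
      using eq S.int_pow_neg_int[OF tc, of n] by (simp only: units_of_one)
    then show ?thesis
      using S.inv_eq_1_iff[OF S.nat_pow_closed[OF tc]] by blast
  qed
  then show False
    using t_pow[OF n(2)] by (simp only: p units_of_one)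
qed

text \<open>The probing lamp j is placed so far above \<open>v\<close> that, of all the distances
  from j to the lamps of \<open>v\<close>, only the distance to the top lamp is a power of two. One
  order of arguments then gives a nonzero power of \<open>t\<close>; in the other all differences
  are negative and the form is trivial.\<close>

lemma bet_nondegenerate:
  assumes "v \<noteq> 0"
  shows "\<exists>j. S.bet (Poly_Mapping.single j 1) v \<noteq> S.bet v (Poly_Mapping.single j 1)"
proof -
  let ?k = "Poly_Mapping.keys v"
  have ne: "?k \<noteq> {}"
    using assms by simp
  define i0 where "i0 = Max ?k"
  have i0: "i0 \<in> ?k" "\<And>i. i \<in> ?k \<Longrightarrow> i \<le> i0"
    using ne by (auto simp: i0_def)
  \<comment> \<open>The bound makes 2^m exceed the width of the support, because m < 2^m.\<close>
  obtain m where m: "m \<ge> nat (i0 - Min ?k)" "unit_enum m = t"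
    using unit_enum_infinitely_often t_unit by blast
  have lt: "i0 - i < 2 ^ m" if "i \<in> ?k" for i
  proof -
    have "i0 - i \<le> i0 - Min ?k"
      using that by simp
    also have "\<dots> \<le> int m"
      using m by simp
    also have "\<dots> < 2 ^ m"
      by (metis of_nat_less_two_power)
    finally show ?thesis .
  qed
  \<comment> \<open>For i in the support, j - i = 2^m + (i0 - i) is at least 2^m and less than
    2^(m+1), and it equals 2^m only for i = i0.\<close>
  define j where "j = i0 + 2 ^ m"
  have "S.bet v (Poly_Mapping.single j 1) = \<one>"
  proof -
    have "twist_seq (i - j) [^]\<^bsub>units_of K\<^esub> Poly_Mapping.lookup v i = \<one>\<^bsub>units_of K\<^esub>" if "i \<in> ?k" for i
    proof -
      have "i - j \<le> 0"
        using i0(2)[OF that] zero_le_power[of "2 :: int" m] unfolding j_def by linarith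
      then show ?thesis
        using S.int_pow_one[unfolded units_of_one] by (simp only: twist_seq_nonpos units_of_one)
    qed
    then show ?thesis
      unfolding S.bet_single_right by (subst S.finprod_one_eqI) (auto simp: units_of_one)
  qed
  moreover have "S.bet (Poly_Mapping.single j 1) v = t [^]\<^bsub>units_of K\<^esub> Poly_Mapping.lookup v i0"
  proof -
    let ?F = "\<lambda>i. twist_seq (j - i) [^]\<^bsub>units_of K\<^esub> Poly_Mapping.lookup v i"
    have F1: "?F i = \<one>\<^bsub>units_of K\<^esub>" if "i \<in> ?k - {i0}" for i
    proof -
      have "0 < i0 - i" "i0 - i < 2 ^ m"
        using i0(2)[of i] lt that by force+
      then have "twist_seq (j - i) = \<one>"
        by (intro twist_seq_between[of m]) (simp_all add: j_def)
      then show ?thesis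
        using S.int_pow_one[unfolded units_of_one] by (simp only: units_of_one)
    qed
    have "finprod (units_of K) ?F {i0} = finprod (units_of K) ?F ?k"
      by (rule S.finprod_mono_neutral_cong_left) (use i0 F1 in auto)
    moreover have "finprod (units_of K) ?F {i0} = ?F i0"
      by (simp del: units_of_carrier)
    moreover have "twist_seq (j - i0) = t"
      using twist_seq_pow[of m] m by (simp add: j_def)
    ultimately show ?thesis
      by (simp only: S.bet_single_left)
  qed
  moreover have "t [^]\<^bsub>units_of K\<^esub> Poly_Mapping.lookup v i0 \<noteq> \<one>"
    using i0 by (intro units_pow_t) (simp add: in_keys_iff)
  ultimately show ?thesis
    by metis
qed

section \<open>The centraliser of the lamps, and simplicity\<close>

lemma lamp_minus_sel:
  "lv (a - c) = lv a - sh (ls a - ls c) (lv c)" "ls (a - c) = ls a - ls c"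
  unfolding minus_lamp_def lamp_sel by (simp_all add: sh_uminus sh_sh)

definition el :: "int \<Rightarrow> lamp"
  where "el j = Lamp (Poly_Mapping.single j 1) 0"

lemma el_sel [simp]: "lv (el j) = Poly_Mapping.single j 1" "ls (el j) = 0"
  by (simp_all add: el_def)

lemma lamp_comm: "ls a = 0 \<Longrightarrow> ls c = 0 \<Longrightarrow> a + c = c + a"
  by (auto intro: lamp.expand simp: add.commute)

text \<open>The support of \<open>f\<close> is invariant under conjugation by lamps. An element with
  a nonzero shift has infinitely many such conjugates, so it cannot occur; a pure configuration is
  fixed by conjugation, and comparing coefficients there puts it into the radical of the commutator
  form, which \<open>bet_nondegenerate\<close> shows to be trivial.\<close>

lemma commute_el_imp_scalar:
  assumes f: "f \<in> fs" and comm: "\<And>j. conv (mon \<one> (el j)) f = conv f (mon \<one> (el j))"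
  shows "supp f \<subseteq> {0}"
proof
  fix \<gamma> assume \<gamma>: "\<gamma> \<in> supp f"
  have ls0: "ls \<gamma> = 0"
  proof (rule ccontr)
    assume n: "ls \<gamma> \<noteq> 0"
    have mem: "el j + \<gamma> - el j \<in> supp f" for j
    proof -
      have "el j + \<gamma> \<in> supp (conv (mon \<one> (el j)) f)"
        using \<gamma> f by (simp add: supp_conv_mon)
      then have "el j + \<gamma> \<in> (\<lambda>b. b + el j) ` supp f"
        using f by (simp add: comm supp_conv_mon)
      then show ?thesis
        by auto
    qed
    \<comment> \<open>Conjugating by lamp j adds one at position j and subtracts one at position
      \<open>j + ls \<gamma>\<close>; as these positions differ, distinct j have distinct
      effects.\<close>
    have "inj (\<lambda>j. el j + \<gamma> - el j)"
    proof (rule injI, rule ccontr)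
      fix j j' assume eq: "el j + \<gamma> - el j = el j' + \<gamma> - el j'" and ne: "j \<noteq> j'"
      have lv: "lv (el j + \<gamma> - el j)
          = Poly_Mapping.single j 1 + lv \<gamma> - Poly_Mapping.single (j + ls \<gamma>) 1" for j
        by (simp add: lamp_minus_sel sh_single)
      have "Poly_Mapping.single j 1 + lv \<gamma> - Poly_Mapping.single (j + ls \<gamma>) 1
          = Poly_Mapping.single j' 1 + lv \<gamma> - Poly_Mapping.single (j' + ls \<gamma>) (1 :: int)"
        unfolding lv[symmetric] eq ..
      then show False
        using ne n by (auto dest!: arg_cong[where f="\<lambda>v. Poly_Mapping.lookup v j"]
            simp: lookup_add lookup_minus lookup_single when_def split: if_splits)
    qed
    then have "infinite (range (\<lambda>j. el j + \<gamma> - el j))"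
      by (simp add: finite_image_iff)
    moreover have "range (\<lambda>j. el j + \<gamma> - el j) \<subseteq> supp f"
      using mem by auto
    ultimately show False
      using f finite_subset fs_finite by blast
  qed
  have "S.bet (Poly_Mapping.single j 1) (lv \<gamma>) = S.bet (lv \<gamma>) (Poly_Mapping.single j 1)" for j
  proof -
    have c: "el j + \<gamma> = \<gamma> + el j"
      using ls0 by (intro lamp_comm) simp_all
    have e1: "- el j + (el j + \<gamma>) = \<gamma>"
      by (simp add: add.assoc[symmetric])
    have e2: "(el j + \<gamma>) - el j = \<gamma>"
      unfolding c by simp
    have "conv (mon \<one> (el j)) f (el j + \<gamma>) = conv f (mon \<one> (el j)) (el j + \<gamma>)"
      by (simp only: comm)
    then have "S.ltw (el j) \<gamma> \<otimes> f \<gamma> = f \<gamma> \<otimes> S.ltw \<gamma> (el j)"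
      using f by (simp add: conv_mon conv_mon_right e1 e2 del: add_minus_cancel minus_add_cancel)
    then have "S.ltw (el j) \<gamma> = S.ltw \<gamma> (el j)"
      using f \<gamma> m_rcancel[of "f \<gamma>" "S.ltw (el j) \<gamma>" "S.ltw \<gamma> (el j)"] by (simp add: supp_def m_comm)
    then show ?thesis
      by (simp add: S.ltw_def ls0)
  qed
  then have "lv \<gamma> = 0"
    using bet_nondegenerate by blast
  with ls0 show "\<gamma> \<in> {0}"
    by (auto intro: lamp.expand)
qed

text \<open>
  Take an element \<open>f\<close> of the ideal that has a constant term, first with the fewest \<open>\<sigma>\<close>-degrees and then with
  the fewest terms in degree zero. Its commutators with lamps are smaller, hence vanish, so \<open>f\<close> is a scalar.
\<close>

theorem tga_simple:
  assumes J: "ideal J tga" and nz: "J \<noteq> {\<zero>\<^bsub>tga\<^esub>}"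
  shows "J = carrier tga"
proof -
  interpret J: ideal J tga
    by fact
  let ?Z = "\<lambda>_ :: lamp. \<zero>"
  have Jfs: "f \<in> fs" if "f \<in> J" for f
    using J.a_subset that by auto
  have JL: "conv x f \<in> J" and JR: "conv f x \<in> J" if "f \<in> J" "x \<in> fs" for f x
    using J.I_l_closed[of f x] J.I_r_closed[of f x] that by auto
  define Q where "Q = {f \<in> J. 0 \<in> supp f}"
  define degs where "degs f = card (ls ` supp f)" for f
  define zero_degs where "zero_degs f = card {g \<in> supp f. ls g = 0}" for f
  \<comment> \<open>Any term can be moved to the identity, so every nonzero element of the ideal has
    a translate in \<open>Q\<close>.\<close>
  have trans: "\<exists>g\<in>Q. supp g = (\<lambda>x. - z + x) ` supp f" if "f \<in> J" "z \<in> supp f" for f z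
  proof (rule bexI)
    show s: "supp (conv (mon \<one> (- z)) f) = (\<lambda>x. - z + x) ` supp f"
      using that Jfs by (simp add: supp_conv_mon)
    show "conv (mon \<one> (- z)) f \<in> Q"
      using that JL by (auto simp: Q_def s intro: image_eqI[of _ _ z])
  qed
  obtain f0 where f0: "f0 \<in> J" "f0 \<noteq> ?Z"
    using nz J.zero_closed by auto
  then obtain z0 where "z0 \<in> supp f0"
    using supp_eq_empty_iff by blast
  then obtain q0 where "q0 \<in> Q"
    using trans f0 by blast
  moreover have "wf (measures [degs, zero_degs])"
    by simp
  ultimately obtain f where fQ: "f \<in> Q" and min: "\<And>g. (g, f) \<in> measures [degs, zero_degs] \<Longrightarrow> g \<notin> Q"
    using wfE_min by metis
  have fJ: "f \<in> J" and f: "f \<in> fs" and f_0: "0 \<in> supp f"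
    using fQ Jfs by (auto simp: Q_def)
  have "conv (mon \<one> (el j)) f = conv f (mon \<one> (el j))" for j
  proof (rule ccontr)
    let ?u = "mon \<one> (el j)"
    assume ne: "conv ?u f \<noteq> conv f ?u"
    define g where "g = conv ?u f \<ominus>\<^bsub>tga\<^esub> conv f ?u"
    have u: "conv ?u f \<in> fs" "conv f ?u \<in> fs"
      using f by simp_all
    have gJ: "g \<in> J"
      unfolding g_def a_minus_def using fJ JL JR by (intro J.a_closed J.a_inv_closed) simp_all
    have gz: "g z = conv ?u f z \<ominus> conv f ?u z" for z
      using u by (simp add: g_def a_minus_tga)
    have "g \<noteq> ?Z"
    proof
      assume "g = ?Z"
      then have "conv ?u f z \<ominus> conv f ?u z = \<zero>" for z
        using gz[of z] by simp
      then have "conv ?u f z = conv f ?u z" for z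
        using r_right_minus_eq fs_closed[OF u(1)] fs_closed[OF u(2)] by blast
      with ne show False
        by blast
    qed
    then obtain z1 where z1: "z1 \<in> supp g"
      using supp_eq_empty_iff by blast
    \<comment> \<open>A term of degree zero is preferred as centre of the translation, since moving
      it to the identity leaves all degrees unchanged.\<close>
    obtain z where z: "z \<in> supp g" "(\<exists>z\<in>supp g. ls z = 0) \<Longrightarrow> ls z = 0"
      using z1 by metis
    have sg: "supp g \<subseteq> supp (conv ?u f) \<union> supp (conv f ?u)"
      using u by (auto simp: supp_def gz)
    then have lsg: "ls ` supp g \<subseteq> ls ` supp f"
      using f by (fastforce simp: supp_conv_mon image_iff)
    \<comment> \<open>Degree-zero terms of the commutator come from degree-zero terms y of
      \<open>f\<close> and sit at \<open>el j + y\<close>, with coefficient \<open>f y\<close> times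
      a difference of twists. At y = 0 both twists are one, so the constant term drops out.\<close>
    have Eg: "{x \<in> supp g. ls x = 0} \<subseteq> (\<lambda>x. el j + x) ` ({x \<in> supp f. ls x = 0} - {0})"
    proof
      fix x assume x: "x \<in> {x \<in> supp g. ls x = 0}"
      define y where "y = - el j + x"
      have lsy: "ls y = 0"
        using x by (simp add: y_def)
      have xy: "x = el j + y"
        by (simp add: y_def add.assoc[symmetric])
      have xy': "x - el j = y"
        using lsy lamp_comm[of "el j" y] by (simp add: xy)
      have val: "g x = S.ltw (el j) y \<otimes> f y \<ominus> f y \<otimes> S.ltw y (el j)"
        using f by (simp add: gz conv_mon conv_mon_right xy' flip: y_def)
      have "g x \<noteq> \<zero>"
        using x by (simp add: supp_def)
      then have "f y \<noteq> \<zero>" "y \<noteq> 0"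
        using f val by (auto simp: minus_eq r_neg units_of_one)
      then show "x \<in> (\<lambda>x. el j + x) ` ({x \<in> supp f. ls x = 0} - {0})"
        using lsy xy by (auto simp: supp_def)
    qed
    have "zero_degs g \<le> card ({x \<in> supp f. ls x = 0} - {0})"
      unfolding zero_degs_def using f by (intro surj_card_le[OF _ Eg]) simp
    also have "\<dots> < zero_degs f"
      unfolding zero_degs_def using f f_0 by (intro card_Diff1_less) auto
    finally have E: "zero_degs g < zero_degs f" .
    obtain h where h: "h \<in> Q" "supp h = (\<lambda>x. - z + x) ` supp g"
      using trans gJ z by blast
    have "ls ` supp h = (\<lambda>n. - ls z + n) ` ls ` supp g"
      by (simp add: h image_image)
    then have Dh: "degs h = degs g"
      unfolding degs_def by (simp add: card_image)
    \<comment> \<open>If the commutator has a term of degree zero, \<open>zero_degs\<close> falls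
      while \<open>degs\<close> does not grow; otherwise degree zero has been lost and
      \<open>degs\<close> itself falls. The translate \<open>h\<close> has the same counts in the
      first case and the same \<open>degs\<close> in the second.\<close>
    show False
    proof (cases "\<exists>z\<in>supp g. ls z = 0")
      case True
      then have lz: "ls z = 0"
        using z by blast
      have "{x \<in> supp h. ls x = 0} = (\<lambda>x. - z + x) ` {x \<in> supp g. ls x = 0}"
        unfolding h using lz by auto
      then have "zero_degs h = zero_degs g"
        unfolding zero_degs_def by (simp add: card_image)
      moreover have "degs g \<le> degs f"
        unfolding degs_def using lsg f by (intro card_mono) auto
      ultimately have "(h, f) \<in> measures [degs, zero_degs]"
        using E Dh by auto
      then show False
        using min h by blast
    next
      case False
      have "ls ` supp g \<subset> ls ` supp f"
      proof
        show "ls ` supp g \<subseteq> ls ` supp f"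
          by (rule lsg)
        have "0 \<in> ls ` supp f"
          using f_0 by (force intro: image_eqI[of _ _ 0])
        then show "ls ` supp g \<noteq> ls ` supp f"
          using False by (metis imageE)
      qed
      then have "degs g < degs f"
        unfolding degs_def using f by (intro psubset_card_mono) auto
      then have "(h, f) \<in> measures [degs, zero_degs]"
        using Dh by auto
      then show False
        using min h by blast
    qed
  qed
  then have "supp f \<subseteq> {0}"
    by (rule commute_el_imp_scalar[OF f])
  then have fm: "f = mon (f 0) 0"
    by (auto simp: fun_eq_iff mon_def supp_def)
  have f0u: "f 0 \<in> Units K"
    using f f_0 by (simp add: field_Units supp_def)
  have "conv (mon (inv (f 0)) 0) f = mon \<one> 0"
    by (subst fm, subst conv_mon_mon) (use f f0u in \<open>simp_all add: units_of_one\<close>)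
  then have "\<one>\<^bsub>tga\<^esub> \<in> J"
    using JL[OF fJ, of "mon (inv (f 0)) 0"] f0u by simp
  then show ?thesis
    by (rule J.one_imp_carrier)
qed

section \<open>Finite generation of the twisted group algebra\<close>

definition gens :: "(lamp \<Rightarrow> 'b) set"
  where "gens = mon \<one> ` {el 0, - el 0, Lamp 0 1, - Lamp 0 1}"

lemma gens_fs: "gens \<subseteq> fs" and finite_gens: "finite gens"
  by (auto simp: gens_def)

text \<open>The coefficient has to compensate the twist of \<open>g\<close> with its inverse. One
  \<open>d\<close> serves both sides, because the cocycle identity for g, -g, g makes the twists of
  (g, -g) and (-g, g) equal.\<close>

lemma mon_inverse:
  assumes "c \<in> Units K"
  obtains d where "d \<in> Units K" "conv (mon c g) (mon d (- g)) = mon \<one> 0"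
    "conv (mon d (- g)) (mon c g) = mon \<one> 0"
proof -
  define e where "e = c \<otimes> S.ltw g (- g)"
  have u: "S.ltw a b \<in> Units K" for a b
    using S.ltw_closed[of a b] by (simp add: units_of_carrier)
  have e: "e \<in> Units K"
    using assms u by (simp add: e_def)
  define d where "d = inv e"
  have d: "d \<in> Units K" "d \<in> carrier K" "c \<in> carrier K"
    using e assms by (auto simp: d_def)
  have sym: "S.ltw (- g) g = S.ltw g (- g)"
    using tw_cocycle[of "g" "- g" g] by (simp add: units_of_one)
  have "c \<otimes> d \<otimes> S.ltw g (- g) = e \<otimes> d"
    using d by (simp add: e_def m_ac)
  then have "c \<otimes> d \<otimes> S.ltw g (- g) = \<one>"
    using Units_r_inv[OF e] by (simp add: d_def)
  then have "conv (mon c g) (mon d (- g)) = mon \<one> 0" "conv (mon d (- g)) (mon c g) = mon \<one> 0"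
    using d by (simp_all add: conv_mon_mon sym m_comm)
  with d that show thesis
    by blast
qed

text \<open>Conjugating \<open>el 0\<close> by powers of the shift gives every lamp, the lamps
  generate all configurations, and each element is a configuration times a power of the
  shift.\<close>

lemma lamp_generated:
  assumes H0: "0 \<in> H" and Hadd: "\<And>a b. a \<in> H \<Longrightarrow> b \<in> H \<Longrightarrow> a + b \<in> H"
    and Hneg: "\<And>a. a \<in> H \<Longrightarrow> - a \<in> H" and Hel: "el 0 \<in> H" and Hs: "Lamp 0 1 \<in> H"
  shows "a \<in> H"
proof -
  have eqI: "a = b" if "lv a = lv b" "ls a = ls b" for a b
    using that by (rule lamp.expand[OF conjI])
  have s: "Lamp 0 n \<in> H" for n
  proof (induction n rule: int_induct[where k = 0])
    case base
    then show ?case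
      using H0 by (simp add: zero_lamp_def)
  next
    case (step1 i)
    have "Lamp 0 (i + 1) = Lamp 0 i + Lamp 0 1"
      by (rule eqI) simp_all
    with step1 show ?case
      using Hadd Hs by simp
  next
    case (step2 i)
    have "Lamp 0 (i - 1) = Lamp 0 i + - Lamp 0 1"
      by (rule eqI) (simp_all only: lamp_sel lamp.sel sh_zero, simp_all)
    with step2 show ?case
      using Hadd Hneg Hs by metis
  qed
  have e: "el i \<in> H" for i
  proof -
    have "el i = Lamp 0 i + el 0 + Lamp 0 (- i)"
      by (rule eqI) (simp_all add: sh_single del: single_one)
    then show ?thesis
      using Hadd Hel s by metis
  qed
  have v: "Lamp v 0 \<in> H" for v
    using subset_UNIV[of "Poly_Mapping.keys v"]
  proof (induction v rule: frag_induction)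
    case zero
    then show ?case
      using H0 by (simp add: zero_lamp_def)
  next
    case (one x)
    then show ?case
      using e[of x] by (simp add: el_def)
  next
    case (diff a b)
    have "Lamp (a - b) 0 = Lamp a 0 + - Lamp b 0"
      by (rule eqI) (simp_all only: lamp_sel lamp.sel, simp_all)
    with diff show ?case
      using Hadd Hneg by metis
  qed
  have "a = Lamp (lv a) 0 + Lamp 0 (ls a)"
    by (rule eqI) simp_all
  then show ?thesis
    using Hadd v s by metis
qed

text \<open>\<open>V\<close> is only known to be an additive monoid stable under left multiplication
  by the generators. The set \<open>M\<close> of left multipliers of \<open>V\<close> is closed
  under addition and multiplication, and once it is everything, applying it to the identity in
  \<open>V\<close> gives the claim.\<close>

theorem tga_generated:
  assumes V: "V \<subseteq> fs" and V1: "mon \<one> 0 \<in> V" and V0: "(\<lambda>_. \<zero>) \<in> V"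
    and Vadd: "\<And>f g. f \<in> V \<Longrightarrow> g \<in> V \<Longrightarrow> (\<lambda>z. f z \<oplus> g z) \<in> V"
    and Vgen: "\<And>x f. x \<in> gens \<Longrightarrow> f \<in> V \<Longrightarrow> conv x f \<in> V"
  shows "V = fs"
proof -
  define M where "M = {x \<in> fs. \<forall>f\<in>V. conv x f \<in> V}"
  have Mfs: "x \<in> fs" if "x \<in> M" for x
    using that by (simp add: M_def)
  have Mmult: "conv x y \<in> M" if "x \<in> M" "y \<in> M" for x y
    using that V by (auto simp: M_def conv_assoc subset_iff)
  have Madd: "(\<lambda>z. x z \<oplus> y z) \<in> M" if "x \<in> M" "y \<in> M" for x y
    using that V Vadd by (auto simp: M_def conv_add_left subset_iff)
  have M1: "mon \<one> 0 \<in> M"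
    using V by (auto simp: M_def conv_one_left subset_iff)
  have M0: "(\<lambda>_. \<zero>) \<in> M"
    using V0 by (simp add: M_def)
  have Mg: "gens \<subseteq> M"
    using gens_fs Vgen by (auto simp: M_def)
  define P where "P x \<longleftrightarrow> x \<in> M \<and> (\<exists>y\<in>M. conv x y = mon \<one> 0 \<and> conv y x = mon \<one> 0)" for x
  have Pmult: "P (conv x y)" if xy: "P x" "P y" for x y
  proof -
    obtain x' y' where xi: "x' \<in> M" "conv x x' = mon \<one> 0" "conv x' x = mon \<one> 0"
      and yi: "y' \<in> M" "conv y y' = mon \<one> 0" "conv y' y = mon \<one> 0"
      using xy by (auto simp: P_def)
    have fs: "x \<in> fs" "y \<in> fs" "x' \<in> fs" "y' \<in> fs"
      using xy xi yi Mfs by (auto simp: P_def)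
    have "conv (conv x y) (conv y' x') = conv x (conv (conv y y') x')"
      using fs by (simp add: conv_assoc)
    moreover have "conv (conv y' x') (conv x y) = conv y' (conv (conv x' x) y)"
      using fs by (simp add: conv_assoc)
    ultimately have "conv (conv x y) (conv y' x') = mon \<one> 0" "conv (conv y' x') (conv x y) = mon \<one> 0"
      using fs xi yi by (simp_all add: conv_one_left)
    then show ?thesis
      using xy xi yi Mmult unfolding P_def by blast
  qed
  \<comment> \<open>Products of monomials pick up twists, so for a group element one can only ask
    that some unit multiple of its monomial be invertible inside \<open>M\<close>.\<close>
  define H where "H = {g. \<exists>c\<in>Units K. P (mon c g)}"
  have u: "S.ltw a b \<in> Units K" for a b
    using S.ltw_closed[of a b] by (simp add: units_of_carrier)
  have all: "g \<in> H" for g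
  proof (rule lamp_generated)
    show "0 \<in> H"
      using M1 conv_one_left[OF mon_fs[OF one_closed], of 0] by (auto simp: H_def P_def)
    fix a b assume "a \<in> H" "b \<in> H"
    then obtain c d where cd: "c \<in> Units K" "d \<in> Units K" "P (mon c a)" "P (mon d b)"
      by (auto simp: H_def)
    then have "P (mon (c \<otimes> d \<otimes> S.ltw a b) (a + b))"
      using Pmult[of "mon c a" "mon d b"] by (simp add: conv_mon_mon Units_closed)
    then show "a + b \<in> H"
      using cd u unfolding H_def by blast
  next
    fix a assume "a \<in> H"
    then obtain c where c: "c \<in> Units K" "P (mon c a)"
      by (auto simp: H_def)
    obtain d where d: "d \<in> Units K" "conv (mon c a) (mon d (- a)) = mon \<one> 0"
      "conv (mon d (- a)) (mon c a) = mon \<one> 0"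
      using mon_inverse c by metis
    obtain y where y: "y \<in> M" "conv (mon c a) y = mon \<one> 0" "conv y (mon c a) = mon \<one> 0"
      using c by (auto simp: P_def)
    have fs: "mon c a \<in> fs" "mon d (- a) \<in> fs" "y \<in> fs"
      using c d y Mfs by (auto simp: Units_closed)
    have "mon d (- a) = conv (mon d (- a)) (conv (mon c a) y)"
      using fs by (simp add: y conv_one_right)
    also have "\<dots> = conv (conv (mon d (- a)) (mon c a)) y"
      by (rule conv_assoc[symmetric, OF fs(2,1,3)])
    also have "\<dots> = y"
      using fs by (simp add: d conv_one_left)
    finally have "mon d (- a) = y" .
    then have "P (mon d (- a))"
      using c d y unfolding P_def by blast
    then show "- a \<in> H"
      using d unfolding H_def by blast
  next
    \<comment> \<open>Self-twists of the two generators are trivial since \<open>twist_seq\<close>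
      is one at 0, so the inverse of such a monomial with coefficient one again has coefficient one
      and belongs to \<open>gens\<close>.\<close>
    have inv1: "S.ltw a (- a) = \<one>" "S.ltw (- a) a = \<one>" if "a = el 0 \<or> a = Lamp 0 1" for a
    proof -
      have "S.bet (Poly_Mapping.single 0 1) (- Poly_Mapping.single 0 1) = \<one>"
      proof -
        have "S.bet (Poly_Mapping.single 0 1) (Poly_Mapping.single 0 1) = \<one>"
          unfolding S.bet_single by (simp add: twist_seq_nonpos)
        then show ?thesis
          using S.bet_add_right[of "Poly_Mapping.single 0 1" "Poly_Mapping.single 0 1" "- Poly_Mapping.single 0 1"]
            S.bet_closed[of "Poly_Mapping.single 0 1" "- Poly_Mapping.single 0 1"]
          by (auto simp: units_of_mult units_of_one units_of_carrier simp del: S.bet_closed)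
      qed
      then show "S.ltw a (- a) = \<one>"
        using that by (auto simp: S.ltw_def units_of_one simp del: single_one)
      then show "S.ltw (- a) a = \<one>"
        using tw_cocycle[of "a" "- a" a] by (simp add: units_of_one)
    qed
    have "P (mon \<one> a)" if "a = el 0 \<or> a = Lamp 0 1" for a
      unfolding P_def
    proof (intro conjI bexI[of _ "mon \<one> (- a)"])
      show "mon \<one> a \<in> M" "mon \<one> (- a) \<in> M"
        using that Mg by (auto simp: gens_def)
      show "conv (mon \<one> a) (mon \<one> (- a)) = mon \<one> 0" "conv (mon \<one> (- a)) (mon \<one> a) = mon \<one> 0"
        using inv1[OF that] by (simp_all add: conv_mon_mon)
    qed
    then show "el 0 \<in> H" "Lamp 0 1 \<in> H"
      unfolding H_def by (auto intro!: bexI[of _ \<one>])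
  qed
  \<comment> \<open>For lamps x and y at distance 2^m, x y = c y x with c =
    \<open>unit_enum m\<close>, whatever their unit coefficients. Hence c = x y z, where z inverts y
    x within \<open>M\<close>.\<close>
  have kapM: "kap c \<in> M" if c: "c \<in> Units K" for c
  proof -
    obtain m where m: "unit_enum m = c"
      using unit_enum_infinitely_often[OF c] by blast
    obtain d e where de: "d \<in> Units K" "e \<in> Units K" "P (mon d (el (2 ^ m)))" "P (mon e (el 0))"
      using all[of "el (2 ^ m)"] all[of "el 0"] by (auto simp: H_def)
    define x y where "x = mon d (el (2 ^ m))" and "y = mon e (el 0)"
    have xy: "x \<in> fs" "y \<in> fs" "P x" "P y"
      using de by (auto simp: x_def y_def Units_closed)
    obtain z where z: "z \<in> M" "conv (conv y x) z = mon \<one> 0"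
      using Pmult[OF xy(4,3)] by (auto simp: P_def)
    have "S.ltw (el (2 ^ m)) (el 0) = c" "S.ltw (el 0) (el (2 ^ m)) = \<one>"
      unfolding S.ltw_def by (simp_all only: el_sel sh_0 S.bet_single, simp_all add: twist_seq_pow m twist_seq_nonpos)
    moreover have "el (2 ^ m) + el 0 = el 0 + el (2 ^ m)"
      by (rule lamp_comm) simp_all
    ultimately have "conv x y = conv (kap c) (conv y x)"
      using de c unfolding x_def y_def kap_def by (simp add: conv_mon_mon m_ac units_of_one Units_closed)
    then have "conv (conv x y) z = conv (kap c) (conv (conv y x) z)"
      using xy z Mfs c by (simp add: conv_assoc kap_def Units_closed)
    also have "\<dots> = kap c"
      using c by (simp add: z kap_def conv_one_right Units_closed)
    finally show ?thesis
      using Mmult z xy by (metis P_def)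
  qed
  have monM: "mon c g \<in> M" if c: "c \<in> carrier K" for c g
  proof (cases "c = \<zero>")
    case True
    then show ?thesis
      using M0 by simp
  next
    case False
    obtain d where d: "d \<in> Units K" "P (mon d g)"
      using all[of g] by (auto simp: H_def)
    have cd: "c \<otimes> inv d \<in> Units K"
      using c d False by (intro Units_m_closed Units_inv_Units) (simp_all add: field_Units)
    have "conv (kap (c \<otimes> inv d)) (mon d g) = mon c g"
      using c d by (simp add: kap_def conv_mon_mon units_of_one m_assoc Units_closed)
    then show ?thesis
      using Mmult[OF kapM[OF cd]] d by (metis P_def)
  qed
  have "f \<in> M" if "f \<in> fs" for f
    using that by (induction rule: fs_induct) (auto simp: M0 monM Madd)
  then have "f \<in> V" if "f \<in> fs" for f
    using that V1 conv_one_right[OF that] by (fastforce simp: M_def)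
  with V show ?thesis
    by blast
qed

text \<open>\<open>ore_on_extend\<close> climbs a chain of subgroups. Over no lamps there are only
  scalars, which commute; each further lamp is adjoined with its exponent as degree; two elements
  involve finitely many lamps, which settles all configurations; the last step takes the shift
  exponent as degree.\<close>

theorem tga_ore:
  assumes "a \<in> fs" "b \<in> fs" "a \<noteq> (\<lambda>_. \<zero>)" "b \<noteq> (\<lambda>_. \<zero>)"
  shows "\<exists>r\<in>fs. \<exists>s\<in>fs. r \<noteq> (\<lambda>_. \<zero>) \<and> conv a r = conv b s"
proof -
  let ?H = "\<lambda>I. {g. ls g = 0 \<and> Poly_Mapping.keys (lv g) \<subseteq> I}"
  have fin: "ore_on (?H I)" if "finite I" for I
    using that
  proof (induction I)
    case empty
    have H: "?H {} = {0}"
      by (auto intro: lamp.expand)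
    show ?case
      unfolding H ore_on_def
    proof (intro ballI impI)
      fix a b assume ab: "a \<in> fs" "b \<in> fs" "supp a \<subseteq> {0}" "supp b \<subseteq> {0}"
        "a \<noteq> (\<lambda>_. \<zero>)" "b \<noteq> (\<lambda>_. \<zero>)"
      have "a = kap (a 0)"
        using ab(3) by (auto simp: kap_def mon_def supp_def fun_eq_iff)
      then obtain c where "c \<in> carrier K" "a = kap c"
        using fs_closed[OF ab(1)] by blast
      then have "conv a b = conv b a"
        using kap_central ab(2) by simp
      then show "ore_pair {0} a b"
        using ab unfolding ore_pair_def by blast
    qed
  next
    case (insert i I)
    show ?case
    proof (rule ore_on_extend[where d = "\<lambda>g. Poly_Mapping.lookup (lv g) i"])
      fix g h assume gh: "g \<in> ?H (insert i I)" "h \<in> ?H (insert i I)"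
      then show "g + h \<in> ?H (insert i I)"
        using keys_add[of "lv g" "lv h"] by auto
      show "Poly_Mapping.lookup (lv (g + h)) i = Poly_Mapping.lookup (lv g) i + Poly_Mapping.lookup (lv h) i"
        using gh by (simp add: lookup_add)
    next
      fix n
      show "\<exists>h\<in>?H (insert i I). Poly_Mapping.lookup (lv h) i = n"
        by (rule bexI[of _ "Lamp (Poly_Mapping.single i n) 0"]) auto
    next
      have "{h \<in> ?H (insert i I). Poly_Mapping.lookup (lv h) i = 0} = ?H I"
        using insert.hyps by (auto simp: in_keys_iff)
      then show "ore_on {h \<in> ?H (insert i I). Poly_Mapping.lookup (lv h) i = 0}"
        using insert.IH by simp
    qed
  qed
  have lamps: "ore_on {g. ls g = 0}"
    unfolding ore_on_def
  proof (intro ballI impI)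
    fix a b assume ab: "a \<in> fs" "b \<in> fs" "supp a \<subseteq> {g. ls g = 0}" "supp b \<subseteq> {g. ls g = 0}"
      "a \<noteq> (\<lambda>_. \<zero>)" "b \<noteq> (\<lambda>_. \<zero>)"
    define I where "I = (\<Union>g\<in>supp a \<union> supp b. Poly_Mapping.keys (lv g))"
    have "finite I"
      using ab by (simp add: I_def)
    moreover have "supp a \<subseteq> ?H I" "supp b \<subseteq> ?H I"
      using ab by (auto simp: I_def)
    ultimately have "ore_pair (?H I) a b"
      using fin ab unfolding ore_on_def by blast
    then obtain r s where "r \<in> fs" "s \<in> fs" "supp r \<subseteq> ?H I" "supp s \<subseteq> ?H I"
      "r \<noteq> (\<lambda>_. \<zero>)" "conv a r = conv b s"
      unfolding ore_pair_def by blast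
    moreover from this have "supp r \<subseteq> {g. ls g = 0}" "supp s \<subseteq> {g. ls g = 0}"
      by auto
    ultimately show "ore_pair {g. ls g = 0} a b"
      unfolding ore_pair_def by blast
  qed
  have "ore_on UNIV"
  proof (rule ore_on_extend[where d = ls])
    show "\<exists>h\<in>UNIV. ls h = n" for n
      by (rule bexI[of _ "Lamp 0 n"]) auto
    show "ore_on {h \<in> UNIV. ls h = 0}"
      using lamps by simp
  qed auto
  then have "ore_pair UNIV a b"
    using assms unfolding ore_on_def by blast
  then show ?thesis
    unfolding ore_pair_def by blast
qed

section \<open>A nonzero element without right inverse\<close>

definition one_plus_shift :: "lamp \<Rightarrow> 'b"
  where "one_plus_shift = (\<lambda>z. mon \<one> 0 z \<oplus> mon \<one> (Lamp 0 1) z)"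

lemma one_plus_shift_fs [simp]: "one_plus_shift \<in> fs"
  by (simp add: one_plus_shift_def)

lemma one_plus_shift_nonzero: "one_plus_shift \<noteq> (\<lambda>_. \<zero>)"
proof
  assume "one_plus_shift = (\<lambda>_. \<zero>)"
  moreover have "Lamp 0 1 \<noteq> 0"
    by (simp add: zero_lamp_def)
  then have "one_plus_shift 0 = \<one>"
    by (auto simp: one_plus_shift_def mon_def)
  ultimately show False
    by simp
qed

lemma one_plus_shift_mult: "r \<in> fs \<Longrightarrow> conv one_plus_shift r z = r z \<oplus> S.ltw (Lamp 0 1) (- Lamp 0 1 + z) \<otimes> r (- Lamp 0 1 + z)"
  unfolding one_plus_shift_def by (subst conv_add_left) (simp_all add: conv_one_left, simp add: conv_mon)

text \<open>Multiplication by 1 + \<sigma> widens the range of shift degrees: terms survive in the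
  lowest degree of \<open>r\<close> and in one more than its highest degree. The identity would
  force these to coincide.\<close>

lemma one_plus_shift_no_right_inverse:
  assumes r: "r \<in> fs"
  shows "conv one_plus_shift r \<noteq> mon \<one> 0"
proof
  assume eq: "conv one_plus_shift r = mon \<one> 0"
  let ?s = "Lamp 0 1"
  have "r \<noteq> (\<lambda>_. \<zero>)"
    using eq by (auto simp: mon_eq_zero_iff dest: sym)
  then have ne: "finite (ls ` supp r)" "ls ` supp r \<noteq> {}"
    using r by (auto simp: supp_eq_empty_iff)
  obtain g where g: "g \<in> supp r" "ls g = Max (ls ` supp r)"
    using Max_in[OF ne] by force
  obtain h where h: "h \<in> supp r" "ls h = Min (ls ` supp r)"
    using Min_in[OF ne] by force
  have le: "ls h \<le> ls g"
    using g h ne by simp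
  have z1: "r (?s + g) = \<zero>"
  proof (rule ccontr)
    assume "r (?s + g) \<noteq> \<zero>"
    then have "ls (?s + g) \<le> Max (ls ` supp r)"
      using ne(1) by (intro Max_ge imageI) (simp_all add: supp_def)
    then show False
      using g by simp
  qed
  have z2: "r (- ?s + h) = \<zero>"
  proof (rule ccontr)
    assume "r (- ?s + h) \<noteq> \<zero>"
    then have "Min (ls ` supp r) \<le> ls (- ?s + h)"
      using ne(1) by (intro Min_le imageI) (simp_all add: supp_def)
    then show False
      using h by simp
  qed
  have "conv one_plus_shift r (?s + g) \<noteq> \<zero>"
    using g r z1 tw_nonzero by (simp add: one_plus_shift_mult supp_def integral_iff add.assoc[symmetric])
  then have "?s + g = 0"
    unfolding eq by (auto simp: mon_def split: if_splits)
  then have "ls (?s + g) = ls 0"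
    by simp
  then have "ls g = - 1"
    by (simp only: lamp_sel lamp.sel)
  moreover have "conv one_plus_shift r h \<noteq> \<zero>"
    using h r z2 by (simp add: one_plus_shift_mult supp_def)
  then have "h = 0"
    unfolding eq by (auto simp: mon_def split: if_splits)
  ultimately show False
    using le by simp
qed

text \<open>This expresses that the right ideal generated by \<open>q\<close> is
  infinite-dimensional over \<open>K\<close>: a monomial carries a chosen point of the support of
  \<open>q\<close> to a prescribed element outside \<open>Z\<close>.\<close>

lemma supp_right_multiples_unbounded:
  assumes q: "q \<in> fs" "q \<noteq> (\<lambda>_. \<zero>)" and Z: "finite Z"
  shows "\<exists>r\<in>fs. \<not> supp (conv q r) \<subseteq> Z"
proof -
  obtain a where a: "a \<in> supp q"
    using q supp_eq_empty_iff by blast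
  have "inj (Lamp 0)"
    by (simp add: inj_def)
  then have "infinite (UNIV :: lamp set)"
    by (metis finite_subset infinite_UNIV_int subset_UNIV finite_image_iff)
  then obtain z where z: "z \<notin> Z"
    using Z by (metis ex_new_if_finite)
  have "z \<in> supp (conv q (mon \<one> (- a + z)))"
    using a q by (auto simp: supp_conv_mon add.assoc[symmetric] intro: image_eqI[of _ _ a])
  with z show ?thesis
    by (intro bexI[of _ "mon \<one> (- a + z)"]) auto
qed

end

section \<open>The just infinite subalgebra\<close>

text \<open>Only additive structure is assumed, so that the rule also applies to
  \<open>tensor_free\<close>, for which just the additive group is established.\<close>

lemma lspan_induct [consumes 2, case_names closed zero add smult]:
  assumes "abelian_monoid A" "x \<in> lspan k A S"
    and closed: "\<And>c s. c \<in> carrier k \<Longrightarrow> s \<in> S \<Longrightarrow> c \<odot>\<^bsub>A\<^esub> s \<in> carrier A"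
    and zero: "P \<zero>\<^bsub>A\<^esub>"
    and add: "\<And>a b. a \<in> carrier A \<Longrightarrow> b \<in> carrier A \<Longrightarrow> P a \<Longrightarrow> P b \<Longrightarrow> P (a \<oplus>\<^bsub>A\<^esub> b)"
    and smult: "\<And>c s. c \<in> carrier k \<Longrightarrow> s \<in> S \<Longrightarrow> P (c \<odot>\<^bsub>A\<^esub> s)"
  shows "x \<in> carrier A \<and> P x"
proof -
  interpret abelian_monoid A
    by fact
  obtain T c where T: "x = finsum A (\<lambda>s. c s \<odot>\<^bsub>A\<^esub> s) T" "finite T" "T \<subseteq> S" "c \<in> T \<rightarrow> carrier k"
    using assms(2) by (auto simp: lspan_def)
  have "finsum A (\<lambda>s. c s \<odot>\<^bsub>A\<^esub> s) T \<in> carrier A \<and> P (finsum A (\<lambda>s. c s \<odot>\<^bsub>A\<^esub> s) T)"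
    using T(2-)
  proof (induction T)
    case empty
    then show ?case
      using zero by simp
  next
    case (insert s T)
    have "(\<lambda>s. c s \<odot>\<^bsub>A\<^esub> s) \<in> T \<rightarrow> carrier A" "c s \<odot>\<^bsub>A\<^esub> s \<in> carrier A" "P (c s \<odot>\<^bsub>A\<^esub> s)"
      using insert.prems closed smult by (auto simp: Pi_def)
    then show ?case
      using insert add by simp
  qed
  with T show ?thesis
    by simp
qed

text \<open>
  The map \<open>sp\<close> stands for the support of an element; it replaces dimension counts, since the elements
  of a finite-dimensional space have supports in a common finite set.
\<close>

locale ambient = ring R + k: field k + K: field K
  for R :: "'r ring" (structure) and k :: "'k ring" and K :: "'b ring" +
  fixes phi :: "'k \<Rightarrow> 'b" and kap :: "'b \<Rightarrow> 'r" and t :: 'b and y :: 'r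
    and gens :: "'r set" and sp :: "'r \<Rightarrow> 'g set"
  assumes phi_hom: "phi \<in> ring_hom k K"
    and kap_hom: "kap \<in> ring_hom K R"
    and kap_central: "c \<in> carrier K \<Longrightarrow> r \<in> carrier R \<Longrightarrow> kap c \<otimes> r = r \<otimes> kap c"
    and integral: "a \<in> carrier R \<Longrightarrow> b \<in> carrier R \<Longrightarrow> a \<otimes> b = \<zero> \<Longrightarrow> a = \<zero> \<or> b = \<zero>"
    and ore: "a \<in> carrier R \<Longrightarrow> b \<in> carrier R \<Longrightarrow> a \<noteq> \<zero> \<Longrightarrow> b \<noteq> \<zero> \<Longrightarrow>
          \<exists>r\<in>carrier R. \<exists>s\<in>carrier R. r \<noteq> \<zero> \<and> a \<otimes> r = b \<otimes> s"
    and simple: "ideal J R \<Longrightarrow> J \<noteq> {\<zero>} \<Longrightarrow> J = carrier R"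
    and gens_finite: "finite gens" and gens_closed: "gens \<subseteq> carrier R"
    and generated: "V \<subseteq> carrier R \<Longrightarrow> \<one> \<in> V \<Longrightarrow> \<zero> \<in> V \<Longrightarrow> (\<And>a b. a \<in> V \<Longrightarrow> b \<in> V \<Longrightarrow> a \<oplus> b \<in> V)
          \<Longrightarrow> (\<And>g a. g \<in> gens \<Longrightarrow> a \<in> V \<Longrightarrow> g \<otimes> a \<in> V) \<Longrightarrow> V = carrier R"
    and t_closed [simp]: "t \<in> carrier K" and t_new: "t \<notin> phi ` carrier k"
    and y_closed [simp]: "y \<in> carrier R" and y_nonzero: "y \<noteq> \<zero>"
    and y_no_inverse: "r \<in> carrier R \<Longrightarrow> y \<otimes> r \<noteq> \<one>"
    and sp_finite: "r \<in> carrier R \<Longrightarrow> finite (sp r)"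
    and sp_zero: "sp \<zero> = {}"
    and sp_add: "r \<in> carrier R \<Longrightarrow> s \<in> carrier R \<Longrightarrow> sp (r \<oplus> s) \<subseteq> sp r \<union> sp s"
    and sp_scale: "c \<in> carrier K \<Longrightarrow> r \<in> carrier R \<Longrightarrow> sp (kap c \<otimes> r) \<subseteq> sp r"
    and sp_unbounded: "q \<in> carrier R \<Longrightarrow> q \<noteq> \<zero> \<Longrightarrow> finite Z \<Longrightarrow> \<exists>r\<in>carrier R. \<not> sp (q \<otimes> r) \<subseteq> Z"
    and countable_R: "countable (carrier R)"
begin

lemma phi_simps [simp]:
  "c \<in> carrier k \<Longrightarrow> phi c \<in> carrier K"
  "c \<in> carrier k \<Longrightarrow> d \<in> carrier k \<Longrightarrow> phi (c \<oplus>\<^bsub>k\<^esub> d) = phi c \<oplus>\<^bsub>K\<^esub> phi d"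
  "c \<in> carrier k \<Longrightarrow> d \<in> carrier k \<Longrightarrow> phi (c \<otimes>\<^bsub>k\<^esub> d) = phi c \<otimes>\<^bsub>K\<^esub> phi d"
  "phi \<one>\<^bsub>k\<^esub> = \<one>\<^bsub>K\<^esub>" "phi \<zero>\<^bsub>k\<^esub> = \<zero>\<^bsub>K\<^esub>"
  using phi_hom ring_hom_zero[OF phi_hom k.ring_axioms K.ring_axioms]
  by (auto simp: ring_hom_closed ring_hom_add ring_hom_mult ring_hom_one)

lemma kap_simps [simp]:
  "c \<in> carrier K \<Longrightarrow> kap c \<in> carrier R"
  "c \<in> carrier K \<Longrightarrow> d \<in> carrier K \<Longrightarrow> kap (c \<oplus>\<^bsub>K\<^esub> d) = kap c \<oplus> kap d"
  "c \<in> carrier K \<Longrightarrow> d \<in> carrier K \<Longrightarrow> kap (c \<otimes>\<^bsub>K\<^esub> d) = kap c \<otimes> kap d"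
  "kap \<one>\<^bsub>K\<^esub> = \<one>" "kap \<zero>\<^bsub>K\<^esub> = \<zero>"
  using kap_hom ring_hom_zero[OF kap_hom K.ring_axioms ring_axioms]
  by (auto simp: ring_hom_closed ring_hom_add ring_hom_mult ring_hom_one)

lemma one_nonzero: "\<one> \<noteq> \<zero>"
proof
  assume "\<one> = \<zero>"
  then have "y = \<zero>"
    using l_one[OF y_closed] by simp
  with y_nonzero show False
    by simp
qed

lemma kap_eq_zero_iff: "c \<in> carrier K \<Longrightarrow> kap c = \<zero> \<longleftrightarrow> c = \<zero>\<^bsub>K\<^esub>"
proof
  assume c: "c \<in> carrier K" and z: "kap c = \<zero>"
  show "c = \<zero>\<^bsub>K\<^esub>"
  proof (rule ccontr)
    assume "c \<noteq> \<zero>\<^bsub>K\<^esub>"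
    then have "c \<in> Units K"
      using c by (simp add: K.field_Units)
    then have "kap c \<otimes> kap (inv\<^bsub>K\<^esub> c) = kap \<one>\<^bsub>K\<^esub>"
      using c by (metis K.Units_inv_closed K.Units_r_inv kap_simps(3))
    then show False
      using one_nonzero z \<open>c \<in> Units K\<close> by simp
  qed
qed simp

lemma phi_eq_zero_iff: "c \<in> carrier k \<Longrightarrow> phi c = \<zero>\<^bsub>K\<^esub> \<longleftrightarrow> c = \<zero>\<^bsub>k\<^esub>"
proof
  assume c: "c \<in> carrier k" and z: "phi c = \<zero>\<^bsub>K\<^esub>"
  show "c = \<zero>\<^bsub>k\<^esub>"
  proof (rule ccontr)
    assume "c \<noteq> \<zero>\<^bsub>k\<^esub>"
    then have "c \<in> Units k"
      using c by (simp add: k.field_Units)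
    then have "phi c \<otimes>\<^bsub>K\<^esub> phi (inv\<^bsub>k\<^esub> c) = phi \<one>\<^bsub>k\<^esub>"
      using c by (metis k.Units_inv_closed k.Units_r_inv phi_simps(3))
    then show False
      using z \<open>c \<in> Units k\<close> by simp
  qed
qed simp

text \<open>A nonzero scalar in y R could be divided out, giving \<open>y\<close> a right
  inverse.\<close>

lemma y_mult_scalar:
  assumes "r \<in> carrier R" "c \<in> carrier K" "y \<otimes> r = kap c"
  shows "c = \<zero>\<^bsub>K\<^esub>"
proof (rule ccontr)
  assume "c \<noteq> \<zero>\<^bsub>K\<^esub>"
  then have c: "c \<in> Units K"
    using assms by (simp add: K.field_Units)
  then have "kap c \<otimes> kap (inv\<^bsub>K\<^esub> c) = \<one>"
    using kap_simps(3)[of c "inv\<^bsub>K\<^esub> c"] assms by simp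
  then have "y \<otimes> (r \<otimes> kap (inv\<^bsub>K\<^esub> c)) = \<one>"
    using c assms by (simp add: m_assoc[symmetric])
  then show False
    using c y_no_inverse[of "r \<otimes> kap (inv\<^bsub>K\<^esub> c)"] assms by simp
qed

section \<open>The subalgebra and the uniqueness of its coefficients\<close>

definition ysq :: 'r
  where "ysq = y \<otimes> y"

lemma ysq_closed [simp]: "ysq \<in> carrier R"
  by (simp add: ysq_def)

lemma ysq_nonzero: "ysq \<noteq> \<zero>"
  using integral[of y y] y_nonzero by (auto simp: ysq_def)

abbreviation kt :: "'k \<Rightarrow> 'k \<Rightarrow> 'b"
  where "kt \<beta> \<gamma> \<equiv> phi \<beta> \<oplus>\<^bsub>K\<^esub> phi \<gamma> \<otimes>\<^bsub>K\<^esub> t"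

definition ktspan :: "'b set"
  where "ktspan = {kt \<beta> \<gamma> |\<beta> \<gamma>. \<beta> \<in> carrier k \<and> \<gamma> \<in> carrier k}"

definition elem :: "'k \<Rightarrow> 'b \<Rightarrow> 'r \<Rightarrow> 'r"
  where "elem \<alpha> p r = kap (phi \<alpha>) \<oplus> kap p \<otimes> y \<oplus> ysq \<otimes> r"

text \<open>
  The algebra \<open>k + ky + kty + y\<^sup>2R\<close>. Already \<open>k + yR\<close> would be a counterexample, but here \<open>y\<close> and \<open>ty\<close>
  stay linearly independent over \<open>k\<close> modulo the ideal \<open>y\<^sup>2R\<close>, so the coefficient of \<open>y\<close> is an explicit
  \<open>k\<close>-linear functional that is not \<open>K\<close>-linear.
\<close>

definition Asub :: "'r set"
  where "Asub = {elem \<alpha> p r |\<alpha> p r. \<alpha> \<in> carrier k \<and> p \<in> ktspan \<and> r \<in> carrier R}"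

lemma ktspan_closed [simp]: "p \<in> ktspan \<Longrightarrow> p \<in> carrier K"
  by (auto simp: ktspan_def)

lemma ktspan_zero [simp]: "\<zero>\<^bsub>K\<^esub> \<in> ktspan"
  unfolding ktspan_def by (rule CollectI, intro exI[of _ "\<zero>\<^bsub>k\<^esub>"]) simp

lemma ktspan_one [simp]: "\<one>\<^bsub>K\<^esub> \<in> ktspan"
  unfolding ktspan_def by (rule CollectI, intro exI[of _ "\<one>\<^bsub>k\<^esub>"] exI[of _ "\<zero>\<^bsub>k\<^esub>"]) simp

lemma ktspan_t [simp]: "t \<in> ktspan"
  unfolding ktspan_def by (rule CollectI, intro exI[of _ "\<zero>\<^bsub>k\<^esub>"] exI[of _ "\<one>\<^bsub>k\<^esub>"]) simp

lemma ktspan_add [simp]: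
  assumes "p \<in> ktspan" "q \<in> ktspan"
  shows "p \<oplus>\<^bsub>K\<^esub> q \<in> ktspan"
proof -
  obtain \<beta> \<gamma> \<beta>' \<gamma>' where *: "\<beta> \<in> carrier k" "\<gamma> \<in> carrier k" "\<beta>' \<in> carrier k" "\<gamma>' \<in> carrier k"
    "p = kt \<beta> \<gamma>" "q = kt \<beta>' \<gamma>'"
    using assms by (auto simp: ktspan_def)
  then have "p \<oplus>\<^bsub>K\<^esub> q = phi (\<beta> \<oplus>\<^bsub>k\<^esub> \<beta>') \<oplus>\<^bsub>K\<^esub> phi (\<gamma> \<oplus>\<^bsub>k\<^esub> \<gamma>') \<otimes>\<^bsub>K\<^esub> t"
    by (simp add: K.l_distr K.a_ac)
  with * show ?thesis
    unfolding ktspan_def by blast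
qed

lemma ktspan_scale [simp]:
  assumes "\<alpha> \<in> carrier k" "p \<in> ktspan"
  shows "phi \<alpha> \<otimes>\<^bsub>K\<^esub> p \<in> ktspan"
proof -
  obtain \<beta> \<gamma> where *: "\<beta> \<in> carrier k" "\<gamma> \<in> carrier k" "p = kt \<beta> \<gamma>"
    using assms by (auto simp: ktspan_def)
  then have "phi \<alpha> \<otimes>\<^bsub>K\<^esub> p = phi (\<alpha> \<otimes>\<^bsub>k\<^esub> \<beta>) \<oplus>\<^bsub>K\<^esub> phi (\<alpha> \<otimes>\<^bsub>k\<^esub> \<gamma>) \<otimes>\<^bsub>K\<^esub> t"
    using assms by (simp add: K.r_distr K.m_assoc)
  with * assms show ?thesis
    unfolding ktspan_def by blast
qed

text \<open>Independence of 1 and \<open>t\<close> over \<open>k\<close>: a relation with \<gamma>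
  nonzero could be solved for \<open>t\<close>, placing it in the image of
  \<open>phi\<close>.\<close>

lemma ktspan_unique:
  assumes "\<beta> \<in> carrier k" "\<gamma> \<in> carrier k" "kt \<beta> \<gamma> = \<zero>\<^bsub>K\<^esub>"
  shows "\<beta> = \<zero>\<^bsub>k\<^esub> \<and> \<gamma> = \<zero>\<^bsub>k\<^esub>"
proof -
  have "\<gamma> = \<zero>\<^bsub>k\<^esub>"
  proof (rule ccontr)
    assume "\<gamma> \<noteq> \<zero>\<^bsub>k\<^esub>"
    then have g: "\<gamma> \<in> Units k"
      using assms by (simp add: k.field_Units)
    define \<delta> where "\<delta> = inv\<^bsub>k\<^esub> \<gamma>"
    have d: "\<delta> \<in> carrier k" "\<delta> \<otimes>\<^bsub>k\<^esub> \<gamma> = \<one>\<^bsub>k\<^esub>"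
      using g by (simp_all add: \<delta>_def)
    then have "phi \<delta> \<otimes>\<^bsub>K\<^esub> phi \<gamma> = \<one>\<^bsub>K\<^esub>"
      using assms(2) phi_simps(3)[of \<delta> \<gamma>] by simp
    then have "phi \<delta> \<otimes>\<^bsub>K\<^esub> (phi \<gamma> \<otimes>\<^bsub>K\<^esub> t) = t"
      using assms(2) d by (simp add: K.m_assoc[symmetric])
    moreover have "phi \<delta> \<otimes>\<^bsub>K\<^esub> (kt \<beta> \<gamma>) = \<zero>\<^bsub>K\<^esub>"
      using assms d by simp
    ultimately have "phi (\<delta> \<otimes>\<^bsub>k\<^esub> \<beta>) \<oplus>\<^bsub>K\<^esub> t = \<zero>\<^bsub>K\<^esub>"
      using assms(1,2) d by (simp add: K.r_distr)
    define \<epsilon> where "\<epsilon> = \<delta> \<otimes>\<^bsub>k\<^esub> \<beta>"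
    have e: "\<epsilon> \<in> carrier k"
      using assms d by (simp add: \<epsilon>_def)
    have "\<ominus>\<^bsub>K\<^esub> phi \<epsilon> = t"
      using e \<open>phi (\<delta> \<otimes>\<^bsub>k\<^esub> \<beta>) \<oplus>\<^bsub>K\<^esub> t = \<zero>\<^bsub>K\<^esub>\<close>
      by (intro K.minus_equality) (simp_all add: K.a_comm flip: \<epsilon>_def)
    moreover have "\<ominus>\<^bsub>K\<^esub> phi \<epsilon> = phi (\<ominus>\<^bsub>k\<^esub> \<epsilon>)"
      using e phi_simps(2)[of "\<ominus>\<^bsub>k\<^esub> \<epsilon>" \<epsilon>] by (intro K.minus_equality) (simp_all add: k.l_neg)
    ultimately have "t \<in> phi ` carrier k"
      using e by (metis imageI k.a_inv_closed)
    then show False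
      using t_new by blast
  qed
  with assms show ?thesis
    by (simp add: phi_eq_zero_iff)
qed

lemma elem_closed [simp]: "\<alpha> \<in> carrier k \<Longrightarrow> p \<in> ktspan \<Longrightarrow> r \<in> carrier R \<Longrightarrow> elem \<alpha> p r \<in> carrier R"
  by (simp add: elem_def)

lemma elem_A0 [simp]: "\<alpha> \<in> carrier k \<Longrightarrow> p \<in> ktspan \<Longrightarrow> r \<in> carrier R \<Longrightarrow> elem \<alpha> p r \<in> Asub"
  by (auto simp: Asub_def)

lemma AsubE:
  assumes "a \<in> Asub"
  obtains \<alpha> p r where "a = elem \<alpha> p r" "\<alpha> \<in> carrier k" "p \<in> ktspan" "r \<in> carrier R"
  using assms by (auto simp: Asub_def)

lemma Asub_closed [simp]: "a \<in> Asub \<Longrightarrow> a \<in> carrier R"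
  by (auto simp: Asub_def)

lemma elem_add:
  assumes "\<alpha> \<in> carrier k" "p \<in> ktspan" "r \<in> carrier R" "\<alpha>' \<in> carrier k" "p' \<in> ktspan" "r' \<in> carrier R"
  shows "elem \<alpha> p r \<oplus> elem \<alpha>' p' r' = elem (\<alpha> \<oplus>\<^bsub>k\<^esub> \<alpha>') (p \<oplus>\<^bsub>K\<^esub> p') (r \<oplus> r')"
  using assms by (simp add: elem_def l_distr r_distr a_ac)

lemma elem_scale:
  assumes "\<alpha> \<in> carrier k" "p \<in> ktspan" "r \<in> carrier R" "c \<in> carrier k"
  shows "kap (phi c) \<otimes> elem \<alpha> p r = elem (c \<otimes>\<^bsub>k\<^esub> \<alpha>) (phi c \<otimes>\<^bsub>K\<^esub> p) (kap (phi c) \<otimes> r)"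
proof -
  have "kap (phi c) \<otimes> (ysq \<otimes> r) = ysq \<otimes> (kap (phi c) \<otimes> r)"
    using assms kap_central[of "phi c" ysq] by (simp add: m_assoc[symmetric])
  then show ?thesis
    using assms by (simp add: elem_def r_distr m_assoc)
qed

text \<open>In the nested form \<alpha> + y (p + y r) = 0, the scalar \<alpha> lies in y R and so
  vanishes; cancelling y, the same argument applies to p.\<close>

lemma elem_unique:
  assumes "\<alpha> \<in> carrier k" "p \<in> ktspan" "r \<in> carrier R" "elem \<alpha> p r = \<zero>"
  shows "\<alpha> = \<zero>\<^bsub>k\<^esub> \<and> p = \<zero>\<^bsub>K\<^esub>"
proof -
  have e: "kap (phi \<alpha>) \<oplus> y \<otimes> (kap p \<oplus> y \<otimes> r) = \<zero>"
    using assms kap_central[of p y] by (simp add: elem_def ysq_def r_distr m_assoc a_assoc)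
  then have "y \<otimes> (kap p \<oplus> y \<otimes> r) = \<ominus> kap (phi \<alpha>)"
    using assms by (intro minus_equality[symmetric]) (simp_all add: a_comm)
  then have "y \<otimes> \<ominus> (kap p \<oplus> y \<otimes> r) = kap (phi \<alpha>)"
    using assms by (simp add: r_minus)
  then have "phi \<alpha> = \<zero>\<^bsub>K\<^esub>"
    using assms by (intro y_mult_scalar[of "\<ominus> (kap p \<oplus> y \<otimes> r)"]) simp_all
  then have a: "\<alpha> = \<zero>\<^bsub>k\<^esub>"
    using assms by (simp add: phi_eq_zero_iff)
  then have "y \<otimes> (kap p \<oplus> y \<otimes> r) = \<zero>"
    using e assms by simp
  then have "kap p \<oplus> y \<otimes> r = \<zero>"
    using integral[of y "kap p \<oplus> y \<otimes> r"] y_nonzero assms by simp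
  then have "y \<otimes> r = \<ominus> kap p"
    using assms by (intro minus_equality[symmetric]) (simp_all add: a_comm)
  then have "y \<otimes> \<ominus> r = kap p"
    using assms by (simp add: r_minus)
  then have "p = \<zero>\<^bsub>K\<^esub>"
    using assms by (intro y_mult_scalar[of "\<ominus> r"]) simp_all
  with a show ?thesis
    by simp
qed

lemma Asub_zero [simp]: "\<zero> \<in> Asub"
  using elem_A0[of "\<zero>\<^bsub>k\<^esub>" "\<zero>\<^bsub>K\<^esub>" "\<zero>"] by (simp add: elem_def)

lemma Asub_one [simp]: "\<one> \<in> Asub"
  using elem_A0[of "\<one>\<^bsub>k\<^esub>" "\<zero>\<^bsub>K\<^esub>" "\<zero>"] by (simp add: elem_def)

lemma Asub_y [simp]: "y \<in> Asub" and Asub_ty [simp]: "kap t \<otimes> y \<in> Asub"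
  using elem_A0[of "\<zero>\<^bsub>k\<^esub>" "\<one>\<^bsub>K\<^esub>" "\<zero>"] elem_A0[of "\<zero>\<^bsub>k\<^esub>" t "\<zero>"] by (simp_all add: elem_def)

lemma Asub_xx [simp]: "r \<in> carrier R \<Longrightarrow> ysq \<otimes> r \<in> Asub"
  using elem_A0[of "\<zero>\<^bsub>k\<^esub>" "\<zero>\<^bsub>K\<^esub>" r] by (simp add: elem_def)

lemma Asub_add [simp]: "a \<in> Asub \<Longrightarrow> b \<in> Asub \<Longrightarrow> a \<oplus> b \<in> Asub"
  by (elim AsubE) (simp add: elem_add)

lemma Asub_scale [simp]: "a \<in> Asub \<Longrightarrow> c \<in> carrier k \<Longrightarrow> kap (phi c) \<otimes> a \<in> Asub"
  by (elim AsubE) (simp add: elem_scale)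

lemma Asub_neg [simp]:
  assumes "a \<in> Asub"
  shows "\<ominus> a \<in> Asub"
proof -
  have "kap (phi (\<ominus>\<^bsub>k\<^esub> \<one>\<^bsub>k\<^esub>)) \<oplus> \<one> = kap (phi (\<ominus>\<^bsub>k\<^esub> \<one>\<^bsub>k\<^esub> \<oplus>\<^bsub>k\<^esub> \<one>\<^bsub>k\<^esub>))"
    by (subst phi_simps, simp_all)
  then have "kap (phi (\<ominus>\<^bsub>k\<^esub> \<one>\<^bsub>k\<^esub>)) = \<ominus> \<one>"
    by (intro minus_equality[symmetric]) (simp_all add: k.l_neg)
  then have "kap (phi (\<ominus>\<^bsub>k\<^esub> \<one>\<^bsub>k\<^esub>)) \<otimes> a = \<ominus> a"
    using assms by (simp add: l_minus)
  with Asub_scale[OF assms, of "\<ominus>\<^bsub>k\<^esub> \<one>\<^bsub>k\<^esub>"] show ?thesis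
    by simp
qed

text \<open>As y^2 R is a right ideal of \<open>R\<close>, the only term of the left factor that
  needs work is p y. Its product with \<open>b\<close> again has a y-coefficient in
  \<open>ktspan\<close>, a k-multiple of p, and central scalars let y^2 be pulled to the front of
  the rest.\<close>

lemma Asub_mult [simp]:
  assumes "a \<in> Asub" "b \<in> Asub"
  shows "a \<otimes> b \<in> Asub"
proof -
  obtain \<alpha> p r where a: "a = elem \<alpha> p r" "\<alpha> \<in> carrier k" "p \<in> ktspan" "r \<in> carrier R"
    using assms(1) by (rule AsubE)
  obtain \<alpha>' p' r' where b: "b = elem \<alpha>' p' r'" "\<alpha>' \<in> carrier k" "p' \<in> ktspan" "r' \<in> carrier R"
    using assms(2) by (rule AsubE)
  have bR: "b \<in> carrier R"
    using assms by simp
  have py: "kap p \<otimes> y \<otimes> b = elem \<zero>\<^bsub>k\<^esub> (phi \<alpha>' \<otimes>\<^bsub>K\<^esub> p) (kap p \<otimes> kap p' \<oplus> kap p \<otimes> y \<otimes> r')"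
  proof -
    have 1: "kap p \<otimes> y \<otimes> kap (phi \<alpha>') = kap (phi \<alpha>') \<otimes> kap p \<otimes> y"
      using a b kap_central[of "phi \<alpha>'" "kap p \<otimes> y"] by (simp add: m_assoc)
    have 2: "kap p \<otimes> y \<otimes> (kap p' \<otimes> y) = ysq \<otimes> (kap p \<otimes> kap p')"
    proof -
      have "kap p \<otimes> y \<otimes> (kap p' \<otimes> y) = kap p \<otimes> (y \<otimes> kap p') \<otimes> y"
        using a b by (simp add: m_assoc)
      also have "y \<otimes> kap p' = kap p' \<otimes> y"
        using b by (simp add: kap_central)
      also have "kap p \<otimes> (kap p' \<otimes> y) \<otimes> y = kap (p \<otimes>\<^bsub>K\<^esub> p') \<otimes> ysq"
        using a b by (simp add: m_assoc ysq_def)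
      also have "\<dots> = ysq \<otimes> kap (p \<otimes>\<^bsub>K\<^esub> p')"
        using a b by (intro kap_central) simp_all
      finally show ?thesis
        using a b by simp
    qed
    have 3: "kap p \<otimes> y \<otimes> (ysq \<otimes> r') = ysq \<otimes> (kap p \<otimes> y \<otimes> r')"
    proof -
      have "kap p \<otimes> y \<otimes> (ysq \<otimes> r') = (kap p \<otimes> ysq) \<otimes> (y \<otimes> r')"
        using a b by (simp add: m_assoc ysq_def)
      also have "kap p \<otimes> ysq = ysq \<otimes> kap p"
        using a by (intro kap_central) simp_all
      finally show ?thesis
        using a b by (simp add: m_assoc)
    qed
    show ?thesis
      using a b unfolding b(1) elem_def
      by (simp add: r_distr 1 2 3) (simp add: a_ac)
  qed
  have "a \<otimes> b = kap (phi \<alpha>) \<otimes> b \<oplus> kap p \<otimes> y \<otimes> b \<oplus> ysq \<otimes> (r \<otimes> b)"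
    using a bR by (simp add: elem_def l_distr m_assoc)
  moreover have "kap p \<otimes> y \<otimes> b \<in> Asub"
    unfolding py using a b by simp
  ultimately show ?thesis
    using assms a by simp
qed

text \<open>\<open>J\<close> is no ideal of \<open>R\<close>, but the set \<open>T\<close> of all r
  with y^2 R r R inside \<open>J\<close> is. It contains j y^2, because y^2 R lies in
  \<open>Asub\<close> and may act on \<open>j\<close> from both sides; simplicity then puts 1 into
  \<open>T\<close>.\<close>

lemma Asub_ideal:
  assumes J: "J \<subseteq> Asub" "\<zero> \<in> J" "j \<in> J" "j \<noteq> \<zero>"
    and add: "\<And>a b. a \<in> J \<Longrightarrow> b \<in> J \<Longrightarrow> a \<oplus> b \<in> J"
    and neg: "\<And>a. a \<in> J \<Longrightarrow> \<ominus> a \<in> J"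
    and left: "\<And>a b. a \<in> Asub \<Longrightarrow> b \<in> J \<Longrightarrow> a \<otimes> b \<in> J"
    and right: "\<And>a b. a \<in> Asub \<Longrightarrow> b \<in> J \<Longrightarrow> b \<otimes> a \<in> J"
    and q: "q \<in> carrier R"
  shows "ysq \<otimes> q \<in> J"
proof -
  define T where "T = {r \<in> carrier R. \<forall>p\<in>carrier R. \<forall>q\<in>carrier R. ysq \<otimes> p \<otimes> r \<otimes> q \<in> J}"
  have jR: "j \<in> carrier R"
    using J by auto
  have "ideal T R"
  proof (rule idealI)
    show "subgroup T (add_monoid R)"
    proof (rule add.subgroupI)
      show "T \<noteq> {}"
        using J by (auto simp: T_def intro!: exI[of _ \<zero>])
      show "\<ominus> a \<in> T" if "a \<in> T" for a
        using that neg by (auto simp: T_def l_minus r_minus)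
      show "a \<oplus> b \<in> T" if "a \<in> T" "b \<in> T" for a b
        using that add by (auto simp: T_def l_distr r_distr)
    qed (auto simp: T_def)
    fix a x assume a: "a \<in> T" and x: "x \<in> carrier R"
    have aR: "a \<in> carrier R" and aJ: "\<And>p q. p \<in> carrier R \<Longrightarrow> q \<in> carrier R \<Longrightarrow> ysq \<otimes> p \<otimes> a \<otimes> q \<in> J"
      using a by (auto simp: T_def)
    show "x \<otimes> a \<in> T"
      unfolding T_def
    proof (intro CollectI conjI ballI)
      fix p q assume pq: "p \<in> carrier R" "q \<in> carrier R"
      show "ysq \<otimes> p \<otimes> (x \<otimes> a) \<otimes> q \<in> J"
        using aJ[of "p \<otimes> x" q] pq x aR by (simp add: m_assoc)
    qed (use x aR in simp)
    show "a \<otimes> x \<in> T"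
      unfolding T_def
    proof (intro CollectI conjI ballI)
      fix p q assume pq: "p \<in> carrier R" "q \<in> carrier R"
      show "ysq \<otimes> p \<otimes> (a \<otimes> x) \<otimes> q \<in> J"
        using aJ[of p "x \<otimes> q"] pq x aR by (simp add: m_assoc)
    qed (use x aR in simp)
  qed (rule ring_axioms)
  moreover have "j \<otimes> ysq \<in> T"
    unfolding T_def
  proof (intro CollectI conjI ballI)
    fix p q assume pq: "p \<in> carrier R" "q \<in> carrier R"
    have "ysq \<otimes> p \<otimes> j \<otimes> (ysq \<otimes> q) \<in> J"
      using pq J by (intro left right) simp_all
    then show "ysq \<otimes> p \<otimes> (j \<otimes> ysq) \<otimes> q \<in> J"
      using pq jR by (simp add: m_assoc)
  qed (use jR in simp)
  moreover have "j \<otimes> ysq \<noteq> \<zero>"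
    using integral[of j ysq] jR J ysq_nonzero by auto
  ultimately have "T = carrier R"
    using simple by blast
  then have "\<one> \<in> T"
    by simp
  then have "ysq \<otimes> \<one> \<otimes> \<one> \<otimes> q \<in> J"
    using q unfolding T_def by blast
  then show ?thesis
    using q by simp
qed

text \<open>The Ore condition of \<open>R\<close> is applied to a y^2 and b y^2, so that the
  multipliers y^2 r and y^2 s fall into the subalgebra.\<close>

lemma Asub_ore:
  assumes "a \<in> Asub" "b \<in> Asub" "a \<noteq> \<zero>" "b \<noteq> \<zero>"
  shows "\<exists>r\<in>Asub. \<exists>s\<in>Asub. a \<otimes> r = b \<otimes> s \<and> a \<otimes> r \<noteq> \<zero>"
proof -
  have n: "a \<otimes> ysq \<noteq> \<zero>" "b \<otimes> ysq \<noteq> \<zero>"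
    using assms integral[of a ysq] integral[of b ysq] ysq_nonzero by auto
  then obtain r s where rs: "r \<in> carrier R" "s \<in> carrier R" "r \<noteq> \<zero>" "a \<otimes> ysq \<otimes> r = b \<otimes> ysq \<otimes> s"
    using ore[of "a \<otimes> ysq" "b \<otimes> ysq"] assms by auto
  then have "a \<otimes> ysq \<otimes> r \<noteq> \<zero>"
    using integral[of "a \<otimes> ysq" r] n assms by auto
  with rs show ?thesis
    using assms by (intro bexI[of _ "ysq \<otimes> r"] bexI[of _ "ysq \<otimes> s"]) (simp_all add: m_assoc)
qed

section \<open>Finite generation of the subalgebra\<close>

definition subalg :: "'r set \<Rightarrow> bool"
  where "subalg B \<longleftrightarrow> \<zero> \<in> B \<and> (\<forall>a\<in>B. \<forall>b\<in>B. a \<oplus> b \<in> B \<and> a \<otimes> b \<in> B)"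

text \<open>
  A disguised form of \<open>1 = \<Sum>(p, q)\<in>P. p \<cdot> y\<^sup>2 \<cdot> q\<close>, phrased so that the set of all \<open>z\<close> in place of \<open>1\<close>
  is visibly an ideal. It rewrites \<open>y\<^sup>2 b w\<close> as \<open>\<Sum> (y\<^sup>2 b p) (y\<^sup>2 q w)\<close>, which lets one
  peel generators off a word.
\<close>

lemma expansion_of_one:
  obtains P where "finite P" "P \<subseteq> carrier R \<times> carrier R"
    "\<And>B b w. subalg B \<Longrightarrow> b \<in> carrier R \<Longrightarrow> w \<in> carrier R \<Longrightarrow>
       \<forall>(p, q)\<in>P. ysq \<otimes> b \<otimes> p \<in> B \<and> ysq \<otimes> q \<otimes> w \<in> B \<Longrightarrow> ysq \<otimes> b \<otimes> w \<in> B"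
proof -
  define Q where "Q z P \<longleftrightarrow> (\<forall>B. subalg B \<longrightarrow> (\<forall>b\<in>carrier R. \<forall>w\<in>carrier R.
      (\<forall>(p, q)\<in>P. ysq \<otimes> b \<otimes> p \<in> B \<and> ysq \<otimes> q \<otimes> w \<in> B) \<longrightarrow> ysq \<otimes> b \<otimes> z \<otimes> w \<in> B))" for z P
  have QD: "ysq \<otimes> b \<otimes> z \<otimes> w \<in> B"
    if "Q z P" "subalg B" "b \<in> carrier R" "w \<in> carrier R"
      "\<forall>(p, q)\<in>P. ysq \<otimes> b \<otimes> p \<in> B \<and> ysq \<otimes> q \<otimes> w \<in> B" for z P B b w
    using that unfolding Q_def by simp
  define T where "T = {z \<in> carrier R. \<exists>P. finite P \<and> P \<subseteq> carrier R \<times> carrier R \<and> Q z P}"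
  have left: "x \<otimes> z \<in> T" if z: "z \<in> T" and x: "x \<in> carrier R" for x z
  proof -
    obtain P where P: "finite P" "P \<subseteq> carrier R \<times> carrier R" "Q z P" and zR: "z \<in> carrier R"
      using z by (auto simp: T_def)
    \<comment> \<open>The factor x moves into the first components, and since \<open>Q\<close>
      quantifies over all b, it can be absorbed by using b x in place of b.\<close>
    have "Q (x \<otimes> z) ((\<lambda>(p, q). (x \<otimes> p, q)) ` P)"
      unfolding Q_def
    proof (intro allI impI ballI)
      fix B b w assume B: "subalg B" "b \<in> carrier R" "w \<in> carrier R"
        and h: "\<forall>(p, q)\<in>(\<lambda>(p, q). (x \<otimes> p, q)) ` P. ysq \<otimes> b \<otimes> p \<in> B \<and> ysq \<otimes> q \<otimes> w \<in> B"
      have "ysq \<otimes> (b \<otimes> x) \<otimes> p \<in> B \<and> ysq \<otimes> q \<otimes> w \<in> B" if "(p, q) \<in> P" for p q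
        using bspec[OF h image_eqI[OF refl that]] P(2) that B x by (auto simp: m_assoc)
      then have "\<forall>(p, q)\<in>P. ysq \<otimes> (b \<otimes> x) \<otimes> p \<in> B \<and> ysq \<otimes> q \<otimes> w \<in> B"
        by blast
      then have "ysq \<otimes> (b \<otimes> x) \<otimes> z \<otimes> w \<in> B"
        using B x by (intro QD[OF P(3)]) simp_all
      then show "ysq \<otimes> b \<otimes> (x \<otimes> z) \<otimes> w \<in> B"
        using B x zR by (simp add: m_assoc)
    qed
    moreover have "finite ((\<lambda>(p, q). (x \<otimes> p, q)) ` P)" "(\<lambda>(p, q). (x \<otimes> p, q)) ` P \<subseteq> carrier R \<times> carrier R"
      using P x by auto
    ultimately show ?thesis
      using zR x unfolding T_def by blast
  qed
  have right: "z \<otimes> x \<in> T" if z: "z \<in> T" and x: "x \<in> carrier R" for x z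
  proof -
    obtain P where P: "finite P" "P \<subseteq> carrier R \<times> carrier R" "Q z P" and zR: "z \<in> carrier R"
      using z by (auto simp: T_def)
    have "Q (z \<otimes> x) ((\<lambda>(p, q). (p, q \<otimes> x)) ` P)"
      unfolding Q_def
    proof (intro allI impI ballI)
      fix B b w assume B: "subalg B" "b \<in> carrier R" "w \<in> carrier R"
        and h: "\<forall>(p, q)\<in>(\<lambda>(p, q). (p, q \<otimes> x)) ` P. ysq \<otimes> b \<otimes> p \<in> B \<and> ysq \<otimes> q \<otimes> w \<in> B"
      have "ysq \<otimes> b \<otimes> p \<in> B \<and> ysq \<otimes> q \<otimes> (x \<otimes> w) \<in> B" if "(p, q) \<in> P" for p q
        using bspec[OF h image_eqI[OF refl that]] P(2) that B x by (auto simp: m_assoc)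
      then have "\<forall>(p, q)\<in>P. ysq \<otimes> b \<otimes> p \<in> B \<and> ysq \<otimes> q \<otimes> (x \<otimes> w) \<in> B"
        by blast
      then have "ysq \<otimes> b \<otimes> z \<otimes> (x \<otimes> w) \<in> B"
        using B x by (intro QD[OF P(3)]) simp_all
      then show "ysq \<otimes> b \<otimes> (z \<otimes> x) \<otimes> w \<in> B"
        using B x zR by (simp add: m_assoc)
    qed
    moreover have "finite ((\<lambda>(p, q). (p, q \<otimes> x)) ` P)" "(\<lambda>(p, q). (p, q \<otimes> x)) ` P \<subseteq> carrier R \<times> carrier R"
      using P x by auto
    ultimately show ?thesis
      using zR x unfolding T_def by blast
  qed
  have "ideal T R"
  proof (rule idealI)
    show "subgroup T (add_monoid R)"
    proof (rule add.subgroupI)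
      have "Q \<zero> {}"
        by (auto simp: Q_def subalg_def)
      then show "T \<noteq> {}"
        unfolding T_def by blast
      show "\<ominus> a \<in> T" if "a \<in> T" for a
      proof -
        have "a \<in> carrier R"
          using that by (simp add: T_def)
        then have "\<ominus> a = \<ominus> \<one> \<otimes> a"
          by (simp add: l_minus)
        then show ?thesis
          using left[OF that, of "\<ominus> \<one>"] by simp
      qed
      show "a \<oplus> b \<in> T" if ab: "a \<in> T" "b \<in> T" for a b
      proof -
        obtain P where P: "finite P" "P \<subseteq> carrier R \<times> carrier R" "Q a P" and aR: "a \<in> carrier R"
          using ab by (auto simp: T_def)
        obtain P' where P': "finite P'" "P' \<subseteq> carrier R \<times> carrier R" "Q b P'" and bR: "b \<in> carrier R"
          using ab by (auto simp: T_def)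
        have "Q (a \<oplus> b) (P \<union> P')"
          unfolding Q_def
        proof (intro allI impI ballI)
          fix B c w assume B: "subalg B" "c \<in> carrier R" "w \<in> carrier R"
            and h: "\<forall>(p, q)\<in>P \<union> P'. ysq \<otimes> c \<otimes> p \<in> B \<and> ysq \<otimes> q \<otimes> w \<in> B"
          have "ysq \<otimes> c \<otimes> a \<otimes> w \<in> B" "ysq \<otimes> c \<otimes> b \<otimes> w \<in> B"
            by (rule QD[OF P(3) B], use h in blast) (rule QD[OF P'(3) B], use h in blast)
          then show "ysq \<otimes> c \<otimes> (a \<oplus> b) \<otimes> w \<in> B"
            using B aR bR by (simp add: subalg_def l_distr r_distr)
        qed
        then show ?thesis
          using P P' aR bR unfolding T_def
          by (intro CollectI conjI exI[of _ "P \<union> P'"]) simp_all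
      qed
    qed (auto simp: T_def)
  qed (use left right ring_axioms in auto)
  moreover have "ysq \<in> T"
  proof -
    have "Q ysq {(\<one>, \<one>)}"
      unfolding Q_def
    proof (intro allI impI ballI)
      fix B b w assume B: "subalg B" "b \<in> carrier R" "w \<in> carrier R"
        and "\<forall>(p, q)\<in>{(\<one>, \<one>)}. ysq \<otimes> b \<otimes> p \<in> B \<and> ysq \<otimes> q \<otimes> w \<in> B"
      then have "ysq \<otimes> b \<in> B" "ysq \<otimes> w \<in> B"
        by simp_all
      then have "(ysq \<otimes> b) \<otimes> (ysq \<otimes> w) \<in> B"
        using B(1) by (simp add: subalg_def)
      then show "ysq \<otimes> b \<otimes> ysq \<otimes> w \<in> B"
        using B by (simp add: m_assoc)
    qed
    then show ?thesis
      unfolding T_def by (intro CollectI conjI exI[of _ "{(\<one>, \<one>)}"]) simp_all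
  qed
  ultimately have "T = carrier R"
    using simple ysq_nonzero by blast
  then have "\<one> \<in> T"
    by simp
  then obtain P where P: "finite P" "P \<subseteq> carrier R \<times> carrier R" "Q \<one> P"
    by (auto simp: T_def)
  show thesis
  proof (rule that[OF P(1,2)])
    fix B b w assume "subalg B" "b \<in> carrier R" "w \<in> carrier R"
      "\<forall>(p, q)\<in>P. ysq \<otimes> b \<otimes> p \<in> B \<and> ysq \<otimes> q \<otimes> w \<in> B"
    then have "ysq \<otimes> b \<otimes> \<one> \<otimes> w \<in> B"
      using QD[OF P(3)] by blast
    then show "ysq \<otimes> b \<otimes> w \<in> B"
      using \<open>b \<in> carrier R\<close> by simp
  qed
qed

text \<open>Induction on words in \<open>gens\<close>: y^2 a g w is a sum of products (y^2 a g
  p)(y^2 q w). The second factors are covered by the induction hypothesis, and the first range over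
  a finite set, which is put into \<open>G\<close>.\<close>

lemma Asub_generated:
  obtains G where "finite G" "G \<subseteq> Asub"
    "\<And>B. subalg B \<Longrightarrow> \<one> \<in> B \<Longrightarrow> (\<And>c a. c \<in> carrier k \<Longrightarrow> a \<in> B \<Longrightarrow> kap (phi c) \<otimes> a \<in> B) \<Longrightarrow> G \<subseteq> B \<Longrightarrow> Asub \<subseteq> B"
proof -
  obtain P where P: "finite P" "P \<subseteq> carrier R \<times> carrier R"
    "\<And>B b w. subalg B \<Longrightarrow> b \<in> carrier R \<Longrightarrow> w \<in> carrier R \<Longrightarrow>
       \<forall>(p, q)\<in>P. ysq \<otimes> b \<otimes> p \<in> B \<and> ysq \<otimes> q \<otimes> w \<in> B \<Longrightarrow> ysq \<otimes> b \<otimes> w \<in> B"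
    using expansion_of_one by blast
  \<comment> \<open>The second components of \<open>P\<close> make the induction hypothesis
    reusable; 1 is added so that the result specialises to y^2 R.\<close>
  define S where "S = insert \<one> (snd ` P)"
  define G where "G = (\<lambda>(a, g, p). ysq \<otimes> (a \<otimes> g) \<otimes> p) ` (S \<times> gens \<times> fst ` P)
      \<union> (\<lambda>a. ysq \<otimes> a) ` S \<union> {y, kap t \<otimes> y}"
  have S: "finite S" "S \<subseteq> carrier R" "fst ` P \<subseteq> carrier R"
    using P by (auto simp: S_def)
  show thesis
  proof (rule that)
    show "finite G"
      using S P gens_finite by (simp add: G_def)
    show "G \<subseteq> Asub"
    proof
      fix z assume z: "z \<in> G"
      have "ysq \<otimes> (a \<otimes> g) \<otimes> p \<in> Asub" if "a \<in> S" "g \<in> gens" "p \<in> fst ` P" for a g p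
      proof -
        have "a \<in> carrier R" "g \<in> carrier R" "p \<in> carrier R"
          using that S gens_closed by auto
        then show ?thesis
          by (simp add: m_assoc)
      qed
      then show "z \<in> Asub"
        using z S by (auto simp: G_def)
    qed
    fix B assume B: "subalg B" "\<one> \<in> B" "G \<subseteq> B"
      and scale: "\<And>c a. c \<in> carrier k \<Longrightarrow> a \<in> B \<Longrightarrow> kap (phi c) \<otimes> a \<in> B"
    define V where "V = {w \<in> carrier R. \<forall>a\<in>S. ysq \<otimes> a \<otimes> w \<in> B}"
    have "V = carrier R"
    proof (rule generated)
      show "\<one> \<in> V" "\<zero> \<in> V"
        using S B by (auto simp: V_def G_def subalg_def subset_iff)
      show "a \<oplus> b \<in> V" if "a \<in> V" "b \<in> V" for a b
        using that B S by (auto simp: V_def r_distr subalg_def subset_iff)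
      show "g \<otimes> w \<in> V" if g: "g \<in> gens" and w: "w \<in> V" for g w
      proof -
        have gR: "g \<in> carrier R" and wR: "w \<in> carrier R"
          using g w gens_closed by (auto simp: V_def)
        have "ysq \<otimes> a \<otimes> (g \<otimes> w) \<in> B" if a: "a \<in> S" for a
        proof -
          have aR: "a \<in> carrier R"
            using a S by auto
          have "ysq \<otimes> (a \<otimes> g) \<otimes> w \<in> B"
          proof (rule P(3)[OF B(1)])
            show "\<forall>(p, q)\<in>P. ysq \<otimes> (a \<otimes> g) \<otimes> p \<in> B \<and> ysq \<otimes> q \<otimes> w \<in> B"
            proof (rule ballI, clarify, rule conjI)
              fix p q assume pq: "(p, q) \<in> P"
              have "(a, g, p) \<in> S \<times> gens \<times> fst ` P"
                using pq a g by force
              then have "ysq \<otimes> (a \<otimes> g) \<otimes> p \<in> (\<lambda>(a, g, p). ysq \<otimes> (a \<otimes> g) \<otimes> p) ` (S \<times> gens \<times> fst ` P)"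
                by (rule rev_image_eqI) simp
              then have "ysq \<otimes> (a \<otimes> g) \<otimes> p \<in> G"
                unfolding G_def by (intro UnI1)
              then show "ysq \<otimes> (a \<otimes> g) \<otimes> p \<in> B"
                by (rule subsetD[OF B(3)])
              have "q \<in> S"
                using pq by (force simp: S_def)
              then show "ysq \<otimes> q \<otimes> w \<in> B"
                using w by (simp add: V_def)
            qed
          qed (use aR gR wR in simp_all)
          then show ?thesis
            using aR gR wR by (simp add: m_assoc)
        qed
        then show ?thesis
          using gR wR by (simp add: V_def)
      qed
    qed (auto simp: V_def)
    then have xB: "ysq \<otimes> r \<in> B" if "r \<in> carrier R" for r
    proof -
      have "ysq \<otimes> \<one> \<otimes> r \<in> B"
        using \<open>V = carrier R\<close> that unfolding V_def S_def by blast
      then show ?thesis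
        by simp
    qed
    show "Asub \<subseteq> B"
    proof
      fix a assume "a \<in> Asub"
      then obtain \<alpha> p r where a: "a = elem \<alpha> p r" "\<alpha> \<in> carrier k" "p \<in> ktspan" "r \<in> carrier R"
        by (rule AsubE)
      then obtain \<beta> \<gamma> where p: "\<beta> \<in> carrier k" "\<gamma> \<in> carrier k" "p = kt \<beta> \<gamma>"
        by (auto simp: ktspan_def)
      have "a = kap (phi \<alpha>) \<otimes> \<one> \<oplus> (kap (phi \<beta>) \<otimes> y \<oplus> kap (phi \<gamma>) \<otimes> (kap t \<otimes> y)) \<oplus> ysq \<otimes> r"
        using a p by (simp add: elem_def l_distr m_assoc)
      moreover have "y \<in> B" "kap t \<otimes> y \<in> B"
        using B(3) by (auto simp: G_def)
      then have "kap (phi \<alpha>) \<otimes> \<one> \<in> B" "kap (phi \<beta>) \<otimes> y \<in> B" "kap (phi \<gamma>) \<otimes> (kap t \<otimes> y) \<in> B"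
        using a p B(2) \<open>y \<in> B\<close> \<open>kap t \<otimes> y \<in> B\<close> by (simp_all only: scale)
      ultimately show "a \<in> B"
        using xB[OF a(4)] B(1) by (simp add: subalg_def)
    qed
  qed
qed

section \<open>The coefficient of y\<close>

lemma phi_neg [simp]: "c \<in> carrier k \<Longrightarrow> phi (\<ominus>\<^bsub>k\<^esub> c) = \<ominus>\<^bsub>K\<^esub> phi c"
  using phi_simps(2)[of "\<ominus>\<^bsub>k\<^esub> c" c] by (intro K.minus_equality[symmetric]) (simp_all add: k.l_neg)

lemma kap_neg [simp]: "c \<in> carrier K \<Longrightarrow> kap (\<ominus>\<^bsub>K\<^esub> c) = \<ominus> kap c"
  using kap_simps(2)[of "\<ominus>\<^bsub>K\<^esub> c" c] by (intro minus_equality[symmetric]) (simp_all add: K.l_neg)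

lemma ktspan_neg [simp]: "p \<in> ktspan \<Longrightarrow> \<ominus>\<^bsub>K\<^esub> p \<in> ktspan"
  using ktspan_scale[of "\<ominus>\<^bsub>k\<^esub> \<one>\<^bsub>k\<^esub>" p] by (simp add: K.l_minus)

lemma Asub_scalar [simp]: "c \<in> carrier k \<Longrightarrow> kap (phi c) \<in> Asub"
  using Asub_scale[OF Asub_one, of c] by simp

lemma elem_inj:
  assumes a: "\<alpha> \<in> carrier k" "p \<in> ktspan" "r \<in> carrier R" and b: "\<alpha>' \<in> carrier k" "p' \<in> ktspan" "r' \<in> carrier R"
    and eq: "elem \<alpha> p r = elem \<alpha>' p' r'"
  shows "\<alpha> = \<alpha>'" "p = p'"
proof -
  let ?n = "elem (\<ominus>\<^bsub>k\<^esub> \<alpha>') (\<ominus>\<^bsub>K\<^esub> p') (\<ominus> r')"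
  have "elem \<alpha> p r \<oplus> ?n = elem \<alpha>' p' r' \<oplus> ?n"
    by (simp only: eq)
  also have "\<dots> = \<zero>"
    using b by (simp add: elem_add k.r_neg K.r_neg r_neg) (simp add: elem_def)
  finally have "elem (\<alpha> \<ominus>\<^bsub>k\<^esub> \<alpha>') (p \<ominus>\<^bsub>K\<^esub> p') (r \<ominus> r') = \<zero>"
    using a b by (simp add: elem_add minus_eq k.minus_eq K.minus_eq)
  then have "\<alpha> \<ominus>\<^bsub>k\<^esub> \<alpha>' = \<zero>\<^bsub>k\<^esub> \<and> p \<ominus>\<^bsub>K\<^esub> p' = \<zero>\<^bsub>K\<^esub>"
    using a b by (intro elem_unique) (simp_all add: K.minus_eq)
  then show "\<alpha> = \<alpha>'" "p = p'"
    using a b by (simp_all add: k.r_right_minus_eq K.r_right_minus_eq)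
qed

lemma ktspan_inj:
  assumes "\<beta> \<in> carrier k" "\<gamma> \<in> carrier k" "\<beta>' \<in> carrier k" "\<gamma>' \<in> carrier k"
    and eq: "kt \<beta> \<gamma> = kt \<beta>' \<gamma>'"
  shows "\<beta> = \<beta>'"
proof -
  have "phi (\<beta> \<ominus>\<^bsub>k\<^esub> \<beta>') \<oplus>\<^bsub>K\<^esub> phi (\<gamma> \<ominus>\<^bsub>k\<^esub> \<gamma>') \<otimes>\<^bsub>K\<^esub> t
      = (kt \<beta> \<gamma>) \<ominus>\<^bsub>K\<^esub> (kt \<beta>' \<gamma>')"
    using assms(1-4) by (simp add: k.minus_eq K.minus_eq K.l_distr K.minus_add K.l_minus K.a_ac)
  also have "\<dots> = \<zero>\<^bsub>K\<^esub>"
    unfolding eq using assms(1-4) by (simp add: K.minus_eq K.r_neg)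
  finally have "\<beta> \<ominus>\<^bsub>k\<^esub> \<beta>' = \<zero>\<^bsub>k\<^esub> \<and> \<gamma> \<ominus>\<^bsub>k\<^esub> \<gamma>' = \<zero>\<^bsub>k\<^esub>"
    using assms(1-4) by (intro ktspan_unique) simp_all
  then show ?thesis
    using assms(1-4) by (simp add: k.r_right_minus_eq)
qed

text \<open>The value is taken in \<open>K\<close> rather than \<open>k\<close> so that its
  composite with \<open>kap\<close> is a k-linear map into \<open>R\<close> of the kind that
  \<open>Ext\<close> extends.\<close>

definition lam :: "'r \<Rightarrow> 'b"
  where "lam a = (THE b. \<exists>\<alpha> \<beta> \<gamma> r. \<alpha> \<in> carrier k \<and> \<beta> \<in> carrier k \<and> \<gamma> \<in> carrier k \<and> r \<in> carrier R \<and>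
           a = elem \<alpha> (kt \<beta> \<gamma>) r \<and> b = phi \<beta>)"

lemma ktspan_I [simp]: "\<beta> \<in> carrier k \<Longrightarrow> \<gamma> \<in> carrier k \<Longrightarrow> kt \<beta> \<gamma> \<in> ktspan"
  by (auto simp: ktspan_def)

lemma lam_el:
  assumes "\<alpha> \<in> carrier k" "\<beta> \<in> carrier k" "\<gamma> \<in> carrier k" "r \<in> carrier R"
  shows "lam (elem \<alpha> (kt \<beta> \<gamma>) r) = phi \<beta>"
  unfolding lam_def
proof (rule the_equality)
  show "\<exists>\<alpha>' \<beta>' \<gamma>' r'. \<alpha>' \<in> carrier k \<and> \<beta>' \<in> carrier k \<and> \<gamma>' \<in> carrier k \<and> r' \<in> carrier R \<and>
      elem \<alpha> (kt \<beta> \<gamma>) r = elem \<alpha>' (kt \<beta>' \<gamma>') r' \<and> phi \<beta> = phi \<beta>'"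
    using assms by blast
next
  fix b
  assume "\<exists>\<alpha>' \<beta>' \<gamma>' r'. \<alpha>' \<in> carrier k \<and> \<beta>' \<in> carrier k \<and> \<gamma>' \<in> carrier k \<and> r' \<in> carrier R \<and>
      elem \<alpha> (kt \<beta> \<gamma>) r = elem \<alpha>' (kt \<beta>' \<gamma>') r' \<and> b = phi \<beta>'"
  then obtain \<alpha>' \<beta>' \<gamma>' r' where *: "\<alpha>' \<in> carrier k" "\<beta>' \<in> carrier k" "\<gamma>' \<in> carrier k" "r' \<in> carrier R"
    "elem \<alpha> (kt \<beta> \<gamma>) r = elem \<alpha>' (kt \<beta>' \<gamma>') r'" "b = phi \<beta>'"
    by blast
  have "kt \<beta> \<gamma> = kt \<beta>' \<gamma>'"
    by (rule elem_inj(2)[OF assms(1) ktspan_I[OF assms(2,3)] assms(4) *(1) ktspan_I[OF *(2,3)] *(4,5)])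
  then have "\<beta> = \<beta>'"
    by (rule ktspan_inj[OF assms(2,3) *(2,3)])
  with * show "b = phi \<beta>"
    by simp
qed

lemma AsubE':
  assumes "a \<in> Asub"
  obtains \<alpha> \<beta> \<gamma> r where "\<alpha> \<in> carrier k" "\<beta> \<in> carrier k" "\<gamma> \<in> carrier k" "r \<in> carrier R"
    "a = elem \<alpha> (kt \<beta> \<gamma>) r"
proof -
  obtain \<alpha> p r where a: "a = elem \<alpha> p r" "\<alpha> \<in> carrier k" "p \<in> ktspan" "r \<in> carrier R"
    using assms by (rule AsubE)
  obtain \<beta> \<gamma> where "p = kt \<beta> \<gamma>" "\<beta> \<in> carrier k" "\<gamma> \<in> carrier k"
    using a(3) unfolding ktspan_def by blast
  with a that show thesis
    by blast
qed

lemma lam_closed [simp]: "a \<in> Asub \<Longrightarrow> lam a \<in> carrier K"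
  by (elim AsubE') (simp add: lam_el)

lemma lam_add:
  assumes "a \<in> Asub" "b \<in> Asub"
  shows "lam (a \<oplus> b) = lam a \<oplus>\<^bsub>K\<^esub> lam b"
proof -
  obtain \<alpha> \<beta> \<gamma> r where a: "\<alpha> \<in> carrier k" "\<beta> \<in> carrier k" "\<gamma> \<in> carrier k" "r \<in> carrier R"
    "a = elem \<alpha> (kt \<beta> \<gamma>) r"
    using assms(1) by (rule AsubE')
  obtain \<alpha>' \<beta>' \<gamma>' r' where b: "\<alpha>' \<in> carrier k" "\<beta>' \<in> carrier k" "\<gamma>' \<in> carrier k" "r' \<in> carrier R"
    "b = elem \<alpha>' (kt \<beta>' \<gamma>') r'"
    using assms(2) by (rule AsubE')
  have "a \<oplus> b = elem (\<alpha> \<oplus>\<^bsub>k\<^esub> \<alpha>') ((kt \<beta> \<gamma>) \<oplus>\<^bsub>K\<^esub> (kt \<beta>' \<gamma>')) (r \<oplus> r')"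
    unfolding a(5) b(5) using a(1-4) b(1-4) by (intro elem_add) simp_all
  also have "(kt \<beta> \<gamma>) \<oplus>\<^bsub>K\<^esub> (kt \<beta>' \<gamma>')
      = phi (\<beta> \<oplus>\<^bsub>k\<^esub> \<beta>') \<oplus>\<^bsub>K\<^esub> phi (\<gamma> \<oplus>\<^bsub>k\<^esub> \<gamma>') \<otimes>\<^bsub>K\<^esub> t"
    using a(1-4) b(1-4) by (simp add: K.l_distr K.a_ac)
  finally have "lam (a \<oplus> b) = phi (\<beta> \<oplus>\<^bsub>k\<^esub> \<beta>')"
    using a(1-4) b(1-4) by (simp only: lam_el k.a_closed a_closed)
  then show ?thesis
    unfolding a(5) b(5) using a(1-4) b(1-4) by (simp add: lam_el)
qed

lemma lam_scale:
  assumes "a \<in> Asub" "c \<in> carrier k"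
  shows "lam (kap (phi c) \<otimes> a) = phi c \<otimes>\<^bsub>K\<^esub> lam a"
proof -
  obtain \<alpha> \<beta> \<gamma> r where a: "\<alpha> \<in> carrier k" "\<beta> \<in> carrier k" "\<gamma> \<in> carrier k" "r \<in> carrier R"
    "a = elem \<alpha> (kt \<beta> \<gamma>) r"
    using assms(1) by (rule AsubE')
  have "kap (phi c) \<otimes> a = elem (c \<otimes>\<^bsub>k\<^esub> \<alpha>) (phi c \<otimes>\<^bsub>K\<^esub> (kt \<beta> \<gamma>)) (kap (phi c) \<otimes> r)"
    unfolding a(5) using a(1-4) assms by (intro elem_scale) simp_all
  also have "phi c \<otimes>\<^bsub>K\<^esub> (kt \<beta> \<gamma>) = phi (c \<otimes>\<^bsub>k\<^esub> \<beta>) \<oplus>\<^bsub>K\<^esub> phi (c \<otimes>\<^bsub>k\<^esub> \<gamma>) \<otimes>\<^bsub>K\<^esub> t"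
    using a(1-4) assms by (simp add: K.r_distr K.m_assoc)
  finally have "lam (kap (phi c) \<otimes> a) = phi (c \<otimes>\<^bsub>k\<^esub> \<beta>)"
    using a(1-4) assms(2) by (simp only: lam_el k.m_closed m_closed kap_simps(1) phi_simps(1))
  then show ?thesis
    unfolding a(5) using a(1-4) assms(2) by (simp add: lam_el)
qed

lemma lam_y: "lam y = \<one>\<^bsub>K\<^esub>" and lam_ty: "lam (kap t \<otimes> y) = \<zero>\<^bsub>K\<^esub>"
  using lam_el[of "\<zero>\<^bsub>k\<^esub>" "\<one>\<^bsub>k\<^esub>" "\<zero>\<^bsub>k\<^esub>" "\<zero>"] lam_el[of "\<zero>\<^bsub>k\<^esub>" "\<zero>\<^bsub>k\<^esub>" "\<one>\<^bsub>k\<^esub>" "\<zero>"]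
  by (simp_all add: elem_def)

section \<open>Transport to the natural numbers, and the properties over k\<close>

definition enc :: "'r \<Rightarrow> nat"
  where "enc = to_nat_on Asub"

definition dec :: "nat \<Rightarrow> 'r"
  where "dec = inv_into Asub enc"

text \<open>A copy of the countable set \<open>Asub\<close> along \<open>enc\<close>, made because
  the resulting algebra has to live on the type \<open>nat\<close>.\<close>

definition alg :: "('k, nat) module"
  where "alg = \<lparr>carrier = enc ` Asub, monoid.mult = (\<lambda>a b. enc (dec a \<otimes> dec b)), one = enc \<one>,
     zero = enc \<zero>, add = (\<lambda>a b. enc (dec a \<oplus> dec b)), smult = (\<lambda>c a. enc (kap (phi c) \<otimes> dec a))\<rparr>"

lemma enc_inj: "inj_on enc Asub"
proof -
  have "countable Asub"
    using countable_R by (rule countable_subset[rotated]) auto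
  then show ?thesis
    by (simp add: enc_def inj_on_to_nat_on)
qed

lemma dec_enc [simp]: "a \<in> Asub \<Longrightarrow> dec (enc a) = a"
  by (simp add: dec_def enc_inj inv_into_f_f)

lemma enc_closed [simp]: "a \<in> Asub \<Longrightarrow> enc a \<in> carrier alg"
  by (simp add: alg_def)

lemma algE:
  assumes "x \<in> carrier alg"
  obtains a where "x = enc a" "a \<in> Asub"
  using assms by (auto simp: alg_def)

lemma dec_A0 [simp]: "x \<in> carrier alg \<Longrightarrow> dec x \<in> Asub"
  and enc_dec [simp]: "x \<in> carrier alg \<Longrightarrow> enc (dec x) = x"
  by (auto elim: algE)

lemma alg_enc [simp]:
  "\<one>\<^bsub>alg\<^esub> = enc \<one>" "\<zero>\<^bsub>alg\<^esub> = enc \<zero>"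
  "a \<in> Asub \<Longrightarrow> b \<in> Asub \<Longrightarrow> enc a \<otimes>\<^bsub>alg\<^esub> enc b = enc (a \<otimes> b)"
  "a \<in> Asub \<Longrightarrow> b \<in> Asub \<Longrightarrow> enc a \<oplus>\<^bsub>alg\<^esub> enc b = enc (a \<oplus> b)"
  "a \<in> Asub \<Longrightarrow> c \<odot>\<^bsub>alg\<^esub> enc a = enc (kap (phi c) \<otimes> a)"
  by (simp_all add: alg_def)

lemma enc_eq_iff [simp]: "a \<in> Asub \<Longrightarrow> b \<in> Asub \<Longrightarrow> enc a = enc b \<longleftrightarrow> a = b"
  using enc_inj by (auto dest: inj_onD)

lemma alg_ring: "ring alg"
proof (rule ringI)
  show "abelian_group alg"
  proof (rule abelian_groupI)
    fix x assume "x \<in> carrier alg"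
    then obtain a where "x = enc a" "a \<in> Asub"
      by (rule algE)
    then show "\<exists>z\<in>carrier alg. z \<oplus>\<^bsub>alg\<^esub> x = \<zero>\<^bsub>alg\<^esub>"
      by (intro bexI[of _ "enc (\<ominus> a)"]) (simp_all add: l_neg)
  qed (auto elim!: algE simp: a_ac)
  show "Group.monoid alg"
    by (rule monoidI) (auto elim!: algE simp: m_assoc)
qed (auto elim!: algE simp: l_distr r_distr)

sublocale alg: ring alg
  by (rule alg_ring)

lemma alg_module: "module k alg"
  by (rule moduleI)
    (auto elim!: algE simp: l_distr r_distr m_assoc intro: k.is_cring alg.is_abelian_group)

lemma alg_kalgebra: "kalgebra k alg"
  unfolding kalgebra_def
proof (intro conjI ballI)
  fix c x z assume c: "c \<in> carrier k" and "x \<in> carrier alg" "z \<in> carrier alg"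
  then obtain a b where x: "x = enc a" "a \<in> Asub" and z: "z = enc b" "b \<in> Asub"
    by (metis algE)
  have "a \<otimes> (kap (phi c) \<otimes> b) = kap (phi c) \<otimes> (a \<otimes> b)"
    using c x z kap_central[of "phi c" a] by (simp add: m_assoc[symmetric])
  then show "c \<odot>\<^bsub>alg\<^esub> x \<otimes>\<^bsub>alg\<^esub> z = c \<odot>\<^bsub>alg\<^esub> (x \<otimes>\<^bsub>alg\<^esub> z)"
    "x \<otimes>\<^bsub>alg\<^esub> (c \<odot>\<^bsub>alg\<^esub> z) = c \<odot>\<^bsub>alg\<^esub> (x \<otimes>\<^bsub>alg\<^esub> z)"
    using c x z by (simp_all add: m_assoc)
qed (rule k.field_axioms alg_ring alg_module)+

lemma alg_finitely_generated: "finitely_generated k alg"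
proof -
  obtain G where G: "finite G" "G \<subseteq> Asub"
    "\<And>B. subalg B \<Longrightarrow> \<one> \<in> B \<Longrightarrow> (\<And>c a. c \<in> carrier k \<Longrightarrow> a \<in> B \<Longrightarrow> kap (phi c) \<otimes> a \<in> B) \<Longrightarrow> G \<subseteq> B \<Longrightarrow> Asub \<subseteq> B"
    using Asub_generated by blast
  let ?g = "gen_subalg k alg (enc ` G)"
  have sub: "x \<in> carrier alg" if "x \<in> ?g" for x
    using that
  proof induction
    case (smult c x)
    then show ?case
      by (auto elim!: algE)
  qed (use G in auto)
  define B where "B = {a \<in> Asub. enc a \<in> ?g}"
  have one: "\<one> \<in> B"
    using gen_subalg.one[of alg k "enc ` G"] by (simp add: B_def)
  have scale: "kap (phi c) \<otimes> a \<in> B" if "c \<in> carrier k" "a \<in> B" for c a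
    using that gen_subalg.smult[of c k "enc a" alg "enc ` G"] by (auto simp: B_def)
  have "subalg B"
    unfolding subalg_def
  proof (intro conjI ballI)
    show "\<zero> \<in> B"
      using scale[OF k.zero_closed one] by simp
    fix a b assume "a \<in> B" "b \<in> B"
    then show "a \<oplus> b \<in> B" "a \<otimes> b \<in> B"
      using gen_subalg.add[of "enc a" k alg "enc ` G" "enc b"]
        gen_subalg.mult[of "enc a" k alg "enc ` G" "enc b"] by (auto simp: B_def)
  qed
  moreover have "G \<subseteq> B"
    using G(2) by (auto simp: B_def intro: gen_subalg.gen)
  ultimately have "Asub \<subseteq> B"
    using one scale by (intro G(3)) blast+
  then have "carrier alg \<subseteq> ?g"
    by (auto simp: B_def elim!: algE)
  with sub have "carrier alg = ?g"
    by blast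
  moreover have "finite (enc ` G)" "enc ` G \<subseteq> carrier alg"
    using G by auto
  ultimately show ?thesis
    unfolding finitely_generated_def by blast
qed

lemma alg_integral:
  assumes "x \<in> carrier alg" "z \<in> carrier alg" "x \<otimes>\<^bsub>alg\<^esub> z = \<zero>\<^bsub>alg\<^esub>"
  shows "x = \<zero>\<^bsub>alg\<^esub> \<or> z = \<zero>\<^bsub>alg\<^esub>"
  using assms by (auto elim!: algE) (metis Asub_closed integral)

text \<open>By the Ore condition two nonzero right ideals always meet, so already \<open>J 0\<close>
  and \<open>J 1\<close> cannot be independent. In a domain a right annihilator is zero or
  everything, which rules out three strictly increasing ones.\<close>

lemma alg_right_goldie: "right_goldie alg"
  unfolding right_goldie_def
proof (intro conjI)
  show "ring alg"
    by (rule alg_ring)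
  show "finite_right_udim alg"
    unfolding finite_right_udim_def
  proof
    assume "\<exists>J. (\<forall>n. right_ideal (J n) alg \<and> J n \<noteq> {\<zero>\<^bsub>alg\<^esub>}) \<and>
        (\<forall>n. J n \<inter> ideal_sum alg J n = {\<zero>\<^bsub>alg\<^esub>})"
    then obtain J :: "nat \<Rightarrow> nat set" where J: "\<And>n. right_ideal (J n) alg" "\<And>n. J n \<noteq> {\<zero>\<^bsub>alg\<^esub>}"
      "\<And>n. J n \<inter> ideal_sum alg J n = {\<zero>\<^bsub>alg\<^esub>}"
      by metis
    have ex: "\<exists>a\<in>Asub. enc a \<in> J n \<and> a \<noteq> \<zero>" for n
    proof -
      have "additive_subgroup (J n) alg"
        using J(1) by (simp add: right_ideal_def)
      then have "J n \<subseteq> carrier alg" "\<zero>\<^bsub>alg\<^esub> \<in> J n"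
        by (blast intro: additive_subgroup.a_Hcarr, rule additive_subgroup.zero_closed)
      then obtain x where "x \<in> J n" "x \<noteq> \<zero>\<^bsub>alg\<^esub>" "x \<in> carrier alg"
        using J(2)[of n] by blast
      then show ?thesis
        by (auto elim!: algE)
    qed
    obtain a where a: "a \<in> Asub" "enc a \<in> J 0" "a \<noteq> \<zero>"
      using ex by blast
    obtain b where b: "b \<in> Asub" "enc b \<in> J 1" "b \<noteq> \<zero>"
      using ex by blast
    obtain r s where rs: "r \<in> Asub" "s \<in> Asub" "a \<otimes> r = b \<otimes> s" "a \<otimes> r \<noteq> \<zero>"
      using Asub_ore a b by blast
    have "enc a \<otimes>\<^bsub>alg\<^esub> enc r \<in> J 0" "enc b \<otimes>\<^bsub>alg\<^esub> enc s \<in> J 1"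
      using J(1) a b rs by (simp_all only: right_ideal_def enc_closed)
    then have m: "enc (a \<otimes> r) \<in> J 0" "enc (a \<otimes> r) \<in> J 1"
      using a b rs by simp_all
    have "enc (a \<otimes> r) \<in> ideal_sum alg J 1"
      unfolding ideal_sum_def
    proof (rule CollectI, intro exI conjI)
      show "\<forall>i<1. (\<lambda>_. enc (a \<otimes> r)) i \<in> J i"
        using m by simp
      have eq: "{..<1 :: nat} = {0}"
        by auto
      have "enc (a \<otimes> r) \<in> carrier alg"
        using a(1) rs(1) by simp
      then show "enc (a \<otimes> r) = finsum alg (\<lambda>_. enc (a \<otimes> r)) {..<1 :: nat}"
        unfolding eq using alg.r_zero by (simp del: alg_enc)
    qed
    then have "enc (a \<otimes> r) = \<zero>\<^bsub>alg\<^esub>"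
      using J(3)[of 1] m by blast
    then show False
      using a(1) rs(1,4) by simp
  qed
  show "acc_right_ann alg"
    unfolding acc_right_ann_def
  proof
    assume "\<exists>Y. (\<forall>n. Y n \<subseteq> carrier alg) \<and> (\<forall>n. right_ann alg (Y n) \<subset> right_ann alg (Y (Suc n)))"
    then obtain Y :: "nat \<Rightarrow> nat set" where Y: "\<And>n. Y n \<subseteq> carrier alg"
      "\<And>n. right_ann alg (Y n) \<subset> right_ann alg (Y (Suc n))"
      by metis
    have two: "right_ann alg Z = {\<zero>\<^bsub>alg\<^esub>} \<or> right_ann alg Z = carrier alg" if Zc: "Z \<subseteq> carrier alg" for Z
    proof (cases "Z \<subseteq> {\<zero>\<^bsub>alg\<^esub>}")
      case True
      then have "right_ann alg Z = carrier alg"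
        using alg.l_null by (auto simp: right_ann_def simp del: alg_enc)
      then show ?thesis ..
    next
      case False
      then obtain z where z: "z \<in> Z" "z \<noteq> \<zero>\<^bsub>alg\<^esub>" "z \<in> carrier alg"
        using Zc by blast
      have "x = \<zero>\<^bsub>alg\<^esub>" if "x \<in> right_ann alg Z" for x
      proof -
        have "x \<in> carrier alg" "z \<otimes>\<^bsub>alg\<^esub> x = \<zero>\<^bsub>alg\<^esub>"
          using that z(1) unfolding right_ann_def by blast+
        then show ?thesis
          using alg_integral[of z x] z by blast
      qed
      moreover have "\<zero>\<^bsub>alg\<^esub> \<in> right_ann alg Z"
        unfolding right_ann_def using Zc alg.r_null alg.zero_closed by blast
      ultimately show ?thesis
        by blast
    qed
    have sub: "right_ann alg Z \<subseteq> carrier alg" for Z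
      by (auto simp: right_ann_def)
    show False
      using two[OF Y(1), of 0] two[OF Y(1), of 1] two[OF Y(1), of 2] Y(2)[of 0] Y(2)[of 1]
        sub[of "Y 1"] sub[of "Y 2"] by (simp add: numeral_2_eq_2) blast
  qed
qed

text \<open>A finite spanning set would confine all supports to one finite set, which y^2 R
  leaves.\<close>

lemma alg_infinite_dim: "infinite_dim k alg"
  unfolding infinite_dim_def fin_codim_def
proof
  assume "\<exists>S. finite S \<and> S \<subseteq> carrier alg \<and>
     (\<forall>a\<in>carrier alg. \<exists>s\<in>lspan k alg S. \<exists>i\<in>{\<zero>\<^bsub>alg\<^esub>}. a = s \<oplus>\<^bsub>alg\<^esub> i)"
  then obtain S where S: "finite S" "S \<subseteq> carrier alg"
    "\<And>a. a \<in> carrier alg \<Longrightarrow> \<exists>s\<in>lspan k alg S. a = s \<oplus>\<^bsub>alg\<^esub> \<zero>\<^bsub>alg\<^esub>"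
    by (auto simp del: alg_enc)
  define Z where "Z = (\<Union>s\<in>S. sp (dec s))"
  have "finite (sp (dec s))" if "s \<in> S" for s
    using that S(2) by (intro sp_finite) auto
  then have "finite Z"
    using S(1) by (simp add: Z_def)
  then obtain r where r: "r \<in> carrier R" "\<not> sp (ysq \<otimes> r) \<subseteq> Z"
    using sp_unbounded[OF ysq_closed ysq_nonzero] by blast
  have span: "x \<in> carrier alg \<and> sp (dec x) \<subseteq> Z" if "x \<in> lspan k alg S" for x
    using alg.abelian_monoid_axioms that
  proof (induction rule: lspan_induct)
    case (closed c s)
    then show ?case
      using S(2) by (auto elim!: algE)
  next
    case zero
    then show ?case
      by (simp add: sp_zero)
  next
    case (add a b)
    then show ?case
      using sp_add[of "dec a" "dec b"] by (auto elim!: algE)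
  next
    case (smult c s)
    then have "sp (dec s) \<subseteq> Z" "s \<in> carrier alg"
      using S(2) by (auto simp: Z_def)
    then show ?case
      using smult sp_scale[of "phi c" "dec s"] by (auto elim!: algE)
  qed
  obtain s where s: "s \<in> lspan k alg S" "enc (ysq \<otimes> r) = s \<oplus>\<^bsub>alg\<^esub> \<zero>\<^bsub>alg\<^esub>"
    using S(3)[of "enc (ysq \<otimes> r)"] r by auto
  then have "enc (ysq \<otimes> r) = s"
    using span alg.r_zero by (simp del: alg_enc)
  then show False
    using span[OF s(1)] r by auto
qed

lemma alg_ideal_contains:
  assumes "ideal I alg" "I \<noteq> {\<zero>\<^bsub>alg\<^esub>}" "r \<in> carrier R"
  shows "enc (ysq \<otimes> r) \<in> I"
proof -
  interpret I: ideal I alg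
    by fact
  define J where "J = {a \<in> Asub. enc a \<in> I}"
  obtain x where x: "x \<in> I" "x \<noteq> \<zero>\<^bsub>alg\<^esub>"
    using assms(2) I.zero_closed by blast
  then have "x \<in> carrier alg"
    using I.a_subset by blast
  then obtain j where "x = enc j" "j \<in> Asub"
    by (rule algE)
  with x have j: "j \<in> J" "j \<noteq> \<zero>"
    by (auto simp: J_def)
  have "ysq \<otimes> r \<in> J"
  proof (rule Asub_ideal[OF _ _ j])
    show "J \<subseteq> Asub"
      by (auto simp: J_def)
    show "\<zero> \<in> J"
      using I.zero_closed by (simp add: J_def)
    show "a \<oplus> b \<in> J" if "a \<in> J" "b \<in> J" for a b
      using that I.a_closed[of "enc a" "enc b"] by (simp add: J_def)
    have left: "a \<otimes> b \<in> J" if "a \<in> Asub" "b \<in> J" for a b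
      using that I.I_l_closed[of "enc b" "enc a"] by (simp add: J_def)
    then show "a \<otimes> b \<in> J" if "a \<in> Asub" "b \<in> J" for a b
      using that by blast
    show "b \<otimes> a \<in> J" if "a \<in> Asub" "b \<in> J" for a b
      using that I.I_r_closed[of "enc b" "enc a"] by (simp add: J_def)
    show "\<ominus> a \<in> J" if "a \<in> J" for a
    proof -
      have "\<ominus> \<one> \<otimes> a = \<ominus> a"
        using that by (simp add: J_def l_minus)
      then show ?thesis
        using left[OF Asub_neg[OF Asub_one] that] by simp
    qed
  qed (rule assms(3))
  then show ?thesis
    by (simp add: J_def)
qed

text \<open>\<open>lspan\<close> indexes coefficients by the vectors themselves, so the three
  vectors must be distinct before \<alpha>, \<beta> and \<gamma> can be attached to them.\<close>

lemma lspan_generators: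
  assumes "\<alpha> \<in> carrier k" "\<beta> \<in> carrier k" "\<gamma> \<in> carrier k"
  shows "enc (kap (phi \<alpha>) \<oplus> (kap (phi \<beta>) \<otimes> y \<oplus> kap (phi \<gamma>) \<otimes> (kap t \<otimes> y)))
      \<in> lspan k alg {enc \<one>, enc y, enc (kap t \<otimes> y)}"
proof -
  have e: "\<one> = elem \<one>\<^bsub>k\<^esub> \<zero>\<^bsub>K\<^esub> \<zero>" "y = elem \<zero>\<^bsub>k\<^esub> \<one>\<^bsub>K\<^esub> \<zero>" "kap t \<otimes> y = elem \<zero>\<^bsub>k\<^esub> t \<zero>"
    by (simp_all add: elem_def)
  have d1: "\<one> \<noteq> y"
    using elem_inj(1)[of "\<one>\<^bsub>k\<^esub>" "\<zero>\<^bsub>K\<^esub>" "\<zero>" "\<zero>\<^bsub>k\<^esub>" "\<one>\<^bsub>K\<^esub>" "\<zero>"] e by auto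
  have d2: "\<one> \<noteq> kap t \<otimes> y"
    using elem_inj(1)[of "\<one>\<^bsub>k\<^esub>" "\<zero>\<^bsub>K\<^esub>" "\<zero>" "\<zero>\<^bsub>k\<^esub>" t "\<zero>"] e by auto
  have "t \<noteq> \<one>\<^bsub>K\<^esub>"
    using t_new by (metis imageI k.one_closed phi_simps(4))
  then have d3: "y \<noteq> kap t \<otimes> y"
    using elem_inj(2)[of "\<zero>\<^bsub>k\<^esub>" "\<one>\<^bsub>K\<^esub>" "\<zero>" "\<zero>\<^bsub>k\<^esub>" t "\<zero>"] e by auto
  define c where "c s = (if s = enc \<one> then \<alpha> else if s = enc y then \<beta> else \<gamma>)" for s
  have c: "c (enc \<one>) = \<alpha>" "c (enc y) = \<beta>" "c (enc (kap t \<otimes> y)) = \<gamma>"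
    using d1 d2 d3 by (simp_all add: c_def)
  have "finsum alg (\<lambda>s. c s \<odot>\<^bsub>alg\<^esub> s) {enc \<one>, enc y, enc (kap t \<otimes> y)}
      = enc (kap (phi \<alpha>) \<oplus> (kap (phi \<beta>) \<otimes> y \<oplus> kap (phi \<gamma>) \<otimes> (kap t \<otimes> y)))"
  proof -
    have "finsum alg (\<lambda>s. c s \<odot>\<^bsub>alg\<^esub> s) {enc (kap t \<otimes> y)} = enc (kap (phi \<gamma>) \<otimes> (kap t \<otimes> y))"
      using c assms by (subst alg.finsum_insert) auto
    moreover have "finsum alg (\<lambda>s. c s \<odot>\<^bsub>alg\<^esub> s) {enc y, enc (kap t \<otimes> y)}
        = enc (kap (phi \<beta>) \<otimes> y) \<oplus>\<^bsub>alg\<^esub> finsum alg (\<lambda>s. c s \<odot>\<^bsub>alg\<^esub> s) {enc (kap t \<otimes> y)}"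
      using c d3 assms by (subst alg.finsum_insert) auto
    moreover have "finsum alg (\<lambda>s. c s \<odot>\<^bsub>alg\<^esub> s) {enc \<one>, enc y, enc (kap t \<otimes> y)}
        = enc (kap (phi \<alpha>)) \<oplus>\<^bsub>alg\<^esub> finsum alg (\<lambda>s. c s \<odot>\<^bsub>alg\<^esub> s) {enc y, enc (kap t \<otimes> y)}"
      using c d1 d2 assms by (subst alg.finsum_insert) auto
    ultimately show ?thesis
      using assms by simp
  qed
  moreover have "c \<in> {enc \<one>, enc y, enc (kap t \<otimes> y)} \<rightarrow> carrier k"
    using assms by (auto simp: c_def)
  ultimately show ?thesis
    unfolding lspan_def
    by (intro CollectI exI[of _ "{enc \<one>, enc y, enc (kap t \<otimes> y)}"] exI[of _ c]) simp
qed

lemma alg_just_infinite: "just_infinite k alg"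
  unfolding just_infinite_def
proof (intro conjI allI impI alg_kalgebra alg_infinite_dim)
  fix I assume I: "ideal I alg \<and> I \<noteq> {\<zero>\<^bsub>alg\<^esub>}"
  show "fin_codim k alg I"
    unfolding fin_codim_def
  proof (intro exI[of _ "{enc \<one>, enc y, enc (kap t \<otimes> y)}"] conjI ballI)
    fix x assume "x \<in> carrier alg"
    then obtain a where x: "x = enc a" "a \<in> Asub"
      by (rule algE)
    then obtain \<alpha> \<beta> \<gamma> r where a: "\<alpha> \<in> carrier k" "\<beta> \<in> carrier k" "\<gamma> \<in> carrier k" "r \<in> carrier R"
      "a = elem \<alpha> (kt \<beta> \<gamma>) r"
      using AsubE' by blast
    let ?s = "kap (phi \<alpha>) \<oplus> (kap (phi \<beta>) \<otimes> y \<oplus> kap (phi \<gamma>) \<otimes> (kap t \<otimes> y))"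
    have s: "?s \<in> Asub"
      using a by simp
    have "a = ?s \<oplus> ysq \<otimes> r"
      using a by (simp add: elem_def l_distr m_assoc)
    then have "x = enc ?s \<oplus>\<^bsub>alg\<^esub> enc (ysq \<otimes> r)"
      using x a s by simp
    then show "\<exists>s\<in>lspan k alg {enc \<one>, enc y, enc (kap t \<otimes> y)}. \<exists>i\<in>I. x = s \<oplus>\<^bsub>alg\<^esub> i"
      using lspan_generators[OF a(1-3)] alg_ideal_contains I a(4) by blast
  qed simp_all
qed

text \<open>This makes the right ideal y^2 R two-sided in \<open>Asub\<close>: scalars and y commute
  with y^2, and the rest of \<open>a\<close> already begins with y^2.\<close>

lemma Asub_xx_commute:
  assumes "a \<in> Asub"
  obtains s where "s \<in> carrier R" "a \<otimes> ysq = ysq \<otimes> s"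
proof -
  obtain \<alpha> p r where a: "a = elem \<alpha> p r" "\<alpha> \<in> carrier k" "p \<in> ktspan" "r \<in> carrier R"
    using assms by (rule AsubE)
  have "kap p \<otimes> y \<otimes> ysq = kap p \<otimes> ysq \<otimes> y"
    using a by (simp add: ysq_def m_assoc)
  also have "kap p \<otimes> ysq = ysq \<otimes> kap p"
    using a by (intro kap_central) simp_all
  finally have 1: "kap p \<otimes> y \<otimes> ysq = ysq \<otimes> (kap p \<otimes> y)"
    using a by (simp add: m_assoc)
  have 2: "kap (phi \<alpha>) \<otimes> ysq = ysq \<otimes> kap (phi \<alpha>)"
    using a by (intro kap_central) simp_all
  have "a \<otimes> ysq = ysq \<otimes> (kap (phi \<alpha>) \<oplus> kap p \<otimes> y \<oplus> r \<otimes> ysq)"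
    using a by (simp add: elem_def l_distr r_distr 1 2 m_assoc)
  with a show thesis
    by (intro that[of "kap (phi \<alpha>) \<oplus> kap p \<otimes> y \<oplus> r \<otimes> ysq"]) simp_all
qed

text \<open>The ideal y^2 R is nonzero, and it is proper because 1 = y (y r) would give y a right
  inverse.\<close>

lemma alg_not_simple: "\<not> simple_ring alg"
proof
  assume s: "simple_ring alg"
  define I where "I = {enc (ysq \<otimes> r) |r. r \<in> carrier R}"
  have "ideal I alg"
  proof (rule idealI)
    show "subgroup I (add_monoid alg)"
    proof (rule alg.add.subgroupI)
      show "I \<subseteq> carrier alg" "I \<noteq> {}"
        by (auto simp: I_def)
      fix x assume "x \<in> I"
      then obtain r where r: "x = enc (ysq \<otimes> r)" "r \<in> carrier R"
        by (auto simp: I_def)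
      have "ysq \<otimes> \<ominus> r \<oplus> ysq \<otimes> r = \<zero>"
        using r_distr[of "\<ominus> r" r ysq] r(2) by (simp add: l_neg)
      then have "enc (ysq \<otimes> \<ominus> r) \<oplus>\<^bsub>alg\<^esub> x = \<zero>\<^bsub>alg\<^esub>"
        using r by simp
      then have "\<ominus>\<^bsub>alg\<^esub> x = enc (ysq \<otimes> \<ominus> r)"
        using r by (intro alg.minus_equality) simp_all
      then show "\<ominus>\<^bsub>alg\<^esub> x \<in> I"
        using r by (auto simp: I_def)
      fix z assume "z \<in> I"
      then obtain s where z: "z = enc (ysq \<otimes> s)" "s \<in> carrier R"
        by (auto simp: I_def)
      have "x \<oplus>\<^bsub>alg\<^esub> z = enc (ysq \<otimes> (r \<oplus> s))"
        using r z by (simp add: r_distr)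
      then show "x \<oplus>\<^bsub>alg\<^esub> z \<in> I"
        using r z by (auto simp: I_def)
    qed
    fix x z assume "x \<in> I" "z \<in> carrier alg"
    then obtain r a where r: "x = enc (ysq \<otimes> r)" "r \<in> carrier R" and a: "z = enc a" "a \<in> Asub"
      by (auto simp: I_def elim!: algE)
    obtain q where q: "q \<in> carrier R" "a \<otimes> ysq = ysq \<otimes> q"
      using Asub_xx_commute a by blast
    have "a \<otimes> (ysq \<otimes> r) = ysq \<otimes> (q \<otimes> r)"
      using a r q by (simp add: m_assoc[symmetric])
    then have "z \<otimes>\<^bsub>alg\<^esub> x = enc (ysq \<otimes> (q \<otimes> r))"
      using a r by simp
    then show "z \<otimes>\<^bsub>alg\<^esub> x \<in> I"
      using q r by (auto simp: I_def)
    have "x \<otimes>\<^bsub>alg\<^esub> z = enc (ysq \<otimes> (r \<otimes> a))"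
      using a r by (simp add: m_assoc)
    then show "x \<otimes>\<^bsub>alg\<^esub> z \<in> I"
      using a r by (auto simp: I_def)
  qed (rule alg_ring)
  moreover have "enc (ysq \<otimes> \<one>) \<in> I"
    unfolding I_def by blast
  then have "I \<noteq> {\<zero>\<^bsub>alg\<^esub>}"
    using ysq_nonzero Asub_xx[OF one_closed] by auto
  ultimately have "I = carrier alg"
    using s unfolding simple_ring_def by blast
  then have "enc \<one> \<in> I"
    by simp
  then obtain r where "enc \<one> = enc (ysq \<otimes> r)" "r \<in> carrier R"
    by (auto simp: I_def)
  then have "ysq \<otimes> r = \<one>"
    by simp
  then have "y \<otimes> (y \<otimes> r) = \<one>"
    using \<open>r \<in> carrier R\<close> by (simp add: ysq_def m_assoc)
  with y_no_inverse[of "y \<otimes> r"] \<open>r \<in> carrier R\<close> show False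
    by simp
qed

end

section \<open>Extension of scalars\<close>

context ambient
begin

abbreviation F :: "('b, nat \<Rightarrow> 'b) module"
  where "F \<equiv> tensor_free alg K"

abbreviation nsupp :: "(nat \<Rightarrow> 'b) \<Rightarrow> nat set"
  where "nsupp f \<equiv> {a. f a \<noteq> \<zero>\<^bsub>K\<^esub>}"

lemma F_simps:
  "f \<in> carrier F \<longleftrightarrow> (\<forall>x. f x \<in> carrier K) \<and> (\<forall>x. x \<notin> carrier alg \<longrightarrow> f x = \<zero>\<^bsub>K\<^esub>) \<and> finite (nsupp f)"
  "\<zero>\<^bsub>F\<^esub> = (\<lambda>_. \<zero>\<^bsub>K\<^esub>)" "f \<oplus>\<^bsub>F\<^esub> g = (\<lambda>x. f x \<oplus>\<^bsub>K\<^esub> g x)" "c \<odot>\<^bsub>F\<^esub> f = (\<lambda>x. c \<otimes>\<^bsub>K\<^esub> f x)"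
  "f \<otimes>\<^bsub>F\<^esub> g = (\<lambda>z. finsum K (\<lambda>p. f (fst p) \<otimes>\<^bsub>K\<^esub> g (snd p))
     {p. f (fst p) \<noteq> \<zero>\<^bsub>K\<^esub> \<and> g (snd p) \<noteq> \<zero>\<^bsub>K\<^esub> \<and> fst p \<otimes>\<^bsub>alg\<^esub> snd p = z})"
  by (simp_all add: tensor_free_def)

lemma F_closed: "f \<in> carrier F \<Longrightarrow> f x \<in> carrier K"
  and F_finite: "f \<in> carrier F \<Longrightarrow> finite (nsupp f)"
  and F_supp: "f \<in> carrier F \<Longrightarrow> nsupp f \<subseteq> carrier alg"
  by (auto simp: F_simps)

lemma F_I: "(\<And>x. f x \<in> carrier K) \<Longrightarrow> nsupp f \<subseteq> S \<Longrightarrow> finite S \<Longrightarrow> S \<subseteq> carrier alg \<Longrightarrow> f \<in> carrier F"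
  unfolding F_simps by (auto intro: finite_subset)

lemma F_add: "f \<in> carrier F \<Longrightarrow> g \<in> carrier F \<Longrightarrow> f \<oplus>\<^bsub>F\<^esub> g \<in> carrier F"
  by (rule F_I[where S = "nsupp f \<union> nsupp g"])
    (use F_closed[of f] F_closed[of g] F_finite[of f] F_finite[of g] F_supp[of f] F_supp[of g] in
      \<open>auto simp: F_simps(3)\<close>)

lemma F_smult: "c \<in> carrier K \<Longrightarrow> f \<in> carrier F \<Longrightarrow> c \<odot>\<^bsub>F\<^esub> f \<in> carrier F"
  by (rule F_I[where S = "nsupp f"])
    (use F_closed[of f] F_finite[of f] F_supp[of f] in \<open>auto simp: F_simps(4)\<close>)

lemma F_delta: "x \<in> carrier alg \<Longrightarrow> delta alg K x \<in> carrier F"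
  by (rule F_I[where S = "{x}"]) (auto simp: delta_def)

lemma F_abelian_group: "abelian_group F"
proof (rule abelian_groupI)
  show "\<zero>\<^bsub>F\<^esub> \<in> carrier F"
    by (rule F_I[where S = "{}"]) (auto simp: F_simps(2))
  fix f assume f: "f \<in> carrier F"
  show "\<zero>\<^bsub>F\<^esub> \<oplus>\<^bsub>F\<^esub> f = f"
    using F_closed[OF f] by (simp add: F_simps(2,3))
  have "(\<lambda>x. \<ominus>\<^bsub>K\<^esub> f x) \<in> carrier F"
    by (rule F_I[where S = "nsupp f"]) (use F_closed[OF f] F_finite[OF f] F_supp[OF f] in auto)
  then show "\<exists>g\<in>carrier F. g \<oplus>\<^bsub>F\<^esub> f = \<zero>\<^bsub>F\<^esub>"
    using F_closed[OF f] by (intro bexI) (simp_all add: F_simps(2,3) K.l_neg)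
  fix g assume g: "g \<in> carrier F"
  show "f \<oplus>\<^bsub>F\<^esub> g \<in> carrier F"
    using f g by (rule F_add)
  show "f \<oplus>\<^bsub>F\<^esub> g = g \<oplus>\<^bsub>F\<^esub> f"
    using F_closed[OF f] F_closed[OF g] by (simp add: F_simps(3) K.a_comm)
  fix h assume h: "h \<in> carrier F"
  show "f \<oplus>\<^bsub>F\<^esub> g \<oplus>\<^bsub>F\<^esub> h = f \<oplus>\<^bsub>F\<^esub> (g \<oplus>\<^bsub>F\<^esub> h)"
    using F_closed[OF f] F_closed[OF g] F_closed[OF h] by (simp add: F_simps(3) K.a_assoc)
qed

interpretation F: abelian_group F
  by (rule F_abelian_group)

text \<open>The K-linear extension of \<open>L\<close> to the free module. It is used for
  \<open>dec\<close>, where it induces the multiplication map into \<open>R\<close>, and for the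
  coefficient of y.\<close>

definition Ext :: "(nat \<Rightarrow> 'r) \<Rightarrow> (nat \<Rightarrow> 'b) \<Rightarrow> 'r"
  where "Ext L f = (\<Oplus>a\<in>nsupp f. kap (f a) \<otimes> L a)"

lemma Ext_superset:
  assumes "f \<in> carrier F" "finite S" "nsupp f \<subseteq> S" "S \<subseteq> carrier alg" "L \<in> carrier alg \<rightarrow> carrier R"
  shows "Ext L f = (\<Oplus>a\<in>S. kap (f a) \<otimes> L a)"
  unfolding Ext_def
proof (rule add.finprod_mono_neutral_cong_left)
  have La: "L a \<in> carrier R" if "a \<in> S" for a
    using that assms(4,5) by blast
  show "kap (f a) \<otimes> L a = \<zero>" if "a \<in> S - nsupp f" for a
    using that La by simp
  show "(\<lambda>a. kap (f a) \<otimes> L a) \<in> S \<rightarrow> carrier R"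
    using La F_closed[OF assms(1)] by auto
qed (use assms in auto)

lemma Ext_closed:
  assumes "f \<in> carrier F" "L \<in> carrier alg \<rightarrow> carrier R"
  shows "Ext L f \<in> carrier R"
proof -
  have "L a \<in> carrier R" if "a \<in> nsupp f" for a
    using that assms(2) F_supp[OF assms(1)] by blast
  then show ?thesis
    unfolding Ext_def using F_closed[OF assms(1)] by (intro finsum_closed) auto
qed

lemma Ext_add:
  assumes f: "f \<in> carrier F" and g: "g \<in> carrier F" and L: "L \<in> carrier alg \<rightarrow> carrier R"
  shows "Ext L (f \<oplus>\<^bsub>F\<^esub> g) = Ext L f \<oplus> Ext L g"
proof -
  let ?S = "nsupp f \<union> nsupp g"
  have S: "finite ?S" "?S \<subseteq> carrier alg"
    using F_finite[OF f] F_finite[OF g] F_supp[OF f] F_supp[OF g] by auto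
  have La: "L a \<in> carrier R" if "a \<in> ?S" for a
    using L S that by blast
  have "Ext L (f \<oplus>\<^bsub>F\<^esub> g) = (\<Oplus>a\<in>?S. kap ((f \<oplus>\<^bsub>F\<^esub> g) a) \<otimes> L a)"
    using F_add[OF f g] S L F_closed[OF f] F_closed[OF g] by (intro Ext_superset) (auto simp: F_simps(3))
  also have "\<dots> = (\<Oplus>a\<in>?S. kap (f a) \<otimes> L a \<oplus> kap (g a) \<otimes> L a)"
    using La F_closed[OF f] F_closed[OF g] by (intro finsum_cong') (auto simp: F_simps(3) l_distr)
  also have "\<dots> = (\<Oplus>a\<in>?S. kap (f a) \<otimes> L a) \<oplus> (\<Oplus>a\<in>?S. kap (g a) \<otimes> L a)"
    using La F_closed[OF f] F_closed[OF g] by (intro finsum_addf) auto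
  also have "(\<Oplus>a\<in>?S. kap (f a) \<otimes> L a) = Ext L f"
    using f S L by (intro Ext_superset[symmetric]) auto
  also have "(\<Oplus>a\<in>?S. kap (g a) \<otimes> L a) = Ext L g"
    using g S L by (intro Ext_superset[symmetric]) auto
  finally show ?thesis .
qed

lemma Ext_smult:
  assumes f: "f \<in> carrier F" and c: "c \<in> carrier K" and L: "L \<in> carrier alg \<rightarrow> carrier R"
  shows "Ext L (c \<odot>\<^bsub>F\<^esub> f) = kap c \<otimes> Ext L f"
proof -
  let ?S = "nsupp f"
  have S: "finite ?S" "?S \<subseteq> carrier alg"
    using F_finite[OF f] F_supp[OF f] by auto
  have La: "L a \<in> carrier R" if "a \<in> ?S" for a
    using L S that by blast
  have "Ext L (c \<odot>\<^bsub>F\<^esub> f) = (\<Oplus>a\<in>?S. kap ((c \<odot>\<^bsub>F\<^esub> f) a) \<otimes> L a)"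
    using F_smult[OF c f] S L c by (intro Ext_superset) (auto simp: F_simps(4))
  also have "\<dots> = (\<Oplus>a\<in>?S. kap c \<otimes> (kap (f a) \<otimes> L a))"
    using La F_closed[OF f] c by (intro finsum_cong') (auto simp: F_simps(4) m_assoc)
  also have "\<dots> = kap c \<otimes> Ext L f"
    unfolding Ext_def using La F_closed[OF f] c S(1) by (intro finsum_rdistr[symmetric]) auto
  finally show ?thesis .
qed

lemma Ext_delta:
  assumes x: "x \<in> carrier alg" and L: "L \<in> carrier alg \<rightarrow> carrier R"
  shows "Ext L (delta alg K x) = L x"
proof -
  have Lx: "L x \<in> carrier R"
    using x L by blast
  have "Ext L (delta alg K x) = (\<Oplus>a\<in>{x}. kap (delta alg K x a) \<otimes> L a)"
    using F_delta[OF x] x L by (intro Ext_superset) (auto simp: delta_def)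
  with Lx show ?thesis
    by (simp add: delta_def)
qed

lemma Ext_zero: "Ext L \<zero>\<^bsub>F\<^esub> = \<zero>"
  by (simp add: Ext_def F_simps(2))

lemma Ext_minus:
  assumes f: "f \<in> carrier F" and g: "g \<in> carrier F" and L: "L \<in> carrier alg \<rightarrow> carrier R"
  shows "Ext L (f \<ominus>\<^bsub>F\<^esub> g) = Ext L f \<ominus> Ext L g"
proof -
  have "Ext L (\<ominus>\<^bsub>F\<^esub> g) \<oplus> Ext L g = \<zero>"
    using Ext_add[of "\<ominus>\<^bsub>F\<^esub> g" g L] g L by (simp add: F.l_neg Ext_zero)
  then have "\<ominus> Ext L g = Ext L (\<ominus>\<^bsub>F\<^esub> g)"
    using g L by (intro minus_equality) (simp_all add: Ext_closed)
  then show ?thesis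
    using f g L by (simp add: F.minus_eq minus_eq Ext_add)
qed

definition klinear :: "(nat \<Rightarrow> 'r) \<Rightarrow> bool"
  where "klinear L \<longleftrightarrow> L \<in> carrier alg \<rightarrow> carrier R \<and>
     (\<forall>x\<in>carrier alg. \<forall>z\<in>carrier alg. L (x \<oplus>\<^bsub>alg\<^esub> z) = L x \<oplus> L z) \<and>
     (\<forall>c\<in>carrier k. \<forall>x\<in>carrier alg. L (c \<odot>\<^bsub>alg\<^esub> x) = kap (phi c) \<otimes> L x)"

abbreviation N :: "(nat \<Rightarrow> 'b) set"
  where "N \<equiv> tensor_rel k alg K phi"

lemma alg_smult_closed: "c \<in> carrier k \<Longrightarrow> x \<in> carrier alg \<Longrightarrow> c \<odot>\<^bsub>alg\<^esub> x \<in> carrier alg"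
  by (auto elim!: algE)

text \<open>The universal property of the tensor product: a k-linear map extends to one that kills
  the defining relations. The membership in \<open>carrier F\<close> rides along in the same
  induction.\<close>

lemma N_kernel:
  assumes L: "klinear L" and n: "n \<in> N"
  shows "n \<in> carrier F \<and> Ext L n = \<zero>"
proof -
  have Lc: "L \<in> carrier alg \<rightarrow> carrier R"
    using L by (simp add: klinear_def)
  let ?G = "{(delta alg K (x \<oplus>\<^bsub>alg\<^esub> z) \<ominus>\<^bsub>F\<^esub> delta alg K x) \<ominus>\<^bsub>F\<^esub> delta alg K z
        | x z. x \<in> carrier alg \<and> z \<in> carrier alg} \<union>
      {delta alg K (a \<odot>\<^bsub>alg\<^esub> x) \<ominus>\<^bsub>F\<^esub> (phi a \<odot>\<^bsub>F\<^esub> delta alg K x)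
        | a x. a \<in> carrier k \<and> x \<in> carrier alg}"
  have gen: "s \<in> carrier F \<and> Ext L s = \<zero>" if "s \<in> ?G" for s
    using that
  proof (elim UnE)
    assume "s \<in> {(delta alg K (x \<oplus>\<^bsub>alg\<^esub> z) \<ominus>\<^bsub>F\<^esub> delta alg K x) \<ominus>\<^bsub>F\<^esub> delta alg K z
        | x z. x \<in> carrier alg \<and> z \<in> carrier alg}"
    then obtain x z where xz: "x \<in> carrier alg" "z \<in> carrier alg"
      and s: "s = (delta alg K (x \<oplus>\<^bsub>alg\<^esub> z) \<ominus>\<^bsub>F\<^esub> delta alg K x) \<ominus>\<^bsub>F\<^esub> delta alg K z"
      by blast
    have Lxz: "L x \<in> carrier R" "L z \<in> carrier R"
      using xz Lc by auto
    have "L (x \<oplus>\<^bsub>alg\<^esub> z) = L x \<oplus> L z"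
      using L xz by (simp add: klinear_def)
    then have "Ext L s = L x \<oplus> L z \<ominus> L x \<ominus> L z"
      using xz Lc by (simp add: s Ext_minus Ext_delta F_delta)
    also have "\<dots> = (L x \<oplus> L z) \<oplus> \<ominus> (L x \<oplus> L z)"
      using Lxz by (simp add: minus_eq minus_add a_assoc)
    also have "\<dots> = \<zero>"
      using Lxz by (intro r_neg) simp
    finally show ?thesis
      using xz by (simp add: s F_delta)
  next
    assume "s \<in> {delta alg K (a \<odot>\<^bsub>alg\<^esub> x) \<ominus>\<^bsub>F\<^esub> (phi a \<odot>\<^bsub>F\<^esub> delta alg K x)
        | a x. a \<in> carrier k \<and> x \<in> carrier alg}"
    then obtain a x where ax: "a \<in> carrier k" "x \<in> carrier alg"
      and s: "s = delta alg K (a \<odot>\<^bsub>alg\<^esub> x) \<ominus>\<^bsub>F\<^esub> (phi a \<odot>\<^bsub>F\<^esub> delta alg K x)"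
      by blast
    have "L (a \<odot>\<^bsub>alg\<^esub> x) = kap (phi a) \<otimes> L x" "L x \<in> carrier R"
      using L ax by (auto simp: klinear_def)
    then have "Ext L s = \<zero>"
      using ax Lc by (simp add: s Ext_minus Ext_delta Ext_smult F_delta F_smult alg_smult_closed minus_eq r_neg)
    then show ?thesis
      using ax by (simp add: s F_delta F_smult alg_smult_closed)
  qed
  have "n \<in> lspan K F ?G"
    using n by (simp add: tensor_rel_def)
  with F.abelian_monoid_axioms show ?thesis
  proof (induction rule: lspan_induct)
    case (closed c s)
    then show ?case
      using gen[of s] by (intro F_smult) blast+
  next
    case zero
    then show ?case
      by (rule Ext_zero)
  next
    case (add a b)
    then show ?case
      using Lc by (simp add: Ext_add)
  next
    case (smult c s)
    then show ?case
      using gen[of s] Lc by (simp add: Ext_smult)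
  qed
qed

lemma N_zero: "\<zero>\<^bsub>F\<^esub> \<in> N"
  unfolding tensor_rel_def lspan_def by (rule CollectI, rule exI[of _ "{}"]) simp

section \<open>The multiplication map on the tensor product\<close>

lemma kap_finsum:
  assumes "finite S" "f \<in> S \<rightarrow> carrier K"
  shows "kap (finsum K f S) = (\<Oplus>i\<in>S. kap (f i))"
  using assms by (induction S) (auto simp: Pi_def)

lemma finsum_Times:
  assumes S: "finite S" and T: "finite T" and g: "\<And>a b. a \<in> S \<Longrightarrow> b \<in> T \<Longrightarrow> g (a, b) \<in> carrier R"
  shows "(\<Oplus>p\<in>S \<times> T. g p) = (\<Oplus>a\<in>S. \<Oplus>b\<in>T. g (a, b))"
proof -
  have eq: "S \<times> T = (\<Union>a\<in>S. Pair a ` T)"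
    by auto
  have "(\<Oplus>p\<in>S \<times> T. g p) = (\<Oplus>a\<in>S. \<Oplus>p\<in>Pair a ` T. g p)"
    unfolding eq by (rule add.finprod_UN_disjoint)
      (use S T g in \<open>auto simp: pairwise_def disjnt_def\<close>)
  also have "\<dots> = (\<Oplus>a\<in>S. \<Oplus>b\<in>T. g (a, b))"
  proof (rule finsum_cong')
    fix a assume a: "a \<in> S"
    show "(\<Oplus>p\<in>Pair a ` T. g p) = (\<Oplus>b\<in>T. g (a, b))"
      using g a by (intro add.finprod_reindex) (auto simp: inj_on_def)
  qed (use g in \<open>auto intro!: finsum_closed\<close>)
  finally show ?thesis .
qed

text \<open>The double sum over both supports is grouped by the product z of the indices, and
  centrality of \<open>kap\<close> separates the factors. The sum runs over all products
  \<open>?Z\<close>, since coefficients may cancel and leave a smaller support.\<close>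

lemma F_mult_Ext:
  assumes f: "f \<in> carrier F" and g: "g \<in> carrier F"
  shows "f \<otimes>\<^bsub>F\<^esub> g \<in> carrier F" "Ext dec (f \<otimes>\<^bsub>F\<^esub> g) = Ext dec f \<otimes> Ext dec g"
proof -
  let ?A = "nsupp f" and ?B = "nsupp g"
  let ?m = "\<lambda>p. fst p \<otimes>\<^bsub>alg\<^esub> snd p"
  let ?P = "\<lambda>z. {p \<in> ?A \<times> ?B. ?m p = z}"
  let ?Z = "?m ` (?A \<times> ?B)"
  let ?h = "f \<otimes>\<^bsub>F\<^esub> g"
  let ?w = "\<lambda>p. (kap (f (fst p)) \<otimes> dec (fst p)) \<otimes> (kap (g (snd p)) \<otimes> dec (snd p))"
  have A: "finite ?A" "?A \<subseteq> carrier alg" and B: "finite ?B" "?B \<subseteq> carrier alg"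
    using F_finite[OF f] F_supp[OF f] F_finite[OF g] F_supp[OF g] by auto
  have Am: "a \<in> carrier alg" if "f a \<noteq> \<zero>\<^bsub>K\<^esub>" for a
    using A that by blast
  have Bm: "b \<in> carrier alg" if "g b \<noteq> \<zero>\<^bsub>K\<^esub>" for b
    using B that by blast
  have Z: "finite ?Z" "?Z \<subseteq> carrier alg"
    using A(1) B(1) Am Bm by auto
  have dPi: "dec \<in> carrier alg \<rightarrow> carrier R"
    by simp
  have h: "?h z = finsum K (\<lambda>p. f (fst p) \<otimes>\<^bsub>K\<^esub> g (snd p)) (?P z)" for z
    unfolding F_simps(5) by (rule arg_cong[where f = "finsum K _"]) auto
  have hc: "?h z \<in> carrier K" for z
    unfolding h using F_closed[OF f] F_closed[OF g] by (intro K.finsum_closed) auto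
  have hs: "nsupp ?h \<subseteq> ?Z"
  proof
    fix z assume z: "z \<in> nsupp ?h"
    show "z \<in> ?Z"
    proof (rule ccontr)
      assume "z \<notin> ?Z"
      then have "?P z = {}"
        by blast
      then have "?h z = \<zero>\<^bsub>K\<^esub>"
        unfolding h by (simp only: K.finsum_empty)
      with z show False
        by simp
    qed
  qed
  show hF: "?h \<in> carrier F"
    using hc hs Z by (rule F_I)
  have wc: "?w p \<in> carrier R" if "p \<in> ?A \<times> ?B" for p
    using that Am Bm F_closed[OF f] F_closed[OF g] by auto
  have summand: "kap (?h z) \<otimes> dec z = (\<Oplus>p\<in>?P z. ?w p)" if z: "z \<in> ?Z" for z
  proof -
    have Pf: "finite (?P z)"
      using A B by (intro finite_subset[of "?P z" "?A \<times> ?B"]) auto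
    have "kap (?h z) = (\<Oplus>p\<in>?P z. kap (f (fst p)) \<otimes> kap (g (snd p)))"
      unfolding h using F_closed[OF f] F_closed[OF g] Pf by (subst kap_finsum) auto
    then have "kap (?h z) \<otimes> dec z = (\<Oplus>p\<in>?P z. kap (f (fst p)) \<otimes> kap (g (snd p)) \<otimes> dec z)"
      using F_closed[OF f] F_closed[OF g] Pf Z z by (simp add: finsum_ldistr subset_iff)
    also have "\<dots> = (\<Oplus>p\<in>?P z. ?w p)"
    proof (rule finsum_cong')
      fix p assume p: "p \<in> ?P z"
      then obtain a b where ab: "p = (a, b)" "a \<in> carrier alg" "b \<in> carrier alg" "z = a \<otimes>\<^bsub>alg\<^esub> b"
        using Am Bm by auto
      have cl: "dec a \<in> carrier R" "dec b \<in> carrier R" "kap (f a) \<in> carrier R" "kap (g b) \<in> carrier R"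
        using ab F_closed[OF f] F_closed[OF g] by simp_all
      have "dec z = dec a \<otimes> dec b"
        using ab by (auto elim!: algE)
      moreover have "kap (g b) \<otimes> (dec a \<otimes> dec b) = dec a \<otimes> (kap (g b) \<otimes> dec b)"
        using kap_central[OF F_closed[OF g], of "dec a" b] cl by (simp flip: m_assoc)
      ultimately show "kap (f (fst p)) \<otimes> kap (g (snd p)) \<otimes> dec z = ?w p"
        using cl by (simp add: ab(1) m_assoc)
    qed (use wc in auto)
    finally show ?thesis .
  qed
  have U: "?A \<times> ?B = (\<Union>z\<in>?Z. ?P z)"
    by auto
  have "Ext dec ?h = (\<Oplus>z\<in>?Z. kap (?h z) \<otimes> dec z)"
    using hF Z hs dPi by (intro Ext_superset) auto
  also have "\<dots> = (\<Oplus>z\<in>?Z. \<Oplus>p\<in>?P z. ?w p)"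
    using summand wc by (intro finsum_cong') (auto intro!: finsum_closed)
  also have "\<dots> = (\<Oplus>p\<in>(\<Union>z\<in>?Z. ?P z). ?w p)"
  proof (rule add.finprod_UN_disjoint[symmetric])
    show "finite (?P z)" for z
      using A B by (intro finite_subset[of "?P z" "?A \<times> ?B"]) auto
    show "pairwise (\<lambda>i j. disjnt (?P i) (?P j)) ?Z"
      by (auto simp: pairwise_def disjnt_def)
  qed (use Z(1) wc in auto)
  also have "\<dots> = (\<Oplus>p\<in>?A \<times> ?B. ?w p)"
    by (simp only: U[symmetric])
  also have "\<dots> = (\<Oplus>a\<in>?A. \<Oplus>b\<in>?B. ?w (a, b))"
    using A(1) B(1) wc by (intro finsum_Times) auto
  also have "\<dots> = (\<Oplus>a\<in>?A. kap (f a) \<otimes> dec a \<otimes> Ext dec g)"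
  proof (rule finsum_cong')
    fix a assume a: "a \<in> ?A"
    then have "kap (f a) \<otimes> dec a \<in> carrier R"
      using Am F_closed[OF f] by auto
    then show "(\<Oplus>b\<in>?B. ?w (a, b)) = kap (f a) \<otimes> dec a \<otimes> Ext dec g"
      unfolding Ext_def using B(1) Bm F_closed[OF g] by (simp add: finsum_rdistr Pi_def)
  qed (use Am F_closed[OF f] Ext_closed[OF g dPi] in auto)
  also have "\<dots> = Ext dec f \<otimes> Ext dec g"
    unfolding Ext_def[of dec f] using A(1) Am F_closed[OF f] Ext_closed[OF g dPi]
    by (intro finsum_ldistr[symmetric]) auto
  finally show "Ext dec ?h = Ext dec f \<otimes> Ext dec g" .
qed

lemma klinear_dec: "klinear dec"
  unfolding klinear_def by (auto elim!: algE)

lemma klinear_lam: "klinear (\<lambda>x. kap (lam (dec x)))"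
  unfolding klinear_def by (auto elim!: algE simp: lam_add lam_scale)

abbreviation T :: "('b, (nat \<Rightarrow> 'b) set) module"
  where "T \<equiv> tensor k alg K phi"

lemma T_simps:
  "V \<in> carrier T \<longleftrightarrow> (\<exists>f\<in>carrier F. V = N +>\<^bsub>F\<^esub> f)"
  "V \<otimes>\<^bsub>T\<^esub> W = (\<Union>a\<in>V. \<Union>b\<in>W. N +>\<^bsub>F\<^esub> (a \<otimes>\<^bsub>F\<^esub> b))"
  "\<zero>\<^bsub>T\<^esub> = N" "V \<oplus>\<^bsub>T\<^esub> W = (\<Union>a\<in>V. \<Union>b\<in>W. {a \<oplus>\<^bsub>F\<^esub> b})"
  "c \<odot>\<^bsub>T\<^esub> V = N +>\<^bsub>F\<^esub> (c \<odot>\<^bsub>F\<^esub> (SOME f. f \<in> V))"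
  by (simp_all add: tensor_def Let_def FactRing_def A_RCOSETS_def' rcoset_mult_def set_add_def' image_iff)

lemma coset_mem: "g \<in> N +>\<^bsub>F\<^esub> f \<longleftrightarrow> (\<exists>n\<in>N. g = n \<oplus>\<^bsub>F\<^esub> f)"
  by (auto simp: a_r_coset_def')

lemma coset_self: "f \<in> carrier F \<Longrightarrow> f \<in> N +>\<^bsub>F\<^esub> f"
  unfolding coset_mem using N_zero by (intro bexI[of _ "\<zero>\<^bsub>F\<^esub>"]) simp_all

text \<open>Constancy on cosets makes \<open>Ext L\<close> insensitive to the representative that
  scalar multiplication in \<open>tensor\<close> picks.\<close>

lemma coset_Ext:
  assumes "klinear L" "f \<in> carrier F" "g \<in> N +>\<^bsub>F\<^esub> f"
  shows "g \<in> carrier F" "Ext L g = Ext L f"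
proof -
  obtain n where n: "n \<in> N" "g = n \<oplus>\<^bsub>F\<^esub> f"
    using assms(3) by (auto simp: coset_mem)
  have L: "L \<in> carrier alg \<rightarrow> carrier R"
    using assms(1) by (simp add: klinear_def)
  show "g \<in> carrier F" "Ext L g = Ext L f"
    using N_kernel[OF assms(1) n(1)] n(2) assms(2) L by (simp_all add: Ext_add Ext_closed)
qed

lemma T_mem:
  assumes "V \<in> carrier T" "f \<in> V"
  shows "f \<in> carrier F"
  using assms coset_Ext(1)[OF klinear_dec] unfolding T_simps(1) by blast

lemma T_nonempty: "V \<in> carrier T \<Longrightarrow> \<exists>f\<in>carrier F. f \<in> V"
  unfolding T_simps(1) using coset_self by blast

lemma dec_Pi: "dec \<in> carrier alg \<rightarrow> carrier R"
  using klinear_dec by (simp add: klinear_def)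

text \<open>
  The map \<open>a \<otimes> c \<mapsto> ca\<close> into \<open>R\<close> has an infinite-dimensional image, and its kernel contains
  \<open>ty \<otimes> 1 - y \<otimes> t\<close>, which is nonzero because the coefficient of \<open>y\<close> detects it. The ring axioms for the
  tensor product come for free from the assumption that it is just infinite.
\<close>

theorem not_just_infinite_tensor: "\<not> just_infinite K T"
proof
  assume ji: "just_infinite K T"
  then have "ring T"
    by (simp add: just_infinite_def kalgebra_def)
  then interpret T: ring T .
  \<comment> \<open>The kernel of the multiplication map, written as the classes all of whose
    representatives are sent to zero.\<close>
  define I where "I = {V \<in> carrier T. \<forall>f\<in>V. Ext dec f = \<zero>}"
  have "ideal I T"
  proof (rule idealI)
    show "subgroup I (add_monoid T)"
    proof (rule T.add.subgroupI)
      show "I \<subseteq> carrier T"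
        by (auto simp: I_def)
      have "\<zero>\<^bsub>T\<^esub> \<in> I"
        unfolding I_def using T.zero_closed N_kernel[OF klinear_dec] by (simp add: T_simps(3))
      then show "I \<noteq> {}"
        by blast
      fix V assume V: "V \<in> I"
      then have VT: "V \<in> carrier T" and V0: "\<And>f. f \<in> V \<Longrightarrow> Ext dec f = \<zero>"
        by (auto simp: I_def)
      obtain f where f: "f \<in> carrier F" "f \<in> V"
        using T_nonempty[OF VT] by blast
      have "Ext dec g = \<zero>" if g: "g \<in> \<ominus>\<^bsub>T\<^esub> V" for g
      proof -
        have gF: "g \<in> carrier F"
          using T_mem[OF T.a_inv_closed[OF VT] g] .
        have "g \<oplus>\<^bsub>F\<^esub> f \<in> \<ominus>\<^bsub>T\<^esub> V \<oplus>\<^bsub>T\<^esub> V"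
          using f g by (auto simp: T_simps(4))
        then have "g \<oplus>\<^bsub>F\<^esub> f \<in> N"
          using VT by (simp add: T.l_neg T_simps(3))
        then have "Ext dec (g \<oplus>\<^bsub>F\<^esub> f) = \<zero>"
          using N_kernel[OF klinear_dec] by blast
        then show ?thesis
          using gF f V0[OF f(2)] dec_Pi by (simp add: Ext_add Ext_closed)
      qed
      then show "\<ominus>\<^bsub>T\<^esub> V \<in> I"
        using VT by (simp add: I_def)
      fix W assume W: "W \<in> I"
      then have WT: "W \<in> carrier T" and W0: "\<And>f. f \<in> W \<Longrightarrow> Ext dec f = \<zero>"
        by (auto simp: I_def)
      have "Ext dec g = \<zero>" if g: "g \<in> V \<oplus>\<^bsub>T\<^esub> W" for g
      proof -
        obtain a b where ab: "a \<in> V" "b \<in> W" "g = a \<oplus>\<^bsub>F\<^esub> b"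
          using g by (auto simp: T_simps(4))
        then show ?thesis
          using T_mem[OF VT ab(1)] T_mem[OF WT ab(2)] V0[OF ab(1)] W0[OF ab(2)] dec_Pi
          by (simp add: Ext_add)
      qed
      then show "V \<oplus>\<^bsub>T\<^esub> W \<in> I"
        using VT WT by (simp add: I_def)
    qed
    have mult: "Ext dec g = \<zero>"
      if V: "V \<in> carrier T" "W \<in> carrier T" "(\<forall>f\<in>V. Ext dec f = \<zero>) \<or> (\<forall>f\<in>W. Ext dec f = \<zero>)"
        and g: "g \<in> V \<otimes>\<^bsub>T\<^esub> W" for V W g
    proof -
      obtain a b where ab: "a \<in> V" "b \<in> W" "g \<in> N +>\<^bsub>F\<^esub> (a \<otimes>\<^bsub>F\<^esub> b)"
        using g by (auto simp: T_simps(2))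
      have F: "a \<in> carrier F" "b \<in> carrier F"
        using T_mem[OF V(1) ab(1)] T_mem[OF V(2) ab(2)] .
      have "Ext dec g = Ext dec a \<otimes> Ext dec b"
        using coset_Ext(2)[OF klinear_dec F_mult_Ext(1)[OF F] ab(3)] F_mult_Ext(2)[OF F] by simp
      moreover have "Ext dec a = \<zero> \<or> Ext dec b = \<zero>"
        using V(3) ab by blast
      ultimately show ?thesis
        using Ext_closed[OF F(1) dec_Pi] Ext_closed[OF F(2) dec_Pi] by auto
    qed
    fix V W assume V: "V \<in> I" and W: "W \<in> carrier T"
    then show "W \<otimes>\<^bsub>T\<^esub> V \<in> I"
      using mult[of W V] by (simp add: I_def)
    show "V \<otimes>\<^bsub>T\<^esub> W \<in> I"
      using V W mult[of V W] by (simp add: I_def)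
  qed (rule T.ring_axioms)
  moreover have "I \<noteq> {\<zero>\<^bsub>T\<^esub>}"
  proof
    assume I0: "I = {\<zero>\<^bsub>T\<^esub>}"
    define f where "f = delta alg K (enc (kap t \<otimes> y)) \<ominus>\<^bsub>F\<^esub> (t \<odot>\<^bsub>F\<^esub> delta alg K (enc y))"
    have d: "delta alg K (enc (kap t \<otimes> y)) \<in> carrier F" "delta alg K (enc y) \<in> carrier F"
      by (simp_all add: F_delta)
    have f: "f \<in> carrier F"
      using d by (simp add: f_def F_smult)
    have e: "Ext L f = L (enc (kap t \<otimes> y)) \<ominus> kap t \<otimes> L (enc y)" if "klinear L" for L
      using that d by (simp add: f_def Ext_minus Ext_smult Ext_delta F_smult klinear_def)
    have "Ext dec f = \<zero>"
      using e[OF klinear_dec] by (simp add: minus_eq r_neg)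
    then have "N +>\<^bsub>F\<^esub> f \<in> I"
      using f coset_Ext(2)[OF klinear_dec f] by (auto simp: I_def T_simps(1))
    then have "N +>\<^bsub>F\<^esub> f = N"
      using I0 by (simp add: T_simps(3))
    then have "f \<in> N"
      using coset_self[OF f] by simp
    \<comment> \<open>The coefficient of y is 0 on ty and 1 on y, so this extension sends
      \<open>f\<close> to 0 - t * 1, in contrast to the multiplication map.\<close>
    then have "Ext (\<lambda>x. kap (lam (dec x))) f = \<zero>"
      using N_kernel[OF klinear_lam] by blast
    then have "\<ominus> kap t = \<zero>"
      using e[OF klinear_lam] by (simp add: lam_y lam_ty minus_eq)
    then have "t = \<zero>\<^bsub>K\<^esub>"
      using kap_eq_zero_iff[OF t_closed] minus_minus[of "kap t"] by auto
    then show False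
      using t_new by (metis imageI k.zero_closed phi_simps(5))
  qed
  ultimately have "fin_codim K T I"
    using ji by (simp add: just_infinite_def)
  then obtain S where S': "finite S \<and> S \<subseteq> carrier T \<and>
      (\<forall>V\<in>carrier T. \<exists>s\<in>lspan K T S. \<exists>i\<in>I. V = s \<oplus>\<^bsub>T\<^esub> i)"
    unfolding fin_codim_def ..
  have S: "finite S" "S \<subseteq> carrier T"
    using S' by simp_all
  \<comment> \<open>The same choice as in the scalar multiplication of \<open>tensor\<close>, so
    that \<open>T_simps(5)\<close> can be read in terms of \<open>rp\<close>.\<close>
  define rp where "rp V = (SOME f. f \<in> V)" for V :: "(nat \<Rightarrow> 'b) set"
  have rp: "rp V \<in> V" "rp V \<in> carrier F" if V: "V \<in> carrier T" for V
  proof -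
    show "rp V \<in> V"
      unfolding rp_def using T_nonempty[OF V] by (metis someI_ex)
    then show "rp V \<in> carrier F"
      by (rule T_mem[OF V])
  qed
  define Z where "Z = (\<Union>V\<in>S. sp (Ext dec (rp V)))"
  have "finite (sp (Ext dec (rp V)))" if "V \<in> S" for V
    using that S(2) rp dec_Pi by (intro sp_finite Ext_closed) auto
  then have "finite Z"
    using S(1) by (simp add: Z_def)
  then obtain r where r: "r \<in> carrier R" "\<not> sp (ysq \<otimes> r) \<subseteq> Z"
    using sp_unbounded[OF ysq_closed ysq_nonzero] by blast
  have span: "V \<in> carrier T \<and> (\<forall>f\<in>V. sp (Ext dec f) \<subseteq> Z)" if "V \<in> lspan K T S" for V
    using T.abelian_monoid_axioms that
  proof (induction rule: lspan_induct)
    case (closed c s)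
    then have "c \<odot>\<^bsub>F\<^esub> rp s \<in> carrier F"
      using S(2) rp by (intro F_smult) auto
    then show ?case
      unfolding T_simps(1,5) rp_def by blast
  next
    case zero
    then show ?case
      using N_kernel[OF klinear_dec] by (simp add: T_simps(3) sp_zero)
  next
    case (add V W)
    show ?case
    proof
      fix g assume "g \<in> V \<oplus>\<^bsub>T\<^esub> W"
      then obtain a b where ab: "a \<in> V" "b \<in> W" "g = a \<oplus>\<^bsub>F\<^esub> b"
        by (auto simp: T_simps(4))
      have F: "a \<in> carrier F" "b \<in> carrier F"
        using T_mem[OF add(1) ab(1)] T_mem[OF add(2) ab(2)] .
      have "sp (Ext dec a) \<subseteq> Z" "sp (Ext dec b) \<subseteq> Z"
        using add(3,4) ab by blast+
      then show "sp (Ext dec g) \<subseteq> Z"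
        using sp_add[OF Ext_closed[OF F(1) dec_Pi] Ext_closed[OF F(2) dec_Pi]]
        unfolding ab(3) Ext_add[OF F dec_Pi] by blast
    qed
  next
    case (smult c s)
    have s: "s \<in> carrier T" "sp (Ext dec (rp s)) \<subseteq> Z"
      using smult S(2) by (auto simp: Z_def)
    have cF: "c \<odot>\<^bsub>F\<^esub> rp s \<in> carrier F"
      using smult rp s by (intro F_smult) auto
    show ?case
    proof
      fix g assume "g \<in> c \<odot>\<^bsub>T\<^esub> s"
      then have "g \<in> N +>\<^bsub>F\<^esub> (c \<odot>\<^bsub>F\<^esub> rp s)"
        by (simp add: T_simps(5) rp_def)
      then have "Ext dec g = kap c \<otimes> Ext dec (rp s)"
        using coset_Ext(2)[OF klinear_dec cF] Ext_smult[OF rp(2)[OF s(1)] smult(1) dec_Pi] by simp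
      then show "sp (Ext dec g) \<subseteq> Z"
        using sp_scale[OF smult(1) Ext_closed[OF rp(2)[OF s(1)] dec_Pi]] s(2) by simp
    qed
  qed
  \<comment> \<open>The tensor of y^2 r with 1. Modulo the kernel \<open>I\<close> it would lie in
    the span of \<open>S\<close>, so its image y^2 r would have its support inside \<open>Z\<close>,
    against the choice of \<open>r\<close>.\<close>
  define f where "f = delta alg K (enc (ysq \<otimes> r))"
  have f: "f \<in> carrier F" "Ext dec f = ysq \<otimes> r"
    using r dec_Pi by (simp_all add: f_def F_delta Ext_delta)
  then have "N +>\<^bsub>F\<^esub> f \<in> carrier T"
    unfolding T_simps(1) by blast
  then obtain s i where si: "s \<in> lspan K T S" "i \<in> I" "N +>\<^bsub>F\<^esub> f = s \<oplus>\<^bsub>T\<^esub> i"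
    using S' by metis
  then have "f \<in> s \<oplus>\<^bsub>T\<^esub> i"
    using coset_self[OF f(1)] by simp
  then obtain a b where ab: "a \<in> s" "b \<in> i" "f = a \<oplus>\<^bsub>F\<^esub> b"
    by (auto simp: T_simps(4))
  have F: "a \<in> carrier F" "b \<in> carrier F"
    using T_mem ab si(2) span[OF si(1)] by (auto simp: I_def)
  have "Ext dec b = \<zero>"
    using si(2) ab(2) by (simp add: I_def)
  then have "Ext dec f = Ext dec a"
    using F ab(3) dec_Pi by (simp add: Ext_add Ext_closed)
  then show False
    using span[OF si(1)] ab(1) f(2) r(2) by auto
qed

end

section \<open>Assembly of the counterexample\<close>

theorem theorem1p4:
  fixes k :: "'k ring"
  assumes "field k" and "algebraically_closed k" and "countable (carrier k)"
  shows "\<exists>A :: ('k, nat) module.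
           kalgebra k A \<and> finitely_generated k A \<and> right_goldie A \<and> \<not> simple_ring A \<and>
           just_infinite k A \<and> \<not> stably_just_infinite_in TYPE(nat set) k A"
proof -
  obtain K :: "nat set ring" and phi t where K: "field K" "countable (carrier K)"
    and phi: "phi \<in> ring_hom k K" and t: "t \<in> carrier K" "t \<notin> phi ` carrier k"
    and t_pow: "\<And>n :: nat. n > 0 \<Longrightarrow> t [^]\<^bsub>K\<^esub> n \<noteq> \<one>\<^bsub>K\<^esub>"
    using transcendental_extension[OF assms(1,3)] by blast
  interpret k: field k
    by fact
  interpret K: field K
    by fact
  have t0: "t \<noteq> \<zero>\<^bsub>K\<^esub>"
    using t(2) ring_hom_zero[OF phi k.ring_axioms K.ring_axioms] by (metis imageI k.zero_closed)
  interpret L: lamp_algebra K t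
    by unfold_locales (use K t t_pow t0 in auto)
  interpret ambient L.tga k K phi L.kap t L.one_plus_shift L.gens L.supp
  proof unfold_locales
    show "phi \<in> ring_hom k K" "t \<in> carrier K" "t \<notin> phi ` carrier k"
      by fact+
    show "L.kap \<in> ring_hom K L.tga"
      by (rule L.kap_hom)
    show "L.kap c \<otimes>\<^bsub>L.tga\<^esub> r = r \<otimes>\<^bsub>L.tga\<^esub> L.kap c" if "c \<in> carrier K" "r \<in> carrier L.tga" for c r
      using L.kap_central that by simp
    show "a = \<zero>\<^bsub>L.tga\<^esub> \<or> b = \<zero>\<^bsub>L.tga\<^esub>"
      if "a \<in> carrier L.tga" "b \<in> carrier L.tga" "a \<otimes>\<^bsub>L.tga\<^esub> b = \<zero>\<^bsub>L.tga\<^esub>" for a b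
      using L.conv_nonzero[of a b] that by auto
    show "\<exists>r\<in>carrier L.tga. \<exists>s\<in>carrier L.tga. r \<noteq> \<zero>\<^bsub>L.tga\<^esub> \<and> a \<otimes>\<^bsub>L.tga\<^esub> r = b \<otimes>\<^bsub>L.tga\<^esub> s"
      if "a \<in> carrier L.tga" "b \<in> carrier L.tga" "a \<noteq> \<zero>\<^bsub>L.tga\<^esub>" "b \<noteq> \<zero>\<^bsub>L.tga\<^esub>" for a b
      using L.tga_ore[of a b] that by simp
    show "J = carrier L.tga" if "ideal J L.tga" "J \<noteq> {\<zero>\<^bsub>L.tga\<^esub>}" for J
      using that by (rule L.tga_simple)
    show "finite L.gens" "L.gens \<subseteq> carrier L.tga"
      using L.finite_gens L.gens_fs by simp_all
    show "V = carrier L.tga"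
      if "V \<subseteq> carrier L.tga" "\<one>\<^bsub>L.tga\<^esub> \<in> V" "\<zero>\<^bsub>L.tga\<^esub> \<in> V"
        "\<And>a b. a \<in> V \<Longrightarrow> b \<in> V \<Longrightarrow> a \<oplus>\<^bsub>L.tga\<^esub> b \<in> V"
        "\<And>g a. g \<in> L.gens \<Longrightarrow> a \<in> V \<Longrightarrow> g \<otimes>\<^bsub>L.tga\<^esub> a \<in> V" for V
      using L.tga_generated[of V] that by simp
    show "L.one_plus_shift \<in> carrier L.tga" "L.one_plus_shift \<noteq> \<zero>\<^bsub>L.tga\<^esub>"
      using L.one_plus_shift_nonzero by simp_all
    show "L.one_plus_shift \<otimes>\<^bsub>L.tga\<^esub> r \<noteq> \<one>\<^bsub>L.tga\<^esub>" if "r \<in> carrier L.tga" for r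
      using L.one_plus_shift_no_right_inverse[of r] that by simp
    show "finite (L.supp r)" if "r \<in> carrier L.tga" for r
      using that by simp
    show "L.supp \<zero>\<^bsub>L.tga\<^esub> = {}"
      by simp
    show "L.supp (r \<oplus>\<^bsub>L.tga\<^esub> s) \<subseteq> L.supp r \<union> L.supp s"
      if "r \<in> carrier L.tga" "s \<in> carrier L.tga" for r s
      using L.supp_add[of r s] that by simp
    show "L.supp (L.kap c \<otimes>\<^bsub>L.tga\<^esub> r) \<subseteq> L.supp r" if "c \<in> carrier K" "r \<in> carrier L.tga" for c r
      using that by (auto simp: L.conv_kap L.supp_def)
    show "\<exists>r\<in>carrier L.tga. \<not> L.supp (q \<otimes>\<^bsub>L.tga\<^esub> r) \<subseteq> Z"
      if "q \<in> carrier L.tga" "q \<noteq> \<zero>\<^bsub>L.tga\<^esub>" "finite Z" for q Z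
      using L.supp_right_multiples_unbounded[of q Z] that by simp
    show "countable (carrier L.tga)"
      using L.countable_fs[OF K(2) countable_lamp] by simp
  qed
  have "\<not> stably_just_infinite_in TYPE(nat set) k alg"
    using not_just_infinite_tensor K(1) phi unfolding stably_just_infinite_in_def by blast
  then show ?thesis
    using alg_kalgebra alg_finitely_generated alg_right_goldie alg_not_simple alg_just_infinite
    by blast
qed

end
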